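(* Let $y:[0,1]\to\Omega_\mathbb{R}$ be a smooth path of control parameters, and let $z(0)\in\mathcal{LC}_{reg}$ with $\pi(z(0))=y(0)$ and $\dim T_{z(0)}\mathcal{LC}=\dim T_{y(0)}\Omega$, and suppose $y(t)\notin\mathcal{D}_\Omega$ for all $t\in[0,1]$, so that there is a smooth lifting $z:[0,1]\to\mathcal{LC}$ starting at $z(0)$ with $\pi(z(t))=y(t)$. If $z(0)$ is a strict local minimum (in the sense defined below), then $z(t)$ is a strict local minimum for every $t\in[0,1]$.
   Context: Elastic tensegrity framework: a graph on nodes $[n]=\{1,\dots,n\}$ with edge set $E=B\cup C$ (disjoint), $B$ the rigid bars and $C$ the elastic cables, embedded in dimension $d$ with node coordinates $p_i=(p_{i1},\dots,p_{id})$. The variables are $p_{ik}$ ($i\in[n],k\in[d]$), bar lengths $\ell_{ij}$ ($ij\in B$), cable resting lengths $r_{ij}$ ($ij\in C$) and cable elasticity constants $c_{ij}$ ($ij\in C$). These variables are partitioned into internal parameters $x\in X\cong\mathbb{C}^{m_1}$ and control parameters $y\in Y\cong\mathbb{C}^{m_2}$. Let $\Omega\subset Y$ be an affine subvariety with real part $\Omega_\mathbb{R}$, assumed to have the same dimension as $\Omega$. Introduce variables $\delta_{ij}$ ($ij\in C$) and $\lambda_{ij}$ ($ij\in E$). Set $g_{ij}=\ell_{ij}^2-\sum_{k}(p_{ik}-p_{jk})^2$ for $ij\in B$ and $g_{ij}=\delta_{ij}^2-\sum_k(p_{ik}-p_{jk})^2$ for $ij\in C$; let $\widetilde Q_y=\sum_{ij\in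 C}\tfrac12 c_{ij}(\delta_{ij}-r_{ij})^2$ and the Lagrangian $L_y(x,\delta,\lambda)=\widetilde Q_y+\sum_{ij\in E}\lambda_{ij}g_{ij}(x,\delta,y)$. It is assumed that for each $y$ the variety $\{(x,\delta):g(x,\delta,y)=0\}$ is a complete intersection. Let $dL_y$ be the polynomial map whose components are all partial derivatives of $L_y$ with respect to $x,\delta,\lambda$, let $\mathcal{L}_y=dL_y^{-1}(0)$, and $\mathcal{LC}=\{(x,\delta,\lambda,y): y\in\Omega,\ (x,\delta,\lambda)\in\mathcal{L}_y\}$, with $\mathcal{LC}_{reg}$ its (open dense) set of smooth points, $\mathcal{LC}_{sing}$ its singular locus, and $\mathcal{LC}_\mathbb{R}$ its real points. Let $\pi:\mathcal{LC}\to\Omega$, $(x,\delta,\lambda,y)\mapsto y$. The catastrophe discriminant $\mathcal{D}_\Omega\subset\Omega$ is the Zariski closure of the set of critical values of $\pi$, i.e. of points $\pi(z)$ with $z\in\mathcal{LC}_{sing}$ or with some nonzero tangent vector $v\in T_z\mathcal{LC}$ in the kernel of $d\pi_z$. Strict local minimum: let $d^2\widetilde Q$ and $d^2g_{ij}$ be the Hessians of $\widetilde Q_y$ and $g_{ij}$ with respect to the variables $(x,\delta)$, and $dg$ the Jacobian of $g=(g_{ij})_{ij\in E}$ with respect to $(x,\delta)$. A point $z=(x,\delta,\lambda,y)\in\mathcal{LC}_\mathbb{R}$ is called a strict local minimum if the projected Hessian $V^T\big[d^2\widetilde Q+\sum_{ij\in E}\lambda_{ij}d^2g_{ij}\big]V$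 is positive definite, where $V$ is a matrix whose columns form a real basis of the null space of $dg$ at $(x,\delta)$.
   Formalization: The smooth lifting z of the path y is assumed to exist on all of [0,1] instead of following from y(t) avoiding the discriminant, since a lift can escape to infinity (a multiplier can blow up); the claim is proved for every such lifting. *)

theory Defs
  imports "HOL-Analysis.Analysis"
begin

text \<open>Points of the affine space with coordinates indexed by the finite set W are
  functions that vanish outside W.\<close>

definition aspace :: "'v set \<Rightarrow> ('v \<Rightarrow> complex) set" where
  "aspace W = {z. \<forall>u. u \<notin> W \<longrightarrow> z u = 0}"

inductive_set poly_fun :: "'v set \<Rightarrow> (('v \<Rightarrow> complex) \<Rightarrow> complex) set" for W where
  pconst: "(\<lambda>z. c) \<in> poly_fun W"
| pvar: "v \<in> W \<Longrightarrow> (\<lambda>z. z v) \<in> poly_fun W"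
| padd: "f \<in> poly_fun W \<Longrightarrow> g \<in> poly_fun W \<Longrightarrow> (\<lambda>z. f z + g z) \<in> poly_fun W"
| pmult: "f \<in> poly_fun W \<Longrightarrow> g \<in> poly_fun W \<Longrightarrow> (\<lambda>z. f z * g z) \<in> poly_fun W"

definition pd :: "'v \<Rightarrow> (('v \<Rightarrow> complex) \<Rightarrow> complex) \<Rightarrow> ('v \<Rightarrow> complex) \<Rightarrow> complex" where
  "pd u f z = deriv (\<lambda>w. f (z(u := w))) (z u)"

definition zero_set :: "'v set \<Rightarrow> (('v \<Rightarrow> complex) \<Rightarrow> complex) set \<Rightarrow> ('v \<Rightarrow> complex) set" where
  "zero_set W P = {z \<in> aspace W. \<forall>f \<in> P. f z = 0}"

definition zclosed :: "'v set \<Rightarrow> ('v \<Rightarrow> complex) set \<Rightarrow> bool" where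
  "zclosed W S \<longleftrightarrow> (\<exists>P \<subseteq> poly_fun W. S = zero_set W P)"

definition zclosure :: "'v set \<Rightarrow> ('v \<Rightarrow> complex) set \<Rightarrow> ('v \<Rightarrow> complex) set" where
  "zclosure W S = \<Inter>{Z. zclosed W Z \<and> S \<subseteq> Z}"

definition zirreducible :: "'v set \<Rightarrow> ('v \<Rightarrow> complex) set \<Rightarrow> bool" where
  "zirreducible W Z \<longleftrightarrow> zclosed W Z \<and> Z \<noteq> {} \<and>
     (\<forall>Z1 Z2. zclosed W Z1 \<longrightarrow> zclosed W Z2 \<longrightarrow> Z = Z1 \<union> Z2 \<longrightarrow> Z = Z1 \<or> Z = Z2)"

definition vdim :: "'v set \<Rightarrow> ('v \<Rightarrow> complex) set \<Rightarrow> nat" where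
  "vdim W S = (GREATEST k. \<exists>Zs :: nat \<Rightarrow> ('v \<Rightarrow> complex) set.
      (\<forall>i\<le>k. zirreducible W (Zs i) \<and> Zs i \<subseteq> S) \<and> (\<forall>i<k. Zs i \<subset> Zs (Suc i)))"

definition local_dim :: "'v set \<Rightarrow> ('v \<Rightarrow> complex) set \<Rightarrow> ('v \<Rightarrow> complex) \<Rightarrow> nat" where
  "local_dim W S z = (GREATEST k. \<exists>Zs :: nat \<Rightarrow> ('v \<Rightarrow> complex) set.
      (\<forall>i\<le>k. zirreducible W (Zs i) \<and> Zs i \<subseteq> S) \<and> (\<forall>i<k. Zs i \<subset> Zs (Suc i)) \<and> z \<in> Zs 0)"

definition vanishing_ideal :: "'v set \<Rightarrow> ('v \<Rightarrow> complex) set \<Rightarrow> (('v \<Rightarrow> complex) \<Rightarrow> complex) set" where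
  "vanishing_ideal W S = {f \<in> poly_fun W. \<forall>s \<in> S. f s = 0}"

definition tangent_space :: "'v set \<Rightarrow> ('v \<Rightarrow> complex) set \<Rightarrow> ('v \<Rightarrow> complex) \<Rightarrow> ('v \<Rightarrow> complex) set" where
  "tangent_space W S z = {v \<in> aspace W. \<forall>f \<in> vanishing_ideal W S. (\<Sum>u\<in>W. pd u f z * v u) = 0}"

definition clin_indep :: "('v \<Rightarrow> complex) set \<Rightarrow> bool" where
  "clin_indep A \<longleftrightarrow> finite A \<and>
     (\<forall>c. (\<lambda>u. \<Sum>a\<in>A. c a * a u) = (\<lambda>_. 0) \<longrightarrow> (\<forall>a\<in>A. c a = 0))"

definition cdim :: "('v \<Rightarrow> complex) set \<Rightarrow> nat" where
  "cdim U = (GREATEST k. \<exists>A \<subseteq> U. clin_indep A \<and> card A = k)"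

definition is_real_pt :: "('v \<Rightarrow> complex) \<Rightarrow> bool" where
  "is_real_pt z \<longleftrightarrow> (\<forall>u. Im (z u) = 0)"

text \<open>Projection to the coordinates in Y (the map pi, also its differential).\<close>

definition proj :: "'v set \<Rightarrow> ('v \<Rightarrow> complex) \<Rightarrow> ('v \<Rightarrow> complex)" where
  "proj Y z = (\<lambda>u. if u \<in> Y then z u else 0)"

definition smooth_on :: "real set \<Rightarrow> (real \<Rightarrow> complex) \<Rightarrow> bool" where
  "smooth_on S f \<longleftrightarrow> (\<exists>D :: nat \<Rightarrow> real \<Rightarrow> complex. D 0 = f \<and>
     (\<forall>k. \<forall>t\<in>S. (D k has_vector_derivative D (Suc k) t) (at t within S)))"

text \<open>Coordinates: node coordinates p_ik, bar lengths l_e, cable resting lengths r_e,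
  elasticity constants c_e, auxiliary delta_e, Lagrange multipliers lambda_e.
  Nodes are 1..n, space coordinates 1..d, an edge ij is the pair (i,j) with i<j.\<close>

datatype coord = Pc nat nat | Ell "nat \<times> nat" | Rest "nat \<times> nat" | Elast "nat \<times> nat"
  | Dlt "nat \<times> nat" | Lam "nat \<times> nat"

definition tvars :: "nat \<Rightarrow> nat \<Rightarrow> (nat \<times> nat) set \<Rightarrow> (nat \<times> nat) set \<Rightarrow> coord set" where
  "tvars n d B C = {Pc i k | i k. i \<in> {1..n} \<and> k \<in> {1..d}} \<union> Ell ` B \<union> Rest ` C \<union> Elast ` C"

definition xd_vars :: "nat \<Rightarrow> nat \<Rightarrow> (nat \<times> nat) set \<Rightarrow> (nat \<times> nat) set \<Rightarrow> coord set \<Rightarrow> coord set" where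
  "xd_vars n d B C Y = (tvars n d B C - Y) \<union> Dlt ` C"

definition all_vars :: "nat \<Rightarrow> nat \<Rightarrow> (nat \<times> nat) set \<Rightarrow> (nat \<times> nat) set \<Rightarrow> coord set" where
  "all_vars n d B C = tvars n d B C \<union> Dlt ` C \<union> Lam ` (B \<union> C)"

definition gfun :: "nat \<Rightarrow> (nat \<times> nat) set \<Rightarrow> nat \<times> nat \<Rightarrow> (coord \<Rightarrow> complex) \<Rightarrow> complex" where
  "gfun d B e z = (if e \<in> B then (z (Ell e))\<^sup>2 else (z (Dlt e))\<^sup>2)
      - (\<Sum>k\<in>{1..d}. (z (Pc (fst e) k) - z (Pc (snd e) k))\<^sup>2)"

definition Qt :: "(nat \<times> nat) set \<Rightarrow> (coord \<Rightarrow> complex) \<Rightarrow> complex" where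
  "Qt C z = (\<Sum>e\<in>C. 1/2 * z (Elast e) * (z (Dlt e) - z (Rest e))\<^sup>2)"

definition Lag :: "nat \<Rightarrow> (nat \<times> nat) set \<Rightarrow> (nat \<times> nat) set \<Rightarrow> (coord \<Rightarrow> complex) \<Rightarrow> complex" where
  "Lag d B C z = Qt C z + (\<Sum>e\<in>B \<union> C. z (Lam e) * gfun d B e z)"

text \<open>The set LC (points are functions on all_vars; the control part is proj Y).\<close>

definition LC :: "nat \<Rightarrow> nat \<Rightarrow> (nat \<times> nat) set \<Rightarrow> (nat \<times> nat) set \<Rightarrow> coord set
    \<Rightarrow> (coord \<Rightarrow> complex) set \<Rightarrow> (coord \<Rightarrow> complex) set" where
  "LC n d B C Y Om = {z \<in> aspace (all_vars n d B C). proj Y z \<in> Om \<and>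
      (\<forall>u \<in> xd_vars n d B C Y \<union> Lam ` (B \<union> C). pd u (Lag d B C) z = 0)}"

definition LC_reg :: "nat \<Rightarrow> nat \<Rightarrow> (nat \<times> nat) set \<Rightarrow> (nat \<times> nat) set \<Rightarrow> coord set
    \<Rightarrow> (coord \<Rightarrow> complex) set \<Rightarrow> (coord \<Rightarrow> complex) set" where
  "LC_reg n d B C Y Om = {z \<in> LC n d B C Y Om.
      cdim (tangent_space (all_vars n d B C) (LC n d B C Y Om) z)
        = local_dim (all_vars n d B C) (LC n d B C Y Om) z}"

definition crit_values :: "nat \<Rightarrow> nat \<Rightarrow> (nat \<times> nat) set \<Rightarrow> (nat \<times> nat) set \<Rightarrow> coord set
    \<Rightarrow> (coord \<Rightarrow> complex) set \<Rightarrow> (coord \<Rightarrow> complex) set" where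
  "crit_values n d B C Y Om = {proj Y z | z. z \<in> LC n d B C Y Om \<and>
      (z \<notin> LC_reg n d B C Y Om \<or>
       (\<exists>v \<in> tangent_space (all_vars n d B C) (LC n d B C Y Om) z. v \<noteq> (\<lambda>_. 0) \<and> proj Y v = (\<lambda>_. 0)))}"

definition cat_disc :: "nat \<Rightarrow> nat \<Rightarrow> (nat \<times> nat) set \<Rightarrow> (nat \<times> nat) set \<Rightarrow> coord set
    \<Rightarrow> (coord \<Rightarrow> complex) set \<Rightarrow> (coord \<Rightarrow> complex) set" where
  "cat_disc n d B C Y Om = zclosure Y (crit_values n d B C Y Om)"

text \<open>Strict local minimum: projected Hessian V^T [d^2 Q + sum lambda d^2 g] V positive
  definite, V a matrix (columns Vs 0, ..., Vs (m-1)) whose columns form a real basis of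
  the null space of dg.  At real points these derivatives are real; Re is used to
  view them as real numbers.\<close>

definition hess_entry :: "nat \<Rightarrow> (nat \<times> nat) set \<Rightarrow> (nat \<times> nat) set \<Rightarrow> (coord \<Rightarrow> complex)
    \<Rightarrow> coord \<Rightarrow> coord \<Rightarrow> complex" where
  "hess_entry d B C z u w = pd u (pd w (Qt C)) z
      + (\<Sum>e\<in>B \<union> C. z (Lam e) * pd u (pd w (gfun d B e)) z)"

definition dg_null :: "nat \<Rightarrow> nat \<Rightarrow> (nat \<times> nat) set \<Rightarrow> (nat \<times> nat) set \<Rightarrow> coord set
    \<Rightarrow> (coord \<Rightarrow> complex) \<Rightarrow> (coord \<Rightarrow> real) set" where
  "dg_null n d B C Y z = {v. (\<forall>u. u \<notin> xd_vars n d B C Y \<longrightarrow> v u = 0) \<and>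
      (\<forall>e \<in> B \<union> C. (\<Sum>u\<in>xd_vars n d B C Y. Re (pd u (gfun d B e) z) * v u) = 0)}"

definition is_real_basis :: "(coord \<Rightarrow> real) set \<Rightarrow> nat \<Rightarrow> (nat \<Rightarrow> coord \<Rightarrow> real) \<Rightarrow> bool" where
  "is_real_basis N m Vs \<longleftrightarrow> (\<forall>a<m. Vs a \<in> N) \<and>
     (\<forall>c. (\<forall>u. (\<Sum>a<m. c a * Vs a u) = 0) \<longrightarrow> (\<forall>a<m. c a = 0)) \<and>
     (\<forall>v\<in>N. \<exists>c. \<forall>u. v u = (\<Sum>a<m. c a * Vs a u))"

definition strict_local_min :: "nat \<Rightarrow> nat \<Rightarrow> (nat \<times> nat) set \<Rightarrow> (nat \<times> nat) set \<Rightarrow> coord set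
    \<Rightarrow> (coord \<Rightarrow> complex) set \<Rightarrow> (coord \<Rightarrow> complex) \<Rightarrow> bool" where
  "strict_local_min n d B C Y Om z \<longleftrightarrow> z \<in> LC n d B C Y Om \<and> is_real_pt z \<and>
     (\<exists>m Vs. is_real_basis (dg_null n d B C Y z) m Vs \<and>
        (\<forall>c::nat \<Rightarrow> real. (\<exists>a<m. c a \<noteq> 0) \<longrightarrow>
           0 < (\<Sum>a<m. \<Sum>b<m. c a * c b *
                  (\<Sum>u\<in>xd_vars n d B C Y. \<Sum>w\<in>xd_vars n d B C Y.
                      Vs a u * Re (hess_entry d B C z u w) * Vs b w))))"

end

theory Submission
  imports Defs "HOL-Computational_Algebra.Polynomial"
begin

text \<open>
  Away from the discriminant the projection from \<open>LC\<close> to the controls is injective near every point: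
  two sequences of distinct points with equal projections and a common limit would produce, as limit of
  normalised differences, a tangent vector killed by the projection. Applied to changes of the
  multipliers alone, this makes the constraint gradients independent; applied to the complex conjugate
  lift, it keeps the path real.

  Positivity of the projected Hessian is an open condition along the path. If it were lost in a limit
  \<open>t*\<close>, the Hessian of the Lagrangian with respect to all unknowns would be singular at \<open>z(t*)\<close>, although
  it is nonsingular at nearby earlier times. The reduced tangent space does not see this directly,
  because the gradient system may cut out \<open>LC\<close> with multiplicity; what excludes it is conservation of the
  number of zeros. An isolated singular zero of a square polynomial system has small perturbations with
  two nonsingular zeros nearby. Joining such a perturbation to the gradient system at a nearby time by a
  complex line, perturbed generically so that only finitely many members have a singular zero, the
  property of having two zeros in a fixed polydisc propagates to the latter system, against local
  injectivity of the projection. The perturbation is chosen off a discriminant, whose existence is a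
  count of parameters: \<open>N\<^sup>2 + N + 1\<close> polynomials in \<open>N\<^sup>2 + N\<close> variables are algebraically dependent.
\<close>

section \<open>Linear systems over finite index sets\<close>

text \<open>A degenerate limit is refuted by exhibiting two distinct points of \<open>LC\<close>
  over one control, so only pairs of zeros are followed and no local degree is ever defined. The
  joining line is complex although the framework is real because finitely many bad parameters cut a
  real segment but leave a disc connected. Perturbing by a full matrix \<open>A\<close> besides the
  constant \<open>c\<close> lets both conditions at a singular zero, the zero equation and the
  kernel equation, be solved for parameters; the bad parameters are then contained in images of
  polynomial maps from a space with fewer coordinates, and counting monomials suffices to enclose
  them in a hypersurface. The nonsingularity of nearby earlier points is the classical fact that a
  Hessian positive on the null space of independent constraints makes the bordered Hessian
  invertible. Throughout, kernel vectors take the place of determinants, minimisation of residuals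
  that of the implicit function theorem, and convergent subsequences on finitely many coordinates
  that of compactness.\<close>

lemma underdetermined_system_has_nonzero_solution:
  fixes M :: "'i \<Rightarrow> 'j \<Rightarrow> 'k::field"
  assumes "finite J" "finite I" "card J < card I"
  shows "\<exists>c. (\<exists>i\<in>I. c i \<noteq> 0) \<and> (\<forall>j\<in>J. (\<Sum>i\<in>I. M i j * c i) = 0)"
  using assms
proof (induction J arbitrary: I M rule: finite_induct)
  case empty
  then have "I \<noteq> {}" by auto
  then show ?case by (intro exI[of _ "\<lambda>_. 1"]) auto
next
  case (insert j J)
  show ?case
  proof (cases "\<forall>i\<in>I. M i j = 0")
    case True
    have "card J < card I" using insert by simp
    from insert.IH[OF insert.prems(1) this, of M] obtain c where
      "\<exists>i\<in>I. c i \<noteq> 0" "\<forall>j\<in>J. (\<Sum>i\<in>I. M i j * c i) = 0" by blast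
    then show ?thesis using True by (intro exI[of _ c]) auto
  next
    case False
    then obtain i0 where i0: "i0 \<in> I" "M i0 j \<noteq> 0" by blast
    define I' where "I' = I - {i0}"
    have finI': "finite I'" and cardI': "card J < card I'"
      using insert i0 by (auto simp: I'_def)
    \<comment> \<open>Gaussian elimination, where \<open>M i j\<close> is the coefficient of unknown
      \<open>i\<close> in equation \<open>j\<close>: equation \<open>j\<close> is solved for the
      unknown \<open>i0\<close>, and \<open>M'\<close> holds the coefficients of the other equations
      after substitution.\<close>
    define M' where "M' i k = M i k - M i j / M i0 j * M i0 k" for i k
    from insert.IH[OF finI' cardI', of M'] obtain c where
      c: "\<exists>i\<in>I'. c i \<noteq> 0" "\<forall>k\<in>J. (\<Sum>i\<in>I'. M' i k * c i) = 0" by blast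
    define s where "s = (\<Sum>i\<in>I'. M i j * c i)"
    define c' where "c' = c(i0 := - s / M i0 j)"
    have split: "(\<Sum>i\<in>I. M i k * c' i) = M i0 k * (- s / M i0 j) + (\<Sum>i\<in>I'. M i k * c i)" for k
    proof -
      have "(\<Sum>i\<in>I. M i k * c' i) = M i0 k * c' i0 + (\<Sum>i\<in>I'. M i k * c' i)"
        unfolding I'_def using insert.prems(1) i0(1) by (simp add: sum.remove)
      moreover have "(\<Sum>i\<in>I'. M i k * c' i) = (\<Sum>i\<in>I'. M i k * c i)"
        by (intro sum.cong) (auto simp: c'_def I'_def)
      ultimately show ?thesis by (simp add: c'_def)
    qed
    have "(\<Sum>i\<in>I. M i j * c' i) = 0"
      using i0(2) by (simp add: split s_def)
    moreover have "(\<Sum>i\<in>I. M i k * c' i) = 0" if "k \<in> J" for k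
    proof -
      have "0 = (\<Sum>i\<in>I'. M' i k * c i)" using c that by simp
      also have "\<dots> = (\<Sum>i\<in>I'. M i k * c i) - (\<Sum>i\<in>I'. M i0 k / M i0 j * (M i j * c i))"
        unfolding sum_subtractf[symmetric] M'_def by (intro sum.cong) (auto simp: field_simps)
      also have "\<dots> = (\<Sum>i\<in>I'. M i k * c i) - M i0 k / M i0 j * s"
        unfolding s_def sum_distrib_left ..
      finally show ?thesis unfolding split by simp
    qed
    moreover have "\<exists>i\<in>I. c' i \<noteq> 0" using c(1) by (auto simp: c'_def I'_def)
    ultimately show ?thesis by (intro exI[of _ c']) auto
  qed
qed

text \<open>Adjoining \<open>b\<close> as a further column gives one unknown more than equations. In
  a nontrivial relation the coefficient of \<open>b\<close> is nonzero, since otherwise injectivity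
  would kill all the others; dividing by it yields the solution.\<close>

lemma injective_square_system_solvable:
  fixes A :: "'v \<Rightarrow> 'v \<Rightarrow> 'k::field"
  assumes "finite X"
    and inj: "\<And>x. \<forall>i\<in>X. (\<Sum>k\<in>X. A i k * x k) = 0 \<Longrightarrow> \<forall>k\<in>X. x k = 0"
  shows "\<exists>x. \<forall>i\<in>X. (\<Sum>k\<in>X. A i k * x k) = b i"
proof -
  define I where "I = insert None (Some ` X)"
  have card: "card X < card I"
    using assms(1) by (simp add: I_def card_image)
  define M where "M o' i = (case o' of None \<Rightarrow> b i | Some k \<Rightarrow> A i k)" for o' i
  from underdetermined_system_has_nonzero_solution[OF assms(1) _ card, of M] obtain c where
    c: "\<exists>i\<in>I. c i \<noteq> 0" "\<forall>j\<in>X. (\<Sum>i\<in>I. M i j * c i) = 0"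
    using assms(1) by (auto simp: I_def)
  have eq: "b j * c None + (\<Sum>k\<in>X. A j k * c (Some k)) = 0" if "j \<in> X" for j
  proof -
    have "(\<Sum>i\<in>I. M i j * c i) = b j * c None + (\<Sum>k\<in>X. A j k * c (Some k))"
      using assms(1) by (simp add: I_def M_def sum.reindex)
    then show ?thesis using c(2) that by simp
  qed
  have "c None \<noteq> 0"
  proof
    assume "c None = 0"
    have "\<forall>i\<in>X. (\<Sum>k\<in>X. A i k * c (Some k)) = 0"
      using eq \<open>c None = 0\<close> by auto
    from inj[OF this] have "\<forall>k\<in>X. c (Some k) = 0" .
    with \<open>c None = 0\<close> c(1) show False by (auto simp: I_def)
  qed
  show ?thesis
  proof (intro exI[of _ "\<lambda>k. - c (Some k) / c None"] ballI)
    fix i assume "i \<in> X"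
    have "(\<Sum>k\<in>X. A i k * (- c (Some k) / c None)) = - (\<Sum>k\<in>X. A i k * c (Some k)) / c None"
      by (simp add: sum_negf sum_divide_distrib)
    also have "\<dots> = b i"
    proof -
      have "- (\<Sum>k\<in>X. A i k * c (Some k)) = b i * c None"
        using eq[OF \<open>i \<in> X\<close>] by (metis add.commute add.inverse_unique)
      then show ?thesis using \<open>c None \<noteq> 0\<close> by simp
    qed
    finally show "(\<Sum>k\<in>X. A i k * (- c (Some k) / c None)) = b i" .
  qed
qed

text \<open>For the Gram matrix \<open>A\<close> of the rows, \<open>x . A x\<close> is the squared
  length of the combination of the rows with coefficients \<open>x\<close>. Hence \<open>A\<close>
  is injective, and combining the rows with the columns of its inverse gives the right inverse.
  Positivity of squares ties this to the reals.\<close>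

lemma independent_rows_right_inverse:
  fixes D :: "'e \<Rightarrow> 'v \<Rightarrow> real"
  assumes "finite E" "finite X"
    and rows: "\<And>m. \<forall>u\<in>X. (\<Sum>e\<in>E. m e * D e u) = 0 \<Longrightarrow> \<forall>e\<in>E. m e = 0"
  shows "\<exists>b. \<forall>e\<in>E. \<forall>e'\<in>E. (\<Sum>u\<in>X. D e' u * b e u) = (if e' = e then 1 else 0)"
proof -
  define A where "A e e' = (\<Sum>u\<in>X. D e u * D e' u)" for e e'
  have Ax: "(\<Sum>e'\<in>E. A e e' * x e') = (\<Sum>u\<in>X. D e u * (\<Sum>e'\<in>E. x e' * D e' u))" for e x
    unfolding A_def sum_distrib_right sum_distrib_left
    by (subst sum.swap) (simp add: mult_ac)
  have inj: "\<forall>e\<in>E. x e = 0" if *: "\<forall>e\<in>E. (\<Sum>e'\<in>E. A e e' * x e') = 0" for x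
  proof (rule rows)
    have "0 = (\<Sum>e\<in>E. x e * (\<Sum>e'\<in>E. A e e' * x e'))" using * by simp
    also have "\<dots> = (\<Sum>e\<in>E. \<Sum>u\<in>X. x e * D e u * (\<Sum>e'\<in>E. x e' * D e' u))"
      unfolding Ax by (simp add: sum_distrib_left mult_ac)
    also have "\<dots> = (\<Sum>u\<in>X. \<Sum>e\<in>E. x e * D e u * (\<Sum>e'\<in>E. x e' * D e' u))"
      by (rule sum.swap)
    also have "\<dots> = (\<Sum>u\<in>X. (\<Sum>e'\<in>E. x e' * D e' u)\<^sup>2)"
      by (simp add: sum_distrib_right[symmetric] power2_eq_square)
    finally have "(\<Sum>u\<in>X. (\<Sum>e'\<in>E. x e' * D e' u)\<^sup>2) = 0" by simp
    then show "\<forall>u\<in>X. (\<Sum>e\<in>E. x e * D e u) = 0"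
      using assms(2) by (subst (asm) sum_nonneg_eq_0_iff) auto
  qed
  have "\<exists>x. \<forall>e'\<in>E. (\<Sum>k\<in>E. A e' k * x k) = (if e' = e then 1 else 0)" for e
    by (rule injective_square_system_solvable[OF assms(1) inj])
  then obtain x where x: "\<And>e e'. e' \<in> E \<Longrightarrow> (\<Sum>k\<in>E. A e' k * x e k) = (if e' = e then 1 else 0)"
    by metis
  show ?thesis
    by (intro exI[of _ "\<lambda>e u. \<Sum>k\<in>E. x e k * D k u"] ballI)
       (simp add: Ax[symmetric] x)
qed

text \<open>Let \<open>T\<close> be the inverse of \<open>R\<close> times \<open>S\<close>. If
  \<open>S + m R\<close> has a kernel, then \<open>- m\<close> is an eigenvalue of \<open>T\<close>.
  The powers of \<open>T\<close> up to exponent \<open>card (X \<times> X)\<close> outnumber the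
  matrix entries, so they satisfy a linear relation, and every eigenvalue is a root of that
  polynomial.\<close>

lemma finite_singular_parameters:
  fixes S R :: "'v \<Rightarrow> 'v \<Rightarrow> complex"
  assumes fin: "finite X"
    and inj: "\<And>x. \<forall>i\<in>X. (\<Sum>k\<in>X. R i k * x k) = 0 \<Longrightarrow> \<forall>k\<in>X. x k = 0"
  shows "finite {m. \<exists>x. (\<exists>u\<in>X. x u \<noteq> 0) \<and> (\<forall>i\<in>X. (\<Sum>k\<in>X. (S i k + m * R i k) * x k) = 0)}"
proof -
  have "\<exists>x. \<forall>i\<in>X. (\<Sum>k\<in>X. R i k * x k) = S i j" for j
    by (rule injective_square_system_solvable[OF fin inj])
  then obtain T0 where T0: "\<And>i j. i \<in> X \<Longrightarrow> (\<Sum>k\<in>X. R i k * T0 j k) = S i j" by metis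
  define T where "T k j = T0 j k" for k j
  define P where "P = rec_nat (\<lambda>i k. if i = k then 1 else (0::complex)) (\<lambda>n Q i k. \<Sum>l\<in>X. T i l * Q l k)"
  have P0: "P 0 i k = (if i = k then 1 else 0)" and PS: "P (Suc n) i k = (\<Sum>l\<in>X. T i l * P n l k)" for i k n
    by (simp_all add: P_def)
  define r where "r = card (X \<times> X)"
  have "\<exists>c. (\<exists>n\<in>{..r}. c n \<noteq> 0) \<and> (\<forall>ik\<in>X\<times>X. (\<Sum>n\<in>{..r}. P n (fst ik) (snd ik) * c n) = 0)"
    by (rule underdetermined_system_has_nonzero_solution) (use fin in \<open>auto simp: r_def\<close>)
  then obtain c where c: "\<exists>n\<le>r. c n \<noteq> 0"
    "\<And>i k. i \<in> X \<Longrightarrow> k \<in> X \<Longrightarrow> (\<Sum>n\<le>r. P n i k * c n) = 0" by auto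
  have "finite {m. (\<Sum>n\<le>r. c n * m ^ n) = 0}"
    using c(1) polyfun_rootbound by blast
  then have "finite (uminus ` {m. (\<Sum>n\<le>r. c n * m ^ n) = 0})" by simp
  moreover have "{m. \<exists>x. (\<exists>u\<in>X. x u \<noteq> 0) \<and> (\<forall>i\<in>X. (\<Sum>k\<in>X. (S i k + m * R i k) * x k) = 0)}
    \<subseteq> uminus ` {m. (\<Sum>n\<le>r. c n * m ^ n) = 0}"
  proof safe
    fix m x u assume u: "u \<in> X" "x u \<noteq> 0"
      and x: "\<forall>i\<in>X. (\<Sum>k\<in>X. (S i k + m * R i k) * x k) = 0"
    have "\<forall>i\<in>X. (\<Sum>k\<in>X. R i k * ((\<Sum>j\<in>X. T k j * x j) + m * x k)) = 0"
    proof
      fix i assume i: "i \<in> X"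
      have "(\<Sum>k\<in>X. R i k * (\<Sum>j\<in>X. T k j * x j)) = (\<Sum>j\<in>X. (\<Sum>k\<in>X. R i k * T k j) * x j)"
        unfolding sum_distrib_left sum_distrib_right by (subst sum.swap) (simp add: mult_ac)
      also have "\<dots> = (\<Sum>j\<in>X. S i j * x j)" using T0[OF i] by (simp add: T_def)
      finally show "(\<Sum>k\<in>X. R i k * ((\<Sum>j\<in>X. T k j * x j) + m * x k)) = 0"
        using x i by (simp add: distrib_left distrib_right sum.distrib mult_ac)
    qed
    from inj[OF this] have eig: "(\<Sum>j\<in>X. T k j * x j) = - m * x k" if "k \<in> X" for k
      using that by (simp add: add_eq_0_iff)
    have pw: "i \<in> X \<Longrightarrow> (\<Sum>k\<in>X. P n i k * x k) = (- m) ^ n * x i" for n i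
    proof (induction n arbitrary: i)
      case 0
      have "(\<Sum>k\<in>X. P 0 i k * x k) = (\<Sum>k\<in>X. if k = i then x k else 0)"
        by (rule sum.cong) (auto simp: P0)
      then show ?case using 0 fin by simp
    next
      case (Suc n)
      have "(\<Sum>k\<in>X. P (Suc n) i k * x k) = (\<Sum>l\<in>X. T i l * (\<Sum>k\<in>X. P n l k * x k))"
        unfolding PS sum_distrib_left sum_distrib_right by (subst sum.swap) (simp add: mult_ac)
      also have "\<dots> = (\<Sum>l\<in>X. (- m) ^ n * (T i l * x l))"
        using Suc.IH by (intro sum.cong) (auto simp: mult_ac)
      also have "\<dots> = (- m) ^ n * (- m * x i)"
        using eig[OF Suc.prems] by (simp add: sum_distrib_left[symmetric])
      finally show ?case by simp
    qed
    have "0 = (\<Sum>k\<in>X. (\<Sum>n\<le>r. P n u k * c n) * x k)" using c(2) u(1) by simp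
    also have "\<dots> = (\<Sum>n\<le>r. c n * (\<Sum>k\<in>X. P n u k * x k))"
      unfolding sum_distrib_left sum_distrib_right by (subst sum.swap) (simp add: mult_ac)
    also have "\<dots> = (\<Sum>n\<le>r. c n * (- m) ^ n) * x u"
      unfolding pw[OF u(1)] sum_distrib_right by (simp add: mult_ac)
    finally have "(\<Sum>n\<le>r. c n * (- m) ^ n) = 0" using u(2) by simp
    then show "m \<in> uminus ` {m. (\<Sum>n\<le>r. c n * m ^ n) = 0}"
      by (intro image_eqI[of _ _ "-m"]) auto
  qed
  ultimately show ?thesis by (rule finite_subset[rotated])
qed

section \<open>Calculus of polynomial functions\<close>

lemma poly_fun_mono: "f \<in> poly_fun W \<Longrightarrow> W \<subseteq> W' \<Longrightarrow> f \<in> poly_fun W'"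
  by (induction rule: poly_fun.induct) (auto intro: poly_fun.intros)

lemma poly_fun_uminus: "f \<in> poly_fun W \<Longrightarrow> (\<lambda>z. - f z) \<in> poly_fun W"
  using pmult[OF pconst[of "-1"], of f W] by simp

lemma poly_fun_diff: "f \<in> poly_fun W \<Longrightarrow> g \<in> poly_fun W \<Longrightarrow> (\<lambda>z. f z - g z) \<in> poly_fun W"
  using padd[OF _ poly_fun_uminus, of f W g] by simp

lemma poly_fun_sum: "(\<And>i. i \<in> I \<Longrightarrow> f i \<in> poly_fun W) \<Longrightarrow> (\<lambda>z. \<Sum>i\<in>I. f i z) \<in> poly_fun W"
  by (induction I rule: infinite_finite_induct) (auto intro: padd pconst)

lemma poly_fun_prod: "(\<And>i. i \<in> I \<Longrightarrow> f i \<in> poly_fun W) \<Longrightarrow> (\<lambda>z. \<Prod>i\<in>I. f i z) \<in> poly_fun W"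
  by (induction I rule: infinite_finite_induct) (auto intro: pmult pconst)

lemma poly_fun_power: "f \<in> poly_fun W \<Longrightarrow> (\<lambda>z. f z ^ n) \<in> poly_fun W"
  by (induction n) (auto intro: pmult pconst)

lemmas poly_fun_intros = pconst pvar padd pmult poly_fun_uminus poly_fun_diff poly_fun_sum
  poly_fun_prod poly_fun_power

lemma poly_fun_subst:
  assumes "f \<in> poly_fun W" "\<And>u. u \<in> W \<Longrightarrow> (\<lambda>z. g u z) \<in> poly_fun W'"
  shows "(\<lambda>z. f (\<lambda>u. g u z)) \<in> poly_fun W'"
  using assms by (induction rule: poly_fun.induct) (auto intro: poly_fun.intros)

lemma poly_fun_cong:
  assumes "f \<in> poly_fun W" "\<And>u. u \<in> W \<Longrightarrow> z u = z' u"
  shows "f z = f z'"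
  using assms by (induction rule: poly_fun.induct) auto

lemma tendsto_poly_fun:
  assumes "f \<in> poly_fun W" "\<And>u. u \<in> W \<Longrightarrow> ((\<lambda>x. z x u) \<longlongrightarrow> l u) F"
  shows "((\<lambda>x. f (z x)) \<longlongrightarrow> f l) F"
  using assms by (induction rule: poly_fun.induct) (auto intro: tendsto_intros)

lemma poly_fun_field_differentiable:
  assumes "f \<in> poly_fun W"
  shows "(\<lambda>w. f (z(u := w))) field_differentiable at a"
  using assms
proof (induction rule: poly_fun.induct)
  case (pvar v)
  then show ?case by (cases "u = v") (auto intro: field_differentiable_ident)
qed (auto intro: field_differentiable_add field_differentiable_mult)

lemma pd_const: "pd u (\<lambda>z. c) z = 0"
  by (simp add: pd_def)

lemma pd_var: "pd u (\<lambda>z. z v) z = (if u = v then 1 else 0)"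
  by (simp add: pd_def)

lemma pd_add:
  assumes "f \<in> poly_fun W" "g \<in> poly_fun W"
  shows "pd u (\<lambda>z. f z + g z) z = pd u f z + pd u g z"
  unfolding pd_def using assms by (intro deriv_add poly_fun_field_differentiable)

lemma pd_mult:
  assumes "f \<in> poly_fun W" "g \<in> poly_fun W"
  shows "pd u (\<lambda>z. f z * g z) z = f z * pd u g z + pd u f z * g z"
  unfolding pd_def using assms
  by (subst deriv_mult) (auto intro: poly_fun_field_differentiable)

lemma pd_uminus:
  assumes "f \<in> poly_fun W"
  shows "pd u (\<lambda>z. - f z) z = - pd u f z"
  using pd_mult[OF pconst[of "-1"] assms] by (simp add: pd_const)

lemma pd_diff:
  assumes "f \<in> poly_fun W" "g \<in> poly_fun W"
  shows "pd u (\<lambda>z. f z - g z) z = pd u f z - pd u g z"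
  using pd_add[OF assms(1) poly_fun_uminus[OF assms(2)]] pd_uminus[OF assms(2)] by simp

lemma pd_sum:
  assumes "\<And>i. i \<in> I \<Longrightarrow> f i \<in> poly_fun W"
  shows "pd u (\<lambda>z. \<Sum>i\<in>I. f i z) z = (\<Sum>i\<in>I. pd u (f i) z)"
  using assms
proof (induction I rule: infinite_finite_induct)
  case (insert i I)
  have "pd u (\<lambda>z. \<Sum>i\<in>insert i I. f i z) z = pd u (\<lambda>z. f i z + (\<Sum>i\<in>I. f i z)) z"
    using insert by simp
  also have "\<dots> = pd u (f i) z + pd u (\<lambda>z. \<Sum>i\<in>I. f i z) z"
    using insert.prems by (intro pd_add poly_fun_sum) auto
  finally show ?case using insert by simp
qed (auto simp: pd_const)

lemma poly_fun_pd:
  assumes "f \<in> poly_fun W"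
  shows "(\<lambda>z. pd u f z) \<in> poly_fun W"
  using assms
  by (induction rule: poly_fun.induct)
     (auto simp: pd_const pd_var pd_add pd_mult intro: poly_fun.intros)

lemma pd_notin:
  assumes "f \<in> poly_fun W" "u \<notin> W"
  shows "pd u f z = 0"
  using assms by (induction rule: poly_fun.induct) (auto simp: pd_const pd_var pd_add pd_mult)

lemma pd_commute:
  assumes "f \<in> poly_fun W"
  shows "pd u (pd v f) z = pd v (pd u f) z"
  using assms
proof (induction arbitrary: z rule: poly_fun.induct)
  case (pconst c)
  have "pd w (\<lambda>z. c) = (\<lambda>z. 0)" for w :: 'a by (auto simp: pd_const)
  then show ?case by (simp add: pd_const)
next
  case (pvar x)
  have "pd w (\<lambda>z. z x) = (\<lambda>z. if w = x then 1 else 0)" for w :: 'a by (auto simp: pd_var)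
  then show ?case by (simp add: pd_const)
next
  case (padd f g)
  have "pd w (\<lambda>z. f z + g z) = (\<lambda>z. pd w f z + pd w g z)" for w
    using padd by (auto simp: pd_add)
  then show ?case using padd by (simp add: pd_add[OF poly_fun_pd poly_fun_pd])
next
  case (pmult f g)
  have 1: "pd w (\<lambda>z. f z * g z) = (\<lambda>z. f z * pd w g z + pd w f z * g z)" for w
    using pmult by (auto simp: pd_mult)
  have 2: "pd x (\<lambda>z. f z * pd w g z + pd w f z * g z) z
     = f z * pd x (pd w g) z + pd x f z * pd w g z + (pd w f z * pd x g z + pd x (pd w f) z * g z)" for x w
    using pmult by (subst pd_add) (auto intro!: poly_fun_intros poly_fun_pd simp: pd_mult[OF _ poly_fun_pd] pd_mult[OF poly_fun_pd])
  show ?case unfolding 1 2 using pmult by simp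
qed

lemma pd_reindex:
  assumes "f \<in> poly_fun W" "inj g"
  shows "pd (g k) (\<lambda>z. f (\<lambda>u. z (g u))) z = pd k f (\<lambda>u. z (g u))"
proof -
  have "(\<lambda>u. (z(g k := w)) (g u)) = (\<lambda>u. z (g u))(k := w)" for w
    using assms(2) by (auto simp: fun_eq_iff inj_def)
  then show ?thesis by (simp add: pd_def)
qed

text \<open>Both points of the quotient move, with a common limit \<open>l\<close>, as is needed for
  zeros that merge. Only the convergence of the coordinate differences scaled by \<open>s\<close>
  enters; the product rule carries the induction.\<close>

lemma poly_fun_difference_quotient:
  fixes s :: "'a \<Rightarrow> complex"
  assumes "finite W" "f \<in> poly_fun W"
    and "\<And>u. u \<in> W \<Longrightarrow> ((\<lambda>x. z x u) \<longlongrightarrow> l u) F"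
    and "\<And>u. u \<in> W \<Longrightarrow> ((\<lambda>x. z' x u) \<longlongrightarrow> l u) F"
    and "\<And>u. u \<in> W \<Longrightarrow> ((\<lambda>x. (z x u - z' x u) / s x) \<longlongrightarrow> v u) F"
  shows "((\<lambda>x. (f (z x) - f (z' x)) / s x) \<longlongrightarrow> (\<Sum>u\<in>W. pd u f l * v u)) F"
  using assms(2)
proof (induction rule: poly_fun.induct)
  case (pconst c)
  then show ?case by (simp add: pd_const)
next
  case (pvar w)
  have "(\<Sum>u\<in>W. pd u (\<lambda>z. z w) l * v u) = v w"
    using pvar assms(1) by (simp add: pd_var if_distrib[of "\<lambda>x. x * _"] cong: if_cong)
  then show ?case using assms(5)[OF pvar] by simp
next
  case (padd f g)
  have "(\<Sum>u\<in>W. pd u (\<lambda>z. f z + g z) l * v u) = (\<Sum>u\<in>W. pd u f l * v u) + (\<Sum>u\<in>W. pd u g l * v u)"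
    using padd by (simp add: pd_add distrib_right sum.distrib)
  moreover have "(\<lambda>x. (f (z x) + g (z x) - (f (z' x) + g (z' x))) / s x) =
     (\<lambda>x. (f (z x) - f (z' x)) / s x + (g (z x) - g (z' x)) / s x)"
    by (auto simp: add_divide_distrib[symmetric])
  ultimately show ?case using tendsto_add[OF padd.IH] by simp
next
  case (pmult f g)
  have 1: "(\<Sum>u\<in>W. pd u (\<lambda>z. f z * g z) l * v u) =
     (\<Sum>u\<in>W. pd u f l * v u) * g l + f l * (\<Sum>u\<in>W. pd u g l * v u)"
    unfolding sum_distrib_left sum_distrib_right sum.distrib[symmetric]
    using pmult by (intro sum.cong) (auto simp: pd_mult algebra_simps)
  have 2: "(\<lambda>x. (f (z x) * g (z x) - (f (z' x) * g (z' x))) / s x) =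
     (\<lambda>x. (f (z x) - f (z' x)) / s x * g (z x) + f (z' x) * ((g (z x) - g (z' x)) / s x))"
    by (auto simp: add_divide_distrib[symmetric] algebra_simps)
  show ?case unfolding 1 2
    by (intro tendsto_add tendsto_mult pmult.IH tendsto_poly_fun[OF pmult.hyps(1)]
        tendsto_poly_fun[OF pmult.hyps(2)] assms)
qed

text \<open>Conjugating argument and value of a holomorphic function conjugates its derivative, and
  an \<open>f\<close> that commutes with conjugation is its own conjugate. This makes derivatives
  real at real points and sends critical points to critical points.\<close>

lemma pd_cnj:
  assumes "f \<in> poly_fun W" and cnj: "\<And>z. f (\<lambda>u. cnj (z u)) = cnj (f z)"
  shows "pd u f (\<lambda>u. cnj (z u)) = cnj (pd u f z)"
proof -
  have d: "((\<lambda>w. f (z(u := w))) has_field_derivative pd u f z) (at (z u))"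
    unfolding pd_def using poly_fun_field_differentiable[OF assms(1)]
    by (simp add: field_differentiable_derivI)
  have "(cnj \<circ> (\<lambda>w. f (z(u := w))) \<circ> cnj has_field_derivative cnj (pd u f z)) (at (cnj (z u)))"
    by (rule has_field_derivative_cnj_cnj) (use d in simp)
  moreover have "cnj \<circ> (\<lambda>w. f (z(u := w))) \<circ> cnj = (\<lambda>w. f ((\<lambda>u. cnj (z u))(u := w)))"
  proof
    fix w
    have "(\<lambda>u. cnj (z u))(u := w) = (\<lambda>v. cnj ((z(u := cnj w)) v))" by auto
    then show "(cnj \<circ> (\<lambda>w. f (z(u := w))) \<circ> cnj) w = f ((\<lambda>u. cnj (z u))(u := w))"
      by (simp only: comp_def cnj)
  qed
  ultimately show ?thesis unfolding pd_def by (simp add: DERIV_imp_deriv)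
qed

lemma poly_fun_on_line:
  assumes "f \<in> poly_fun W"
  shows "\<exists>p. \<forall>s. f (\<lambda>u. a u + s * b u) = poly p s"
  using assms
proof (induction rule: poly_fun.induct)
  case (pconst c)
  show ?case by (intro exI[of _ "[:c:]"]) simp
next
  case (pvar v)
  show ?case by (intro exI[of _ "[:a v, b v:]"]) (simp add: mult.commute)
next
  case (padd f g)
  then obtain p q where "\<forall>s. f (\<lambda>u. a u + s * b u) = poly p s" "\<forall>s. g (\<lambda>u. a u + s * b u) = poly q s" by blast
  then show ?case by (intro exI[of _ "p + q"]) simp
next
  case (pmult f g)
  then obtain p q where "\<forall>s. f (\<lambda>u. a u + s * b u) = poly p s" "\<forall>s. g (\<lambda>u. a u + s * b u) = poly q s" by blast
  then show ?case by (intro exI[of _ "p * q"]) simp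
qed

section \<open>Zeros of polynomial systems depending on parameters\<close>

abbreviation in_polydisc :: "'v set \<Rightarrow> ('v \<Rightarrow> complex) \<Rightarrow> real \<Rightarrow> ('v \<Rightarrow> complex) \<Rightarrow> bool" where
  "in_polydisc X a \<rho> w \<equiv> \<forall>u\<in>X. cmod (w u - a u) \<le> \<rho>"

abbreviation two_zeros_in :: "'v set \<Rightarrow> ('v \<Rightarrow> complex) \<Rightarrow> real \<Rightarrow> ('v \<Rightarrow> ('v \<Rightarrow> complex) \<Rightarrow> complex) \<Rightarrow> bool" where
  "two_zeros_in X a \<rho> G \<equiv> \<exists>w w'. in_polydisc X a \<rho> w \<and> in_polydisc X a \<rho> w' \<and>
     (\<forall>i\<in>X. G i w = 0) \<and> (\<forall>i\<in>X. G i w' = 0) \<and> (\<exists>u\<in>X. w u \<noteq> w' u)"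

section \<open>Compactness over finitely many coordinates\<close>

lemma eventually_close:
  fixes z :: "nat \<Rightarrow> 'v \<Rightarrow> complex"
  assumes "finite W" "\<And>u. u \<in> W \<Longrightarrow> (\<lambda>k. z k u) \<longlonglongrightarrow> l u" "r > 0"
  shows "\<forall>\<^sub>F k in sequentially. \<forall>u\<in>W. cmod (z k u - l u) < r"
proof (rule eventually_ball_finite[OF assms(1)], rule ballI)
  fix u assume "u \<in> W"
  then have "(\<lambda>k. cmod (z k u - l u)) \<longlonglongrightarrow> cmod (l u - l u)"
    by (intro tendsto_intros assms(2))
  then show "\<forall>\<^sub>F k in sequentially. cmod (z k u - l u) < r"
    by (rule order_tendstoD) (use assms(3) in simp)
qed

text \<open>Bolzano-Weierstrass one coordinate at a time, each step refining the previous
  subsequence; coordinates outside \<open>W\<close> are left alone.\<close>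

lemma bounded_family_convergent_subsequence:
  fixes z :: "nat \<Rightarrow> 'v \<Rightarrow> 'a::{heine_borel, real_normed_vector}"
  assumes "finite W" "\<And>n u. u \<in> W \<Longrightarrow> norm (z n u) \<le> R u"
  shows "\<exists>r l. strict_mono (r :: nat \<Rightarrow> nat) \<and> (\<forall>u\<in>W. (\<lambda>n. z (r n) u) \<longlonglongrightarrow> l u)"
  using assms
proof (induction W rule: finite_induct)
  case empty
  then show ?case by (intro exI[of _ "\<lambda>n. n"]) (auto simp: strict_mono_def)
next
  case (insert w W)
  then obtain r l where r: "strict_mono (r :: nat \<Rightarrow> nat)" "\<forall>u\<in>W. (\<lambda>n. z (r n) u) \<longlonglongrightarrow> l u"
    by auto
  have "bounded (range (\<lambda>n. z (r n) w))"
    using insert.prems by (auto simp: bounded_iff)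
  then obtain lw r' where r': "strict_mono (r' :: nat \<Rightarrow> nat)" "((\<lambda>n. z (r n) w) \<circ> r') \<longlonglongrightarrow> lw"
    using bounded_imp_convergent_subsequence by blast
  have "(\<lambda>n. z (r (r' n)) u) \<longlonglongrightarrow> (l(w := lw)) u" if "u \<in> insert w W" for u
  proof (cases "u = w")
    case True
    then show ?thesis using r'(2) by (simp add: o_def)
  next
    case False
    then show ?thesis
      using that r(2) LIMSEQ_subseq_LIMSEQ[OF _ r'(1), of "\<lambda>n. z (r n) u" "l u"] by (simp add: o_def)
  qed
  then show ?case using strict_mono_o[OF r(1) r'(1)]
    by (intro exI[of _ "r \<circ> r'"] exI[of _ "l(w := lw)"]) (simp add: o_def)
qed

text \<open>Dividing by the sum of the norms puts the vectors on a unit sphere; the sum is still 1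
  in the limit, so the limit direction is nonzero.\<close>

lemma normalized_subsequence:
  fixes x :: "nat \<Rightarrow> 'v \<Rightarrow> 'a::{heine_borel, real_normed_vector}"
  assumes fin: "finite W" and ne: "\<And>n. \<exists>u\<in>W. x n u \<noteq> 0"
  shows "\<exists>r s v. strict_mono (r :: nat \<Rightarrow> nat) \<and> (\<forall>n. s n > 0) \<and>
    (\<forall>u\<in>W. (\<lambda>n. x (r n) u /\<^sub>R s n) \<longlonglongrightarrow> v u) \<and> (\<exists>u\<in>W. v u \<noteq> 0)"
proof -
  define s where "s n = (\<Sum>u\<in>W. norm (x n u))" for n
  have s: "s n > 0" for n
  proof -
    obtain u where "u \<in> W" "x n u \<noteq> 0" using ne by blast
    then show ?thesis unfolding s_def using fin by (intro sum_pos2[of _ u]) auto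
  qed
  define y where "y n u = x n u /\<^sub>R s n" for n u
  have le: "norm (x n u) \<le> s n" if "u \<in> W" for n u
    unfolding s_def using that fin by (intro member_le_sum) auto
  have "norm (y n u) \<le> 1" if "u \<in> W" for n u
    using le[OF that, of n] s[of n] by (simp add: y_def field_simps)
  from bounded_family_convergent_subsequence[of W y "\<lambda>_. 1", OF fin this] obtain r v where
    r: "strict_mono (r :: nat \<Rightarrow> nat)" and v: "\<And>u. u \<in> W \<Longrightarrow> (\<lambda>n. y (r n) u) \<longlonglongrightarrow> v u" by blast
  have one: "(\<Sum>u\<in>W. norm (y n u)) = 1" for n
  proof -
    have "(\<Sum>u\<in>W. norm (y n u)) = inverse (s n) * s n"
      using s[of n] by (simp add: y_def sum_distrib_left[symmetric]) (simp add: s_def)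
    then show ?thesis using s[of n] by simp
  qed
  have "(\<lambda>n. \<Sum>u\<in>W. norm (y (r n) u)) \<longlonglongrightarrow> (\<Sum>u\<in>W. norm (v u))"
    by (intro tendsto_sum tendsto_norm v)
  then have "(\<Sum>u\<in>W. norm (v u)) = 1"
    using one LIMSEQ_unique[OF _ tendsto_const] by fastforce
  then have "\<exists>u\<in>W. v u \<noteq> 0" by (metis norm_zero sum.neutral zero_neq_one)
  then show ?thesis using r s v unfolding y_def
    by (intro exI[of _ r] exI[of _ "\<lambda>n. s (r n)"] exI[of _ v]) auto
qed

text \<open>One limit direction serves all polynomials at once: if \<open>f\<close> takes equal
  values along the two sequences, its difference quotients vanish and its differential at
  \<open>l\<close> kills \<open>v\<close>. Over an ideal this gives a tangent vector, over a square
  system a kernel vector of the Jacobian.\<close>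

lemma coalescing_sequences_tangent:
  fixes z z' :: "nat \<Rightarrow> 'v \<Rightarrow> complex"
  assumes fin: "finite W"
    and z: "\<And>u. u \<in> W \<Longrightarrow> (\<lambda>n. z n u) \<longlonglongrightarrow> l u"
    and z': "\<And>u. u \<in> W \<Longrightarrow> (\<lambda>n. z' n u) \<longlonglongrightarrow> l u"
    and ne: "\<And>n. \<exists>u\<in>W. z n u \<noteq> z' n u"
  shows "\<exists>v. (\<exists>u\<in>W. v u \<noteq> 0) \<and>
    (\<forall>f\<in>poly_fun W. (\<forall>n. f (z n) = f (z' n)) \<longrightarrow> (\<Sum>u\<in>W. pd u f l * v u) = 0)"
proof -
  have "\<exists>u\<in>W. z n u - z' n u \<noteq> 0" for n using ne by auto
  from normalized_subsequence[of W "\<lambda>n u. z n u - z' n u", OF fin this] obtain r s v where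
    r: "strict_mono (r :: nat \<Rightarrow> nat)" and v: "\<And>u. u \<in> W \<Longrightarrow> (\<lambda>n. (z (r n) u - z' (r n) u) /\<^sub>R s n) \<longlonglongrightarrow> v u"
    and v0: "\<exists>u\<in>W. v u \<noteq> 0" by blast
  have "(\<Sum>u\<in>W. pd u f l * v u) = 0"
    if f: "f \<in> poly_fun W" and eq: "\<forall>n. f (z n) = f (z' n)" for f
  proof -
    have "(\<lambda>n. (f (z (r n)) - f (z' (r n))) / complex_of_real (s n)) \<longlonglongrightarrow> (\<Sum>u\<in>W. pd u f l * v u)"
    proof (rule poly_fun_difference_quotient[OF fin f])
      show "(\<lambda>n. z (r n) u) \<longlonglongrightarrow> l u" "(\<lambda>n. z' (r n) u) \<longlonglongrightarrow> l u" if "u \<in> W" for u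
        using LIMSEQ_subseq_LIMSEQ[OF z[OF that] r] LIMSEQ_subseq_LIMSEQ[OF z'[OF that] r]
        by (simp_all add: o_def)
    qed (use v in \<open>simp add: scaleR_conv_of_real divide_inverse mult.commute\<close>)
    then show ?thesis using eq by (simp add: LIMSEQ_const_iff)
  qed
  then show ?thesis using v0 by blast
qed

section \<open>Singular and nonsingular zeros of square systems\<close>

text \<open>\<open>U\<close> indexes equations and unknowns alike; the coordinates of
  \<open>z\<close> outside \<open>U\<close> are parameters. A kernel vector stands for the vanishing
  of the Jacobian determinant, so that limits can be taken directly.\<close>

definition singular_at :: "'v set \<Rightarrow> ('v \<Rightarrow> ('v \<Rightarrow> complex) \<Rightarrow> complex) \<Rightarrow> ('v \<Rightarrow> complex) \<Rightarrow> bool" where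
  "singular_at U f z \<longleftrightarrow>
     (\<exists>x. (\<exists>u\<in>U. x u \<noteq> 0) \<and> (\<forall>i\<in>U. (\<Sum>k\<in>U. pd k (f i) z * x k) = 0))"

text \<open>The parameter coordinates are polynomials that agree along both sequences, so the limit
  direction vanishes off \<open>U\<close> and is a kernel vector of the partial Jacobian.\<close>

lemma coalescing_zeros_singular:
  assumes "finite V" "U \<subseteq> V" "\<And>i. i \<in> U \<Longrightarrow> f i \<in> poly_fun V"
    and "\<And>u. u \<in> V \<Longrightarrow> (\<lambda>n. z n u) \<longlonglongrightarrow> l u" "\<And>u. u \<in> V \<Longrightarrow> (\<lambda>n. z' n u) \<longlonglongrightarrow> l u"
    and off: "\<And>n u. u \<in> V - U \<Longrightarrow> z n u = z' n u"
    and ne: "\<And>n. \<exists>u\<in>U. z n u \<noteq> z' n u"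
    and zero: "\<And>n i. i \<in> U \<Longrightarrow> f i (z n) = 0" "\<And>n i. i \<in> U \<Longrightarrow> f i (z' n) = 0"
  shows "singular_at U f l"
proof -
  have "\<exists>u\<in>V. z n u \<noteq> z' n u" for n using ne assms(2) by blast
  from coalescing_sequences_tangent[of V z l z', OF assms(1,4,5) this] obtain v where
    v: "\<exists>u\<in>V. v u \<noteq> 0" "\<And>g. g \<in> poly_fun V \<Longrightarrow> (\<forall>n. g (z n) = g (z' n)) \<Longrightarrow> (\<Sum>u\<in>V. pd u g l * v u) = 0"
    by blast
  have v0: "v u = 0" if "u \<in> V - U" for u
  proof -
    have "(\<Sum>w\<in>V. pd w (\<lambda>z. z u) l * v w) = 0"
      using that off by (intro v(2) pvar) auto
    then show ?thesis
      using that assms(1) by (simp add: pd_var if_distrib[of "\<lambda>x. x * _"] cong: if_cong)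
  qed
  have "(\<Sum>u\<in>U. pd u (f i) l * v u) = 0" if "i \<in> U" for i
  proof -
    have "(\<Sum>u\<in>V. pd u (f i) l * v u) = 0"
      by (rule v(2)) (use assms(3) zero that in auto)
    moreover have "(\<Sum>u\<in>V. pd u (f i) l * v u) = (\<Sum>u\<in>U. pd u (f i) l * v u)"
      using assms(1,2) v0 by (intro sum.mono_neutral_right) auto
    ultimately show ?thesis by simp
  qed
  moreover have "\<exists>u\<in>U. v u \<noteq> 0" using v(1) v0 by blast
  ultimately show ?thesis unfolding singular_at_def by blast
qed

lemma singular_at_limit:
  assumes "finite V" "U \<subseteq> V" "\<And>i. i \<in> U \<Longrightarrow> f i \<in> poly_fun V"
    and lim: "\<And>u. u \<in> V \<Longrightarrow> (\<lambda>n. z n u) \<longlonglongrightarrow> l u"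
    and sing: "\<And>n. singular_at U f (z n)"
  shows "singular_at U f l"
proof -
  have fin: "finite U" using assms(1,2) finite_subset by blast
  obtain x where x: "\<And>n. \<exists>u\<in>U. x n u \<noteq> 0" "\<And>n i. i \<in> U \<Longrightarrow> (\<Sum>k\<in>U. pd k (f i) (z n) * x n k) = 0"
    using sing unfolding singular_at_def by metis
  from normalized_subsequence[of U x, OF fin x(1)] obtain r s v where
    r: "strict_mono (r :: nat \<Rightarrow> nat)" and v: "\<And>u. u \<in> U \<Longrightarrow> (\<lambda>n. x (r n) u /\<^sub>R s n) \<longlonglongrightarrow> v u"
    and v0: "\<exists>u\<in>U. v u \<noteq> 0" by blast
  have "(\<Sum>k\<in>U. pd k (f i) l * v k) = 0" if i: "i \<in> U" for i
  proof -
    have "(\<lambda>n. \<Sum>k\<in>U. pd k (f i) (z (r n)) * (x (r n) k /\<^sub>R s n)) \<longlonglongrightarrow> (\<Sum>k\<in>U. pd k (f i) l * v k)"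
    proof (intro tendsto_sum tendsto_mult v)
      show "(\<lambda>n. pd k (f i) (z (r n))) \<longlonglongrightarrow> pd k (f i) l" for k
        using LIMSEQ_subseq_LIMSEQ[OF lim r]
        by (intro tendsto_poly_fun[OF poly_fun_pd[OF assms(3)[OF i]]]) (auto simp: o_def)
    qed
    moreover have "(\<Sum>k\<in>U. pd k (f i) (z (r n)) * (x (r n) k /\<^sub>R s n)) = 0" for n
      using x(2)[OF i, of "r n"] by (simp add: scaleR_sum_right[symmetric])
    ultimately show ?thesis by (simp add: LIMSEQ_const_iff)
  qed
  then show ?thesis using v0 unfolding singular_at_def by blast
qed

lemma polydisc_residual_attains_min:
  fixes f :: "'i \<Rightarrow> ('v \<Rightarrow> complex) \<Rightarrow> complex" and q c :: "'v \<Rightarrow> complex"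
  assumes "finite V" "finite U" "\<And>i. i \<in> I \<Longrightarrow> f i \<in> poly_fun V" "r \<ge> 0"
  defines "D \<equiv> {z. (\<forall>u. u \<notin> U \<longrightarrow> z u = q u) \<and> in_polydisc U c r z}"
  shows "\<exists>z\<in>D. \<forall>z'\<in>D. (\<Sum>i\<in>I. cmod (f i z)) \<le> (\<Sum>i\<in>I. cmod (f i z'))"
proof -
  define \<phi> where "\<phi> z = (\<Sum>i\<in>I. cmod (f i z))" for z
  have bb: "bdd_below (\<phi> ` D)"
    by (rule bdd_belowI2[of _ 0]) (auto simp: \<phi>_def intro: sum_nonneg)
  have "(\<lambda>u. if u \<in> U then c u else q u) \<in> D" using assms(4) by (auto simp: D_def)
  then have ne: "\<phi> ` D \<noteq> {}" by blast
  have "\<exists>z\<in>D. \<phi> z < Inf (\<phi> ` D) + 1 / real (Suc n)" for n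
    using cInf_lessD[OF ne, of "Inf (\<phi> ` D) + 1 / real (Suc n)"] by auto
  then obtain z where z: "\<And>n. z n \<in> D" "\<And>n. \<phi> (z n) < Inf (\<phi> ` D) + 1 / real (Suc n)" by metis
  have "norm (z n u) \<le> cmod (c u) + r" if "u \<in> U" for n u
  proof -
    have "cmod (z n u - c u) \<le> r" using z(1) that by (auto simp: D_def)
    then show ?thesis using norm_triangle_sub[of "z n u" "c u"] by linarith
  qed
  from bounded_family_convergent_subsequence[of U z "\<lambda>u. cmod (c u) + r", OF assms(2) this] obtain k l where
    k: "strict_mono (k :: nat \<Rightarrow> nat)" and l: "\<And>u. u \<in> U \<Longrightarrow> (\<lambda>n. z (k n) u) \<longlonglongrightarrow> l u" by blast
  define m where "m u = (if u \<in> U then l u else q u)" for u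
  have conv: "(\<lambda>n. z (k n) u) \<longlonglongrightarrow> m u" for u
    using l z(1) by (cases "u \<in> U") (auto simp: m_def D_def)
  have "m \<in> D"
  proof -
    have "cmod (m u - c u) \<le> r" if "u \<in> U" for u
    proof (rule Lim_bounded)
      show "(\<lambda>n. cmod (z (k n) u - c u)) \<longlonglongrightarrow> cmod (m u - c u)"
        by (intro tendsto_intros conv)
      show "\<forall>n\<ge>0. cmod (z (k n) u - c u) \<le> r" using z(1) that by (auto simp: D_def)
    qed
    then show ?thesis by (auto simp: D_def m_def)
  qed
  have "\<phi> m \<le> Inf (\<phi> ` D)"
  proof (rule LIMSEQ_le)
    show "(\<lambda>n. \<phi> (z (k n))) \<longlonglongrightarrow> \<phi> m"
      unfolding \<phi>_def by (intro tendsto_sum tendsto_norm tendsto_poly_fun[OF assms(3)] conv)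
    have "(\<lambda>n. Inf (\<phi> ` D) + inverse (real (Suc (k n)))) \<longlonglongrightarrow> Inf (\<phi> ` D) + 0"
      using LIMSEQ_subseq_LIMSEQ[OF LIMSEQ_inverse_real_of_nat k]
      by (intro tendsto_intros) (simp add: o_def)
    then show "(\<lambda>n. Inf (\<phi> ` D) + 1 / real (Suc (k n))) \<longlonglongrightarrow> Inf (\<phi> ` D)"
      by (simp add: inverse_eq_divide)
    show "\<exists>N. \<forall>n\<ge>N. \<phi> (z (k n)) \<le> Inf (\<phi> ` D) + 1 / real (Suc (k n))"
      using z(2) less_imp_le by blast
  qed
  then have "\<forall>z'\<in>D. \<phi> m \<le> \<phi> z'"
    using cInf_lower[OF _ bb] by fastforce
  then show ?thesis using \<open>m \<in> D\<close> unfolding \<phi>_def by blast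
qed

text \<open>Zeros with the same parameters accumulating at \<open>l\<close> would merge with the
  constant sequence \<open>l\<close> and make it singular.\<close>

lemma nonsingular_zero_isolated:
  assumes "finite V" "U \<subseteq> V" "\<And>i. i \<in> U \<Longrightarrow> f i \<in> poly_fun V"
    and zero: "\<And>i. i \<in> U \<Longrightarrow> f i l = 0" and ns: "\<not> singular_at U f l" and "r > 0"
  shows "\<exists>r0>0. r0 \<le> r \<and> (\<forall>z. (\<forall>u\<in>V - U. z u = l u) \<longrightarrow> in_polydisc U l r0 z \<longrightarrow>
    (\<forall>i\<in>U. f i z = 0) \<longrightarrow> (\<forall>u\<in>U. z u = l u))"
proof (rule ccontr)
  define \<epsilon> where "\<epsilon> n = r * inverse (real (Suc n))" for n
  have e: "\<epsilon> n > 0" "\<epsilon> n \<le> r" for n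
    using \<open>r > 0\<close> by (auto simp: \<epsilon>_def field_simps)
  have "\<epsilon> \<longlonglongrightarrow> r * 0" unfolding \<epsilon>_def by (intro tendsto_intros LIMSEQ_inverse_real_of_nat)
  then have e0: "\<epsilon> \<longlonglongrightarrow> 0" by simp
  assume contra: "\<not> ?thesis"
  define P where "P n z \<longleftrightarrow> (\<forall>u\<in>V - U. z u = l u) \<and> (\<forall>u\<in>U. cmod (z u - l u) \<le> \<epsilon> n) \<and>
    (\<forall>i\<in>U. f i z = 0) \<and> (\<exists>u\<in>U. z u \<noteq> l u)" for n z
  have "\<exists>z. P n z" for n
    using contra e[of n] unfolding P_def by blast
  then obtain z where P: "\<And>n. P n (z n)" by metis
  have z: "\<And>n u. u \<in> V - U \<Longrightarrow> z n u = l u" "\<And>n u. u \<in> U \<Longrightarrow> cmod (z n u - l u) \<le> \<epsilon> n"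
    "\<And>n i. i \<in> U \<Longrightarrow> f i (z n) = 0" "\<And>n. \<exists>u\<in>U. z n u \<noteq> l u"
    using P unfolding P_def by blast+
  have "(\<lambda>n. z n u) \<longlonglongrightarrow> l u" if "u \<in> V" for u
  proof (cases "u \<in> U")
    case True
    have "(\<lambda>n. z n u - l u) \<longlonglongrightarrow> 0"
      by (rule Lim_null_comparison[OF _ e0]) (use z(2)[OF True] in simp)
    then show ?thesis by (simp add: LIM_zero_iff)
  next
    case False
    then show ?thesis using z(1) that by simp
  qed
  then have "singular_at U f l"
    using coalescing_zeros_singular[of V U f z l "\<lambda>_. l"] assms(1-3) z zero by auto
  then show False using ns by simp
qed

text \<open>Along the Newton direction the value of each \<open>f i\<close> is
  \<open>(1 - t) * f i x + t * E i t\<close> with \<open>E\<close> tending to 0, so a short step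
  shrinks the residual to first order by the factor \<open>1 - t\<close>.\<close>

lemma newton_step_decreases_residual:
  fixes f :: "'v \<Rightarrow> ('v \<Rightarrow> complex) \<Rightarrow> complex"
  assumes "finite V" "U \<subseteq> V" "\<And>i. i \<in> U \<Longrightarrow> f i \<in> poly_fun V"
    and ns: "\<not> singular_at U f x" and pos: "0 < (\<Sum>i\<in>U. cmod (f i x))" and "e > 0"
  shows "\<exists>y. (\<forall>u. u \<notin> U \<longrightarrow> y u = x u) \<and> (\<forall>u\<in>U. cmod (y u - x u) < e) \<and>
    (\<Sum>i\<in>U. cmod (f i y)) < (\<Sum>i\<in>U. cmod (f i x))"
proof -
  have fin: "finite U" using assms(1,2) finite_subset by blast
  have "\<exists>d. \<forall>i\<in>U. (\<Sum>k\<in>U. pd k (f i) x * d k) = - f i x"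
    by (rule injective_square_system_solvable[OF fin]) (use ns in \<open>auto simp: singular_at_def\<close>)
  then obtain d0 where d0: "\<And>i. i \<in> U \<Longrightarrow> (\<Sum>k\<in>U. pd k (f i) x * d0 k) = - f i x" by blast
  define d where "d u = (if u \<in> U then d0 u else 0)" for u
  define y where "y t u = x u + complex_of_real t * d u" for t u
  have ylim: "((\<lambda>t. y t u) \<longlongrightarrow> x u) (at_right 0)" for u
  proof -
    have "((\<lambda>t. y t u) \<longlongrightarrow> x u + complex_of_real 0 * d u) (at_right 0)"
      unfolding y_def by (intro tendsto_intros)
    then show ?thesis by simp
  qed
  define E where "E i t = (f i (y t) - f i x) / complex_of_real t + f i x" for i t
  have E: "(E i \<longlongrightarrow> 0) (at_right 0)" if i: "i \<in> U" for i
  proof -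
    have "((\<lambda>t. (f i (y t) - f i x) / complex_of_real t) \<longlongrightarrow> (\<Sum>u\<in>V. pd u (f i) x * d u)) (at_right 0)"
    proof (rule poly_fun_difference_quotient[OF assms(1) assms(3)[OF i]])
      show "((\<lambda>t. (y t u - x u) / complex_of_real t) \<longlongrightarrow> d u) (at_right 0)" for u
        by (rule Lim_transform_eventually[OF tendsto_const])
           (auto simp: y_def eventually_at_right_less eventually_at_filter)
    qed (use ylim in auto)
    moreover have "(\<Sum>u\<in>V. pd u (f i) x * d u) = (\<Sum>u\<in>U. pd u (f i) x * d0 u)"
    proof -
      have "(\<Sum>u\<in>V. pd u (f i) x * d u) = (\<Sum>u\<in>U. pd u (f i) x * d u)"
        using assms(1,2) by (intro sum.mono_neutral_right) (auto simp: d_def)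
      then show ?thesis by (simp add: d_def)
    qed
    ultimately have "((\<lambda>t. (f i (y t) - f i x) / complex_of_real t) \<longlongrightarrow> - f i x) (at_right 0)"
      using d0[OF i] by simp
    from tendsto_add[OF this tendsto_const[of "f i x"]] show ?thesis
      by (simp add: E_def[abs_def])
  qed
  have "((\<lambda>t. \<Sum>i\<in>U. cmod (E i t)) \<longlongrightarrow> (\<Sum>i\<in>U. cmod 0)) (at_right 0)"
    by (intro tendsto_sum tendsto_norm E)
  then have ev1: "\<forall>\<^sub>F t in at_right 0. (\<Sum>i\<in>U. cmod (E i t)) < (\<Sum>i\<in>U. cmod (f i x))"
    by (rule order_tendstoD) (use pos in simp)
  have ev2: "\<forall>\<^sub>F t in at_right 0. \<forall>u\<in>U. cmod (y t u - x u) < e"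
  proof (rule eventually_ball_finite[OF fin], rule ballI)
    fix u
    have "((\<lambda>t. cmod (y t u - x u)) \<longlongrightarrow> cmod (x u - x u)) (at_right 0)"
      by (intro tendsto_intros ylim)
    then show "\<forall>\<^sub>F t in at_right 0. cmod (y t u - x u) < e"
      by (rule order_tendstoD) (use \<open>e > 0\<close> in simp)
  qed
  have ev3: "\<forall>\<^sub>F t in at_right (0::real). 0 < t \<and> t < 1"
    using eventually_at_right_real[of 0 "1::real"] by simp
  from eventually_happens'[OF _ eventually_conj[OF ev1 eventually_conj[OF ev2 ev3]]]
  obtain t where t: "(\<Sum>i\<in>U. cmod (E i t)) < (\<Sum>i\<in>U. cmod (f i x))"
    "\<forall>u\<in>U. cmod (y t u - x u) < e" "0 < t" "t < 1" by auto
  have "cmod (f i (y t)) \<le> (1 - t) * cmod (f i x) + t * cmod (E i t)" for i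
  proof -
    have "f i (y t) = complex_of_real (1 - t) * f i x + complex_of_real t * E i t"
      using t(3) by (simp add: E_def field_simps)
    then have "cmod (f i (y t)) \<le> cmod (complex_of_real (1 - t) * f i x) + cmod (complex_of_real t * E i t)"
      using norm_triangle_ineq by metis
    then show ?thesis using t(3,4) by (simp add: norm_mult del: of_real_diff)
  qed
  then have "(\<Sum>i\<in>U. cmod (f i (y t))) \<le> (\<Sum>i\<in>U. (1 - t) * cmod (f i x) + t * cmod (E i t))"
    by (rule sum_mono)
  also have "\<dots> = (1 - t) * (\<Sum>i\<in>U. cmod (f i x)) + t * (\<Sum>i\<in>U. cmod (E i t))"
    by (simp add: sum.distrib sum_distrib_left)
  also have "\<dots> < (1 - t) * (\<Sum>i\<in>U. cmod (f i x)) + t * (\<Sum>i\<in>U. cmod (f i x))"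
    using t by simp
  finally have "(\<Sum>i\<in>U. cmod (f i (y t))) < (\<Sum>i\<in>U. cmod (f i x))" by (simp add: algebra_simps)
  then show ?thesis using t(2) by (intro exI[of _ "y t"]) (auto simp: y_def d_def)
qed

text \<open>The existence half of the implicit function theorem. The residual for the perturbed
  parameters is minimised over a polydisc isolating \<open>l\<close>. Accumulation points of the
  minimisers are zeros of the limit system, hence equal to \<open>l\<close>; so some minimiser is
  nonsingular and interior, and a Newton step would lower its positive residual.\<close>

lemma nonsingular_zero_persists:
  fixes f :: "'v \<Rightarrow> ('v \<Rightarrow> complex) \<Rightarrow> complex"
  assumes "finite V" "U \<subseteq> V" "\<And>i. i \<in> U \<Longrightarrow> f i \<in> poly_fun V"
    and zero: "\<And>i. i \<in> U \<Longrightarrow> f i l = 0" and ns: "\<not> singular_at U f l" and "r > 0"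
    and q: "\<And>u. u \<in> V \<Longrightarrow> (\<lambda>n. q n u) \<longlonglongrightarrow> l u"
  shows "\<forall>\<^sub>F n in sequentially. \<exists>z. (\<forall>u. u \<notin> U \<longrightarrow> z u = q n u) \<and>
    in_polydisc U l r z \<and> (\<forall>i\<in>U. f i z = 0)"
proof (rule ccontr)
  have fin: "finite U" using assms(1,2) finite_subset by blast
  have "\<exists>r0>0. r0 \<le> r \<and> (\<forall>z. (\<forall>u\<in>V - U. z u = l u) \<longrightarrow> in_polydisc U l r0 z \<longrightarrow>
    (\<forall>i\<in>U. f i z = 0) \<longrightarrow> (\<forall>u\<in>U. z u = l u))"
    by (rule nonsingular_zero_isolated) (use assms in auto)
  then obtain r0 where r0: "r0 > 0" "r0 \<le> r" and iso: "\<forall>z. (\<forall>u\<in>V - U. z u = l u) \<longrightarrow>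
    in_polydisc U l r0 z \<longrightarrow> (\<forall>i\<in>U. f i z = 0) \<longrightarrow> (\<forall>u\<in>U. z u = l u)"
    by (elim exE conjE)
  assume "\<not> ?thesis"
  from not_eventually_sequentiallyD[OF this] obtain k where k: "strict_mono (k :: nat \<Rightarrow> nat)"
    and no0: "\<forall>n. \<not> (\<exists>z. (\<forall>u. u \<notin> U \<longrightarrow> z u = q (k n) u) \<and>
      in_polydisc U l r z \<and> (\<forall>i\<in>U. f i z = 0))"
    by (elim exE conjE)
  have no: "\<And>n z. (\<forall>u. u \<notin> U \<longrightarrow> z u = q (k n) u) \<Longrightarrow> in_polydisc U l r z \<Longrightarrow> \<exists>i\<in>U. f i z \<noteq> 0"
    using no0 by blast
  define D where "D n = {z. (\<forall>u. u \<notin> U \<longrightarrow> z u = q (k n) u) \<and> in_polydisc U l r0 z}" for n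
  define \<phi> where "\<phi> z = (\<Sum>i\<in>U. cmod (f i z))" for z
  have qk: "(\<lambda>n. q (k n) u) \<longlonglongrightarrow> l u" if "u \<in> V" for u
    using LIMSEQ_subseq_LIMSEQ[OF q[OF that] k] by (simp add: o_def)
  have "\<exists>z\<in>D n. \<forall>z'\<in>D n. \<phi> z \<le> \<phi> z'" for n
    unfolding D_def \<phi>_def using assms(1-3) fin r0(1) by (intro polydisc_residual_attains_min) auto
  then obtain z where zD: "\<And>n. z n \<in> D n" and zmin: "\<And>n z'. z' \<in> D n \<Longrightarrow> \<phi> (z n) \<le> \<phi> z'" by metis
  have pos: "\<phi> (z n) > 0" for n
  proof -
    obtain i where "i \<in> U" "f i (z n) \<noteq> 0"
      using no[of "z n" n] zD[of n] r0(2) by (force simp: D_def)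
    then show ?thesis unfolding \<phi>_def using fin by (intro sum_pos2[of _ i]) auto
  qed
  have "norm (z n u) \<le> cmod (l u) + r0" if "u \<in> U" for n u
  proof -
    have "cmod (z n u - l u) \<le> r0" using zD[of n] that by (auto simp: D_def)
    then show ?thesis using norm_triangle_sub[of "z n u" "l u"] by linarith
  qed
  from bounded_family_convergent_subsequence[of U z "\<lambda>u. cmod (l u) + r0", OF fin this] obtain h m0 where
    h: "strict_mono (h :: nat \<Rightarrow> nat)" and m0: "\<And>u. u \<in> U \<Longrightarrow> (\<lambda>n. z (h n) u) \<longlonglongrightarrow> m0 u" by blast
  define m where "m u = (if u \<in> U then m0 u else l u)" for u
  have zm: "(\<lambda>n. z (h n) u) \<longlonglongrightarrow> m u" if "u \<in> V" for u
  proof (cases "u \<in> U")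
    case False
    then have "z (h n) u = q (k (h n)) u" for n using zD by (auto simp: D_def)
    then show ?thesis using LIMSEQ_subseq_LIMSEQ[OF qk[OF that] h] False by (simp add: o_def m_def)
  qed (use m0 in \<open>simp add: m_def\<close>)
  have "\<phi> m \<le> 0"
  proof (rule LIMSEQ_le)
    show "(\<lambda>n. \<phi> (z (h n))) \<longlonglongrightarrow> \<phi> m"
      unfolding \<phi>_def by (intro tendsto_sum tendsto_norm tendsto_poly_fun[OF assms(3)] zm)
    \<comment> \<open>A competitor for the minimum: the unknowns of \<open>l\<close> with the
      perturbed parameters. Its residual tends to that of \<open>l\<close>, which is 0.\<close>
    define c where "c n u = (if u \<in> U then l u else q (k n) u)" for n u
    have "(\<lambda>n. c n u) \<longlonglongrightarrow> l u" if "u \<in> V" for u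
      using qk[OF that] by (cases "u \<in> U") (auto simp: c_def)
    then have "(\<lambda>n. \<phi> (c n)) \<longlonglongrightarrow> \<phi> l"
      unfolding \<phi>_def by (intro tendsto_sum tendsto_norm tendsto_poly_fun[OF assms(3)])
    moreover have "\<phi> l = 0" using zero by (simp add: \<phi>_def)
    ultimately show "(\<lambda>n. \<phi> (c (h n))) \<longlonglongrightarrow> 0"
      using LIMSEQ_subseq_LIMSEQ[OF _ h, of "\<lambda>n. \<phi> (c n)"] by (simp add: o_def)
    have "c n \<in> D n" for n using r0 by (auto simp: c_def D_def)
    then show "\<exists>N. \<forall>n\<ge>N. \<phi> (z (h n)) \<le> \<phi> (c (h n))" using zmin by blast
  qed
  moreover have "\<phi> m \<ge> 0" by (auto simp: \<phi>_def intro: sum_nonneg)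
  ultimately have "\<forall>i\<in>U. f i m = 0"
    using fin by (auto simp: \<phi>_def sum_nonneg_eq_0_iff)
  moreover have "cmod (m u - l u) \<le> r0" if "u \<in> U" for u
  proof (rule Lim_bounded)
    show "(\<lambda>n. cmod (z (h n) u - l u)) \<longlonglongrightarrow> cmod (m u - l u)"
      using that assms(2) by (intro tendsto_intros zm) auto
    show "\<forall>n\<ge>0. cmod (z (h n) u - l u) \<le> r0" using zD that by (auto simp: D_def)
  qed
  ultimately have "\<forall>u\<in>U. m u = l u" using iso[THEN spec[of _ m]] by (auto simp: m_def)
  then have zl: "(\<lambda>n. z (h n) u) \<longlonglongrightarrow> l u" if "u \<in> V" for u
    using zm[OF that] by (cases "u \<in> U") (auto simp: m_def)
  have "\<forall>\<^sub>F n in sequentially. \<not> singular_at U f (z (h n))"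
  proof (rule ccontr)
    assume "\<not> ?thesis"
    from not_eventually_sequentiallyD[OF this] obtain p where p: "strict_mono (p :: nat \<Rightarrow> nat)"
      "\<And>n. singular_at U f (z (h (p n)))" by auto
    have "singular_at U f l"
      by (rule singular_at_limit[of V U f "\<lambda>n. z (h (p n))", OF assms(1-3) _ p(2)])
         (use LIMSEQ_subseq_LIMSEQ[OF zl p(1)] in \<open>auto simp: o_def\<close>)
    then show False using ns by simp
  qed
  moreover have "\<forall>\<^sub>F n in sequentially. \<forall>u\<in>U. cmod (z (h n) u - l u) < r0"
    by (rule eventually_close) (use fin zl assms(2) r0 in auto)
  ultimately have "\<forall>\<^sub>F n in sequentially. \<not> singular_at U f (z (h n)) \<and> (\<forall>u\<in>U. cmod (z (h n) u - l u) < r0)"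
    by eventually_elim auto
  then obtain n where n: "\<not> singular_at U f (z (h n))" "\<forall>u\<in>U. cmod (z (h n) u - l u) < r0"
    using eventually_happens' sequentially_bot by blast
  \<comment> \<open>A lower bound for the distance to the boundary of the polydisc, so that the
    Newton step stays inside; inserting \<open>r0\<close> gives \<open>Min\<close> a nonempty set
    also when \<open>U\<close> is empty.\<close>
  define e where "e = Min (insert r0 ((\<lambda>u. r0 - cmod (z (h n) u - l u)) ` U))"
  have e: "e > 0" "\<And>u. u \<in> U \<Longrightarrow> e \<le> r0 - cmod (z (h n) u - l u)"
    unfolding e_def using fin n(2) r0(1) by auto
  have "\<exists>y. (\<forall>u. u \<notin> U \<longrightarrow> y u = z (h n) u) \<and> (\<forall>u\<in>U. cmod (y u - z (h n) u) < e) \<and> \<phi> y < \<phi> (z (h n))"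
    unfolding \<phi>_def by (rule newton_step_decreases_residual[of V])
      (use assms(1-3) n(1) e(1) pos[of "h n"] in \<open>auto simp: \<phi>_def\<close>)
  then obtain y where y: "\<forall>u. u \<notin> U \<longrightarrow> y u = z (h n) u" "\<forall>u\<in>U. cmod (y u - z (h n) u) < e"
    "\<phi> y < \<phi> (z (h n))" by blast
  have "y \<in> D (h n)"
  proof -
    have "cmod (y u - l u) \<le> r0" if "u \<in> U" for u
      using y(2) e(2)[OF that] that norm_triangle_ineq[of "y u - z (h n) u" "z (h n) u - l u"]
      by fastforce
    then show ?thesis using y(1) zD[of "h n"] by (auto simp: D_def)
  qed
  then show False using zmin[of y "h n"] y(3) by simp
qed

section \<open>Algebraic dependence\<close>

text \<open>The degree is bounded in each variable separately, so the exponents form a product set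
  with exactly \<open>(d + 1) ^ card U\<close> elements and the count below stays
  elementary.\<close>

definition box_poly :: "'v set \<Rightarrow> nat \<Rightarrow> (('v \<Rightarrow> complex) \<Rightarrow> complex) set" where
  "box_poly U d = {f. \<exists>c. \<forall>z. f z = (\<Sum>\<beta>\<in>PiE U (\<lambda>_. {..d}). c \<beta> * (\<Prod>u\<in>U. z u ^ \<beta> u))}"

lemma box_poly_monomial:
  assumes "finite U" "\<And>u. u \<in> U \<Longrightarrow> \<beta> u \<le> d"
  shows "(\<lambda>z. a * (\<Prod>u\<in>U. z u ^ \<beta> u)) \<in> box_poly U d"
proof -
  have fin: "finite (PiE U (\<lambda>_. {..d}))" using assms(1) by (simp add: finite_PiE)
  have mem: "restrict \<beta> U \<in> PiE U (\<lambda>_. {..d})" using assms(2) by auto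
  have "a * (\<Prod>u\<in>U. z u ^ \<beta> u) =
      (\<Sum>\<gamma>\<in>PiE U (\<lambda>_. {..d}). (if \<gamma> = restrict \<beta> U then a else 0) * (\<Prod>u\<in>U. z u ^ \<gamma> u))" for z :: "'a \<Rightarrow> complex"
  proof -
    have "(\<Sum>\<gamma>\<in>PiE U (\<lambda>_. {..d}). (if \<gamma> = restrict \<beta> U then a else 0) * (\<Prod>u\<in>U. z u ^ \<gamma> u))
      = (\<Sum>\<gamma>\<in>PiE U (\<lambda>_. {..d}). if \<gamma> = restrict \<beta> U then a * (\<Prod>u\<in>U. z u ^ \<gamma> u) else 0)"
      by (intro sum.cong) auto
    also have "\<dots> = a * (\<Prod>u\<in>U. z u ^ (restrict \<beta> U) u)" using fin mem by simp
    finally show ?thesis by simp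
  qed
  then show ?thesis unfolding box_poly_def
    by (intro CollectI exI[of _ "\<lambda>\<gamma>. if \<gamma> = restrict \<beta> U then a else 0"]) simp
qed

lemma box_poly_add:
  assumes "f \<in> box_poly U d" "g \<in> box_poly U d"
  shows "(\<lambda>z. f z + g z) \<in> box_poly U d"
proof -
  obtain a b where "\<forall>z. f z = (\<Sum>\<beta>\<in>PiE U (\<lambda>_. {..d}). a \<beta> * (\<Prod>u\<in>U. z u ^ \<beta> u))"
    "\<forall>z. g z = (\<Sum>\<beta>\<in>PiE U (\<lambda>_. {..d}). b \<beta> * (\<Prod>u\<in>U. z u ^ \<beta> u))"
    using assms unfolding box_poly_def by blast
  then have "\<forall>z. f z + g z = (\<Sum>\<beta>\<in>PiE U (\<lambda>_. {..d}). (a \<beta> + b \<beta>) * (\<Prod>u\<in>U. z u ^ \<beta> u))"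
    by (simp add: distrib_right sum.distrib)
  then show ?thesis unfolding box_poly_def by (intro CollectI exI[of _ "\<lambda>\<beta>. a \<beta> + b \<beta>"])
qed

lemma box_poly_sum:
  assumes "finite U" "\<And>i. i \<in> I \<Longrightarrow> f i \<in> box_poly U d"
  shows "(\<lambda>z. \<Sum>i\<in>I. f i z) \<in> box_poly U d"
  using assms(2)
proof (induction I rule: infinite_finite_induct)
  case (insert i I)
  then show ?case using box_poly_add[of "f i" U d "\<lambda>z. \<Sum>i\<in>I. f i z"] by simp
qed (use box_poly_monomial[OF assms(1), of "\<lambda>_. 0" d 0] in auto)

lemma box_poly_mult:
  assumes "finite U" "f \<in> box_poly U d" "g \<in> box_poly U e"
  shows "(\<lambda>z. f z * g z) \<in> box_poly U (d + e)"
proof -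
  obtain a b where a: "\<And>z. f z = (\<Sum>\<beta>\<in>PiE U (\<lambda>_. {..d}). a \<beta> * (\<Prod>u\<in>U. z u ^ \<beta> u))"
    and b: "\<And>z. g z = (\<Sum>\<gamma>\<in>PiE U (\<lambda>_. {..e}). b \<gamma> * (\<Prod>u\<in>U. z u ^ \<gamma> u))"
    using assms unfolding box_poly_def by blast
  have "f z * g z = (\<Sum>\<beta>\<in>PiE U (\<lambda>_. {..d}). \<Sum>\<gamma>\<in>PiE U (\<lambda>_. {..e}).
      (a \<beta> * b \<gamma>) * (\<Prod>u\<in>U. z u ^ (\<beta> u + \<gamma> u)))" for z
    unfolding a b sum_product by (simp add: power_add prod.distrib mult_ac)
  moreover have "(\<lambda>z. \<Sum>\<beta>\<in>PiE U (\<lambda>_. {..d}). \<Sum>\<gamma>\<in>PiE U (\<lambda>_. {..e}).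
      (a \<beta> * b \<gamma>) * (\<Prod>u\<in>U. z u ^ (\<beta> u + \<gamma> u))) \<in> box_poly U (d + e)"
    by (intro box_poly_sum box_poly_monomial assms(1)) (auto simp: PiE_def Pi_def intro: add_mono)
  ultimately show ?thesis by simp
qed

lemma box_poly_mono:
  assumes "finite U" "f \<in> box_poly U d" "d \<le> e"
  shows "f \<in> box_poly U e"
  using box_poly_mult[OF assms(1,2) box_poly_monomial[OF assms(1), of "\<lambda>_. 0" "e - d" 1]] assms(3)
  by simp

lemma poly_fun_subset_box_poly:
  assumes "finite U" "f \<in> poly_fun U"
  shows "\<exists>d. f \<in> box_poly U d"
  using assms(2)
proof (induction rule: poly_fun.induct)
  case (pconst c)
  then show ?case using box_poly_monomial[OF assms(1), of "\<lambda>_. 0" 0 c] by auto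
next
  case (pvar v)
  have "(\<Prod>u\<in>U. z u ^ (if u = v then 1 else 0)) = z v" for z :: "'a \<Rightarrow> complex"
  proof -
    have "(\<Prod>u\<in>U. z u ^ (if u = v then 1 else 0)) = (\<Prod>u\<in>U. if u = v then z u else 1)"
      by (intro prod.cong) auto
    then show ?thesis using pvar assms(1) by simp
  qed
  moreover have "(\<lambda>z. 1 * (\<Prod>u\<in>U. z u ^ (if u = v then 1 else 0))) \<in> box_poly U 1"
    by (rule box_poly_monomial[OF assms(1)]) simp
  ultimately show ?case by auto
next
  case (padd f g)
  then obtain d e where "f \<in> box_poly U d" "g \<in> box_poly U e" by blast
  then have "f \<in> box_poly U (max d e)" "g \<in> box_poly U (max d e)"
    using box_poly_mono[OF assms(1)] by (meson max.cobounded1 max.cobounded2)+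
  then show ?case using box_poly_add by blast
next
  case (pmult f g)
  then show ?case using box_poly_mult[OF assms(1)] by blast
qed

lemma box_poly_power:
  assumes "finite U" "f \<in> box_poly U d"
  shows "(\<lambda>z. f z ^ n) \<in> box_poly U (n * d)"
proof (induction n)
  case 0
  then show ?case using box_poly_monomial[OF assms(1), of "\<lambda>_. 0" 0 1] by simp
next
  case (Suc n)
  then show ?case using box_poly_mult[OF assms(1) assms(2) Suc] by simp
qed

lemma box_poly_prod:
  assumes "finite U" "finite I" "\<And>i. i \<in> I \<Longrightarrow> f i \<in> box_poly U (d i)"
  shows "(\<lambda>z. \<Prod>i\<in>I. f i z) \<in> box_poly U (\<Sum>i\<in>I. d i)"
  using assms(2,3)
proof (induction I rule: finite_induct)
  case empty
  then show ?case using box_poly_monomial[OF assms(1), of "\<lambda>_. 0" 0 1] by simp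
next
  case (insert i I)
  then show ?case using box_poly_mult[OF assms(1), of "f i" "d i" "\<lambda>z. \<Prod>i\<in>I. f i z"] by simp
qed

text \<open>Splitting off the variable \<open>x\<close> leaves a polynomial in \<open>z x\<close>
  alone, with coefficients free of \<open>x\<close>. It vanishes identically, so each coefficient
  does, and the induction hypothesis applies to it.\<close>

lemma monomials_independent:
  assumes "finite O'"
    and "\<And>z :: 'o \<Rightarrow> complex. (\<Sum>\<alpha>\<in>PiE O' (\<lambda>_. {..K::nat}). c \<alpha> * (\<Prod>o'\<in>O'. z o' ^ \<alpha> o')) = 0"
    and "\<alpha> \<in> PiE O' (\<lambda>_. {..K})"
  shows "c \<alpha> = 0"
  using assms
proof (induction O' arbitrary: c \<alpha> rule: finite_induct)
  case empty
  then show ?case by simp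
next
  case (insert x S)
  have split: "(\<Sum>\<alpha>\<in>PiE (insert x S) (\<lambda>_. {..K}). c \<alpha> * (\<Prod>o'\<in>insert x S. z o' ^ \<alpha> o')) =
     (\<Sum>k\<le>K. (\<Sum>\<alpha>\<in>PiE S (\<lambda>_. {..K}). c (\<alpha>(x := k)) * (\<Prod>o'\<in>S. z o' ^ \<alpha> o')) * z x ^ k)" for z :: "'o \<Rightarrow> complex"
  proof -
    have "(\<Sum>\<alpha>\<in>PiE (insert x S) (\<lambda>_. {..K}). c \<alpha> * (\<Prod>o'\<in>insert x S. z o' ^ \<alpha> o')) =
      (\<Sum>p\<in>{..K} \<times> PiE S (\<lambda>_. {..K}). c ((snd p)(x := fst p)) * (\<Prod>o'\<in>insert x S. z o' ^ ((snd p)(x := fst p)) o'))"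
      unfolding PiE_insert_eq
      by (subst sum.reindex[OF inj_combinator[OF insert.hyps(2)]]) (simp add: case_prod_unfold o_def)
    also have "\<dots> = (\<Sum>k\<le>K. \<Sum>\<alpha>\<in>PiE S (\<lambda>_. {..K}). c (\<alpha>(x := k)) * (\<Prod>o'\<in>insert x S. z o' ^ (\<alpha>(x := k)) o'))"
      by (simp add: sum.cartesian_product case_prod_unfold)
    also have "\<dots> = (\<Sum>k\<le>K. \<Sum>\<alpha>\<in>PiE S (\<lambda>_. {..K}). c (\<alpha>(x := k)) * (\<Prod>o'\<in>S. z o' ^ \<alpha> o') * z x ^ k)"
    proof (intro sum.cong refl)
      fix k \<alpha>
      have "(\<Prod>o'\<in>S. z o' ^ (\<alpha>(x := k)) o') = (\<Prod>o'\<in>S. z o' ^ \<alpha> o')"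
        using insert.hyps by (intro prod.cong) auto
      then show "c (\<alpha>(x := k)) * (\<Prod>o'\<in>insert x S. z o' ^ (\<alpha>(x := k)) o') = c (\<alpha>(x := k)) * (\<Prod>o'\<in>S. z o' ^ \<alpha> o') * z x ^ k"
        using insert.hyps by simp
    qed
    finally show ?thesis by (simp add: sum_distrib_right)
  qed
  have zero: "(\<Sum>\<alpha>\<in>PiE S (\<lambda>_. {..K}). c (\<alpha>(x := k)) * (\<Prod>o'\<in>S. z o' ^ \<alpha> o')) = 0" if "k \<le> K" for k and z :: "'o \<Rightarrow> complex"
  proof -
    define a where "a k = (\<Sum>\<alpha>\<in>PiE S (\<lambda>_. {..K}). c (\<alpha>(x := k)) * (\<Prod>o'\<in>S. z o' ^ \<alpha> o'))" for k
    have "(\<Sum>k\<le>K. a k * w ^ k) = 0" for w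
    proof -
      have "(\<Prod>o'\<in>S. (z(x := w)) o' ^ \<alpha> o') = (\<Prod>o'\<in>S. z o' ^ \<alpha> o')" for \<alpha> :: "'o \<Rightarrow> nat"
        using insert.hyps by (intro prod.cong) auto
      then show ?thesis using insert.prems(1)[of "z(x := w)"] unfolding split a_def by simp
    qed
    then have "a k = 0" using that polyfun_eq_0[of a K] by auto
    then show ?thesis by (simp add: a_def)
  qed
  obtain k \<beta> where k: "k \<le> K" "\<beta> \<in> PiE S (\<lambda>_. {..K})" "\<alpha> = \<beta>(x := k)"
    using insert.prems(2) unfolding PiE_insert_eq by auto
  show ?case using insert.IH[of "\<lambda>\<alpha>. c (\<alpha>(x := k))", OF zero[OF k(1)] k(2)] by (simp only: k(3))
qed

text \<open>The monomials in the \<Psi> with exponents up to \<open>K\<close> outnumber the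
  monomials of a box that contains all of them, so a nontrivial combination vanishes; independence
  of monomials makes that combination a nonzero polynomial.\<close>

lemma algebraic_dependence:
  fixes \<Psi> :: "'o \<Rightarrow> ('u \<Rightarrow> complex) \<Rightarrow> complex"
  assumes "finite U" "finite O'" "card U < card O'" "\<And>x. x \<in> O' \<Longrightarrow> \<Psi> x \<in> poly_fun U"
  shows "\<exists>D\<in>poly_fun O'. (\<exists>z. D z \<noteq> 0) \<and> (\<forall>p. D (\<lambda>x. \<Psi> x p) = 0)"
proof -
  have "\<forall>x\<in>O'. \<exists>d. \<Psi> x \<in> box_poly U d"
    using poly_fun_subset_box_poly[OF assms(1)] assms(4) by blast
  then obtain d0 where d0: "\<And>x. x \<in> O' \<Longrightarrow> \<Psi> x \<in> box_poly U (d0 x)" by metis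
  define d where "d = Suc (\<Sum>x\<in>O'. d0 x)"
  have d: "\<Psi> x \<in> box_poly U d" if "x \<in> O'" for x
    by (rule box_poly_mono[OF assms(1) d0[OF that]])
       (use member_le_sum[of x O' d0] assms(2) that in \<open>auto simp: d_def intro: le_SucI\<close>)
  define m where "m = card U"
  define r where "r = card O' * d"
  \<comment> \<open>This choice turns \<open>((K + 1) * r) ^ m\<close> into
    \<open>(K + 1) ^ m * K\<close>, which is just below \<open>(K + 1) ^ Suc m\<close>. The
    \<open>Suc\<close> in \<open>d\<close> keeps \<open>r\<close> positive, so that
    \<open>K * r + 1\<close> is at most \<open>(K + 1) * r\<close>.\<close>
  define K where "K = r ^ m"
  define I where "I = PiE O' (\<lambda>_. {..K})"
  define J where "J = PiE U (\<lambda>_. {..K * r})"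
  have finI: "finite I" and finJ: "finite J"
    using assms by (auto simp: I_def J_def finite_PiE)
  have "r \<ge> 1" using assms(3) by (simp add: r_def d_def)
  have "card J = (K * r + 1) ^ m" using assms(1) by (simp add: J_def card_PiE m_def)
  also have "\<dots> \<le> ((K + 1) * r) ^ m" using \<open>r \<ge> 1\<close> by (intro power_mono) auto
  also have "\<dots> = (K + 1) ^ m * K" unfolding power_mult_distrib by (simp add: K_def)
  also have "\<dots> < (K + 1) ^ m * (K + 1)" by simp
  also have "\<dots> = (K + 1) ^ Suc m" by simp
  also have "\<dots> \<le> (K + 1) ^ card O'" using assms(3) by (intro power_increasing) (auto simp: m_def)
  also have "\<dots> = card I" using assms(2) by (simp add: I_def card_PiE)
  finally have card: "card J < card I" .
  have "\<exists>c. \<forall>p. (\<Prod>x\<in>O'. \<Psi> x p ^ \<alpha> x) = (\<Sum>\<beta>\<in>J. c \<beta> * (\<Prod>u\<in>U. p u ^ \<beta> u))" if "\<alpha> \<in> I" for \<alpha>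
  proof -
    have "(\<lambda>p. \<Prod>x\<in>O'. \<Psi> x p ^ \<alpha> x) \<in> box_poly U (\<Sum>x\<in>O'. \<alpha> x * d)"
      by (intro box_poly_prod box_poly_power assms d)
    moreover have "(\<Sum>x\<in>O'. \<alpha> x * d) \<le> (\<Sum>x\<in>O'. K * d)"
      using that by (intro sum_mono mult_right_mono) (auto simp: I_def PiE_def Pi_def)
    ultimately have "(\<lambda>p. \<Prod>x\<in>O'. \<Psi> x p ^ \<alpha> x) \<in> box_poly U (K * r)"
      using box_poly_mono[OF assms(1)] by (simp add: r_def mult_ac)
    then show ?thesis unfolding box_poly_def J_def by blast
  qed
  then obtain c where c: "\<And>\<alpha> p. \<alpha> \<in> I \<Longrightarrow> (\<Prod>x\<in>O'. \<Psi> x p ^ \<alpha> x) = (\<Sum>\<beta>\<in>J. c \<alpha> \<beta> * (\<Prod>u\<in>U. p u ^ \<beta> u))"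
    by metis
  from underdetermined_system_has_nonzero_solution[OF finJ finI card, of c] obtain a where
    a: "\<exists>\<alpha>\<in>I. a \<alpha> \<noteq> 0" "\<And>\<beta>. \<beta> \<in> J \<Longrightarrow> (\<Sum>\<alpha>\<in>I. c \<alpha> \<beta> * a \<alpha>) = 0" by blast
  define D where "D z = (\<Sum>\<alpha>\<in>I. a \<alpha> * (\<Prod>x\<in>O'. z x ^ \<alpha> x))" for z
  have "D \<in> poly_fun O'"
    unfolding D_def by (intro poly_fun_intros)
  moreover have "\<exists>z. D z \<noteq> 0"
  proof (rule ccontr)
    assume "\<not> ?thesis"
    then have "a \<alpha> = 0" if "\<alpha> \<in> I" for \<alpha>
      using monomials_independent[OF assms(2), of a K \<alpha>] that unfolding D_def I_def by blast
    then show False using a(1) by blast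
  qed
  moreover have "D (\<lambda>x. \<Psi> x p) = 0" for p
  proof -
    have "D (\<lambda>x. \<Psi> x p) = (\<Sum>\<alpha>\<in>I. a \<alpha> * (\<Sum>\<beta>\<in>J. c \<alpha> \<beta> * (\<Prod>u\<in>U. p u ^ \<beta> u)))"
      unfolding D_def by (intro sum.cong) (auto simp: c)
    also have "\<dots> = (\<Sum>\<beta>\<in>J. (\<Sum>\<alpha>\<in>I. c \<alpha> \<beta> * a \<alpha>) * (\<Prod>u\<in>U. p u ^ \<beta> u))"
      unfolding sum_distrib_left sum_distrib_right by (subst sum.swap) (simp add: mult_ac)
    also have "\<dots> = 0" using a(2) by simp
    finally show ?thesis .
  qed
  ultimately show ?thesis by blast
qed

lemma poly_fun_nonzero_off_finite_on_line:
  assumes "f \<in> poly_fun W" "f (\<lambda>u. a u + t * b u) \<noteq> 0"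
  shows "finite {s. f (\<lambda>u. a u + s * b u) = 0}"
proof -
  obtain p where p: "\<And>s. f (\<lambda>u. a u + s * b u) = poly p s" using poly_fun_on_line[OF assms(1)] by blast
  then have "p \<noteq> 0" using assms(2) by auto
  then show ?thesis unfolding p by (rule poly_roots_finite)
qed

text \<open>Two points where the respective factors do not vanish are joined by a line. Each factor
  has only finitely many zeros on it, so some point of the line avoids both.\<close>

lemma poly_fun_nonzero_prod:
  assumes "finite I" "\<And>i. i \<in> I \<Longrightarrow> f i \<in> poly_fun W" "\<And>i. i \<in> I \<Longrightarrow> \<exists>z. f i z \<noteq> 0"
  shows "\<exists>z. (\<Prod>i\<in>I. f i z) \<noteq> 0"
  using assms
proof (induction I rule: finite_induct)
  case (insert i I)
  then obtain a where a: "(\<Prod>i\<in>I. f i a) \<noteq> 0" by auto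
  obtain b where b: "f i b \<noteq> 0" using insert.prems by blast
  define l where "l s u = a u + s * (b u - a u)" for s u
  have l: "l 0 = a" "l 1 = b" by (auto simp: l_def)
  have "finite {s. (\<Prod>i\<in>I. f i (l s)) = 0}"
    unfolding l_def using a insert.prems l(1)
    by (intro poly_fun_nonzero_off_finite_on_line[where t = 0 and a = a and b = "\<lambda>u. b u - a u" and f = "\<lambda>z. \<Prod>i\<in>I. f i z" and W = W] poly_fun_prod) auto
  moreover have "finite {s. f i (l s) = 0}"
    unfolding l_def using b insert.prems l(2)
    by (intro poly_fun_nonzero_off_finite_on_line[where t = 1 and f = "f i" and a = a and b = "\<lambda>u. b u - a u" and W = W]) (auto simp: l_def[abs_def])
  ultimately have "finite ({s. (\<Prod>i\<in>I. f i (l s)) = 0} \<union> {s. f i (l s) = 0})" by blast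
  then obtain s where "s \<notin> {s. (\<Prod>i\<in>I. f i (l s)) = 0} \<union> {s. f i (l s) = 0}"
    using ex_new_if_finite[OF infinite_UNIV_char_0] by blast
  then show ?case using insert.hyps by (intro exI[of _ "l s"]) auto
qed auto

section \<open>Conservation of zeros\<close>

text \<open>Coordinates for the family \<open>(1 - \<theta>) P0(w) + \<theta> P1(w) + A w + c\<close>: \<open>Unk\<close> for \<open>w\<close>, \<open>Mat\<close> for \<open>A\<close>,
  \<open>Cst\<close> for \<open>c\<close> and \<open>Hom\<close> for \<open>\<theta>\<close>.\<close>

datatype 'v pvar = Unk 'v | Mat 'v 'v | Cst 'v | Hom

lemma Mat_in_image_iff [simp]: "Mat i k \<in> case_prod Mat ` S \<longleftrightarrow> (i, k) \<in> S"
  by (force simp: image_iff)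

locale poly_homotopy =
  fixes X :: "'v set" and P0 P1 :: "'v \<Rightarrow> ('v \<Rightarrow> complex) \<Rightarrow> complex"
  assumes finX: "finite X"
    and P0: "\<And>i. i \<in> X \<Longrightarrow> P0 i \<in> poly_fun X"
    and P1: "\<And>i. i \<in> X \<Longrightarrow> P1 i \<in> poly_fun X"
begin

definition "pars = case_prod Mat ` (X \<times> X) \<union> Cst ` X \<union> {Hom}"
definition "unks = Unk ` X"
definition "vars = unks \<union> pars"

definition H :: "'v \<Rightarrow> ('v pvar \<Rightarrow> complex) \<Rightarrow> complex" where
  "H i z = (1 - z Hom) * P0 i (\<lambda>u. z (Unk u)) + z Hom * P1 i (\<lambda>u. z (Unk u))"

definition dH :: "'v \<Rightarrow> 'v \<Rightarrow> ('v pvar \<Rightarrow> complex) \<Rightarrow> complex" where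
  "dH i k z = (1 - z Hom) * pd k (P0 i) (\<lambda>u. z (Unk u)) + z Hom * pd k (P1 i) (\<lambda>u. z (Unk u))"

text \<open>Equation \<open>i\<close> carries the index \<open>Unk i\<close>, so that equations and
  unknowns share the index set \<open>unks\<close> that \<open>singular_at\<close> expects; at other
  indices the value is a dummy.\<close>

definition pert :: "'v pvar \<Rightarrow> ('v pvar \<Rightarrow> complex) \<Rightarrow> complex" where
  "pert q z = (case q of Unk i \<Rightarrow> H i z + (\<Sum>k\<in>X. z (Mat i k) * z (Unk k)) + z (Cst i) | _ \<Rightarrow> 0)"

lemma fin_vars: "finite unks" "finite pars" "finite vars"
  using finX by (auto simp: unks_def pars_def vars_def)

lemma poly_H: "i \<in> X \<Longrightarrow> H i \<in> poly_fun (unks \<union> {Hom})"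
  unfolding H_def unks_def
  by (intro poly_fun_intros poly_fun_subst[OF P0] poly_fun_subst[OF P1]) auto

lemma poly_dH: "i \<in> X \<Longrightarrow> dH i k \<in> poly_fun (unks \<union> {Hom})"
  unfolding dH_def unks_def
  by (intro poly_fun_intros poly_fun_subst[OF poly_fun_pd[OF P0]] poly_fun_subst[OF poly_fun_pd[OF P1]]) auto

lemma poly_pert: "q \<in> unks \<Longrightarrow> pert q \<in> poly_fun vars"
proof -
  assume "q \<in> unks"
  then obtain i where i: "i \<in> X" "q = Unk i" by (auto simp: unks_def)
  have "H i \<in> poly_fun vars"
    by (rule poly_fun_mono[OF poly_H[OF i(1)]]) (auto simp: vars_def pars_def)
  then show ?thesis
    unfolding pert_def i(2) pvar.case using i(1)
    by (intro poly_fun_intros) (auto simp: vars_def unks_def pars_def)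
qed

lemma pd_pert:
  assumes "i \<in> X" "k \<in> X"
  shows "pd (Unk k) (pert (Unk i)) z = dH i k z + z (Mat i k)"
proof -
  have inj: "inj Unk" by (auto simp: inj_def)
  let ?W = "vars"
  have v: "(\<lambda>z. z q) \<in> poly_fun ?W" if "q \<in> ?W" for q by (rule pvar[OF that])
  have vH: "(\<lambda>z. z Hom) \<in> poly_fun ?W" by (rule v) (simp add: vars_def pars_def)
  have vU: "(\<lambda>z. z (Unk u)) \<in> poly_fun ?W" if "u \<in> X" for u
    by (rule v) (use that in \<open>simp add: vars_def unks_def\<close>)
  have vM: "(\<lambda>z. z (Mat i u)) \<in> poly_fun ?W" if "u \<in> X" for u
    by (rule v) (use that assms in \<open>auto simp: vars_def pars_def\<close>)
  have vC: "(\<lambda>z. z (Cst i)) \<in> poly_fun ?W"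
    by (rule v) (use assms in \<open>auto simp: vars_def pars_def\<close>)
  have q0: "(\<lambda>z. P0 i (\<lambda>u. z (Unk u))) \<in> poly_fun ?W" by (rule poly_fun_subst[OF P0[OF assms(1)] vU])
  have q1: "(\<lambda>z. P1 i (\<lambda>u. z (Unk u))) \<in> poly_fun ?W" by (rule poly_fun_subst[OF P1[OF assms(1)] vU])
  have H: "H i \<in> poly_fun ?W" by (rule poly_fun_mono[OF poly_H[OF assms(1)]]) (auto simp: vars_def pars_def)
  have dh: "pd (Unk k) (H i) z = dH i k z"
  proof -
    have 1: "(\<lambda>z. 1 - z Hom) \<in> poly_fun ?W" by (intro poly_fun_intros vH)
    have "pd (Unk k) (H i) z = pd (Unk k) (\<lambda>z. (1 - z Hom) * P0 i (\<lambda>u. z (Unk u)) + z Hom * P1 i (\<lambda>u. z (Unk u))) z"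
      by (simp add: H_def[abs_def])
    also have "\<dots> = dH i k z"
      by (subst pd_add[OF pmult[OF 1 q0] pmult[OF vH q1]], subst pd_mult[OF 1 q0], subst pd_mult[OF vH q1])
         (simp add: pd_diff[OF pconst vH] pd_const pd_var dH_def
           pd_reindex[OF P0[OF assms(1)] inj] pd_reindex[OF P1[OF assms(1)] inj])
    finally show ?thesis .
  qed
  have s: "(\<lambda>z. \<Sum>k\<in>X. z (Mat i k) * z (Unk k)) \<in> poly_fun ?W"
    by (intro poly_fun_sum pmult vM vU)
  have ds: "pd (Unk k) (\<lambda>z. \<Sum>k\<in>X. z (Mat i k) * z (Unk k)) z = z (Mat i k)"
  proof -
    have "pd (Unk k) (\<lambda>z. \<Sum>k\<in>X. z (Mat i k) * z (Unk k)) z = (\<Sum>l\<in>X. pd (Unk k) (\<lambda>z. z (Mat i l) * z (Unk l)) z)"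
      by (rule pd_sum[where W = vars]) (intro pmult vM vU)
    also have "\<dots> = (\<Sum>l\<in>X. if l = k then z (Mat i l) else 0)"
      by (intro sum.cong refl) (subst pd_mult[OF vM vU], auto simp: pd_var)
    finally show ?thesis using finX assms(2) by simp
  qed
  have "pert (Unk i) = (\<lambda>z. H i z + (\<Sum>k\<in>X. z (Mat i k) * z (Unk k)) + z (Cst i))"
    by (simp add: pert_def fun_eq_iff)
  then show ?thesis
    using pd_add[OF padd[OF H s] vC, of "Unk k" z] pd_add[OF H s, of "Unk k" z] dh ds
    by (simp add: pd_var)
qed

text \<open>The entries of \<open>A\<close> enter the Jacobian additively; this is what allows a
  column of \<open>A\<close> to be eliminated at a singular zero.\<close>

lemma singular_pert_iff:
  "singular_at unks pert z \<longleftrightarrow>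
    (\<exists>x. (\<exists>u\<in>X. x u \<noteq> 0) \<and> (\<forall>i\<in>X. (\<Sum>k\<in>X. (dH i k z + z (Mat i k)) * x k) = 0))"
proof -
  have eq: "(\<Sum>k\<in>unks. pd k (pert (Unk i)) z * x k) = (\<Sum>k\<in>X. (dH i k z + z (Mat i k)) * x (Unk k))"
    if "i \<in> X" for i x
    using that unfolding unks_def by (subst sum.reindex) (auto simp: inj_on_def pd_pert)
  show ?thesis (is "?L \<longleftrightarrow> ?R")
  proof
    assume ?L
    then obtain x where "\<exists>u\<in>unks. x u \<noteq> 0" "\<forall>i\<in>unks. (\<Sum>k\<in>unks. pd k (pert i) z * x k) = 0"
      unfolding singular_at_def by blast
    then show ?R by (intro exI[of _ "\<lambda>u. x (Unk u)"]) (auto simp: eq[symmetric], auto simp: unks_def)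
  next
    assume ?R
    then obtain x where x: "\<exists>u\<in>X. x u \<noteq> 0" "\<forall>i\<in>X. (\<Sum>k\<in>X. (dH i k z + z (Mat i k)) * x k) = 0" by blast
    have "(\<Sum>k\<in>unks. pd k (pert (Unk i)) z * (case k of Unk u \<Rightarrow> x u | _ \<Rightarrow> 0)) = 0" if "i \<in> X" for i
      using x(2) that by (simp add: eq)
    then show ?L unfolding singular_at_def using x(1)
      by (intro exI[of _ "\<lambda>q. case q of Unk u \<Rightarrow> x u | _ \<Rightarrow> 0"]) (auto simp: unks_def)
  qed
qed

text \<open>At a singular zero with kernel vector \<open>x\<close> normalised by \<open>x j = 1\<close>, column \<open>j\<close> of \<open>A\<close> and the
  vector \<open>c\<close> are polynomials in \<open>w\<close>, \<open>\<theta>\<close>, the other columns of \<open>A\<close> and the other entries of \<open>x\<close>.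
  In this parametrisation the coordinate \<open>Cst k\<close> holds the entry \<open>x k\<close>, not \<open>c k\<close>.\<close>

lemma column_discriminant:
  assumes j: "j \<in> X"
  shows "\<exists>D\<in>poly_fun pars. (\<exists>z. D z \<noteq> 0) \<and>
    (\<forall>z x. (\<forall>i\<in>X. pert (Unk i) z = 0) \<longrightarrow> x j \<noteq> 0 \<longrightarrow>
       (\<forall>i\<in>X. (\<Sum>k\<in>X. (dH i k z + z (Mat i k)) * x k) = 0) \<longrightarrow> D z = 0)"
proof -
  \<comment> \<open>With \<open>N = card X\<close> there are \<open>N\<close> unknowns,
    \<open>N * (N - 1)\<close> matrix entries, \<open>N - 1\<close> kernel entries and the homotopy
    parameter, in all \<open>N * N + N\<close> coordinates: one fewer than in
    \<open>pars\<close>.\<close>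
  define U where "U = unks \<union> case_prod Mat ` (X \<times> (X - {j})) \<union> Cst ` (X - {j}) \<union> {Hom}"
  have finU: "finite U" using finX by (simp add: U_def unks_def)
  define N where "N = card X"
  have N: "N \<ge> 1" using j finX by (auto simp: N_def card_gt_0_iff Suc_le_eq)
  have injM: "inj_on (case_prod Mat) A" for A :: "('v \<times> 'v) set" by (auto simp: inj_on_def)
  have "card U \<le> card unks + card (case_prod Mat ` (X \<times> (X - {j}))) + card (Cst ` (X - {j})) + card {Hom :: 'v pvar}"
    unfolding U_def by (intro order_trans[OF card_Un_le] add_mono order_refl)
  also have "card unks = N" by (simp add: unks_def N_def card_image inj_on_def)
  also have "card (case_prod Mat ` (X \<times> (X - {j}))) = N * (N - 1)"
    using j finX by (simp add: card_image[OF injM] card_cartesian_product N_def)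
  also have "card (Cst ` (X - {j})) = N - 1"
    using j finX by (simp add: card_image inj_on_def N_def)
  also have "N + N * (N - 1) + (N - 1) + card {Hom :: 'v pvar} = N * N + N"
    using N by (cases N) auto
  finally have cardU: "card U \<le> N * N + N" .
  have "card pars = card (case_prod Mat ` (X \<times> X)) + card (Cst ` X) + card {Hom :: 'v pvar}"
    unfolding pars_def using finX
    by (subst card_Un_disjoint; (subst card_Un_disjoint)?) auto
  also have "\<dots> = N * N + N + 1"
    using finX by (simp add: card_image[OF injM] card_image inj_on_def card_cartesian_product N_def)
  finally have card: "card U < card pars" using cardU by simp
  define \<Psi>M where "\<Psi>M i k p = (if k = j then - dH i j p - (\<Sum>l\<in>X - {j}. (dH i l p + p (Mat i l)) * p (Cst l))
      else p (Mat i k))" for i k and p :: "'v pvar \<Rightarrow> complex"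
  define \<Psi> where "\<Psi> q p = (case q of Unk u \<Rightarrow> 0 | Mat i k \<Rightarrow> \<Psi>M i k p
      | Cst i \<Rightarrow> - H i p - (\<Sum>k\<in>X. \<Psi>M i k p * p (Unk k)) | Hom \<Rightarrow> p Hom)" for q and p :: "'v pvar \<Rightarrow> complex"
  have U1: "unks \<union> {Hom} \<subseteq> U" by (auto simp: U_def)
  have \<Psi>M: "\<Psi>M i k \<in> poly_fun U" if "i \<in> X" "k \<in> X" for i k
  proof (cases "k = j")
    case True
    have "(\<lambda>p. - dH i j p - (\<Sum>l\<in>X - {j}. (dH i l p + p (Mat i l)) * p (Cst l))) \<in> poly_fun U"
      using that by (intro poly_fun_intros poly_fun_mono[OF poly_dH U1]) (auto simp: U_def)
    then show ?thesis using True by (simp add: \<Psi>M_def[abs_def])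
  next
    case False
    then have "(\<lambda>p. p (Mat i k)) \<in> poly_fun U" using that by (intro pvar) (auto simp: U_def)
    then show ?thesis using False by (simp add: \<Psi>M_def[abs_def])
  qed
  have \<Psi>: "\<Psi> q \<in> poly_fun U" if q: "q \<in> pars" for q
  proof -
    consider (M) i k where "i \<in> X" "k \<in> X" "q = Mat i k" | (C) i where "i \<in> X" "q = Cst i" | (H) "q = Hom"
      using q by (auto simp: pars_def)
    then show ?thesis
    proof cases
      case M
      then show ?thesis using \<Psi>M by (simp add: \<Psi>_def[abs_def])
    next
      case C
      have "(\<lambda>p. - H i p - (\<Sum>k\<in>X. \<Psi>M i k p * p (Unk k))) \<in> poly_fun U"
        using C(1) by (intro poly_fun_intros poly_fun_mono[OF poly_H U1] \<Psi>M) (auto simp: U_def unks_def)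
      then show ?thesis using C by (simp add: \<Psi>_def[abs_def])
    next
      case H
      have "(\<lambda>p. p Hom) \<in> poly_fun U" by (intro pvar) (simp add: U_def)
      then show ?thesis using H by (simp add: \<Psi>_def[abs_def])
    qed
  qed
  from algebraic_dependence[OF finU fin_vars(2) card, of \<Psi>] \<Psi> obtain D where
    D: "D \<in> poly_fun pars" "\<exists>z. D z \<noteq> 0" "\<And>p. D (\<lambda>q. \<Psi> q p) = 0" by blast
  have "D z = 0" if zero: "\<forall>i\<in>X. pert (Unk i) z = 0" and xj: "x j \<noteq> 0"
    and ker: "\<forall>i\<in>X. (\<Sum>k\<in>X. (dH i k z + z (Mat i k)) * x k) = 0" for z x
  proof -
    \<comment> \<open>The preimage of \<open>z\<close> under the parametrisation: only the slots
      \<open>Cst l\<close> change, to the kernel vector rescaled to have entry 1 at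
      \<open>j\<close>.\<close>
    define p where "p q = (case q of Cst l \<Rightarrow> x l / x j | _ \<Rightarrow> z q)" for q
    have p: "p (Unk u) = z (Unk u)" "p Hom = z Hom" "p (Mat i k) = z (Mat i k)" "p (Cst u) = x u / x j" for u i k
      by (simp_all add: p_def)
    have dHp: "dH i k p = dH i k z" and Hp: "H i p = H i z" for i k
      by (simp_all add: dH_def H_def p)
    have M: "\<Psi>M i k p = z (Mat i k)" if i: "i \<in> X" for i k
    proof (cases "k = j")
      case True
      have "0 = (\<Sum>k\<in>X. (dH i k z + z (Mat i k)) * x k) / x j" using ker i by simp
      also have "\<dots> = (\<Sum>k\<in>X. (dH i k z + z (Mat i k)) * (x k / x j))"
        by (simp add: sum_divide_distrib)
      also have "\<dots> = dH i j z + z (Mat i j) + (\<Sum>k\<in>X - {j}. (dH i k z + z (Mat i k)) * (x k / x j))"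
        using finX j xj by (simp add: sum.remove)
      finally have 0: "0 = dH i j z + z (Mat i j) + (\<Sum>k\<in>X - {j}. (dH i k z + z (Mat i k)) * (x k / x j))" .
      have "b = - a - s" if "0 = a + b + s" for a b s :: complex
        using that by (auto simp: complex_eq_iff)
      from this[OF 0] have *: "z (Mat i j) = - dH i j z - (\<Sum>k\<in>X - {j}. (dH i k z + z (Mat i k)) * (x k / x j))"
        .
      show ?thesis unfolding True \<Psi>M_def by (simp only: dHp p refl if_True) (simp only: *)
    qed (simp add: \<Psi>M_def p)
    have "\<Psi> q p = z q" if q: "q \<in> pars" for q
    proof -
      have "\<Psi> (Cst i) p = z (Cst i)" if "i \<in> X" for i
      proof -
        have "- a - s = c" if "a + s + c = 0" for a s c :: complex
          using that by (auto simp: complex_eq_iff)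
        moreover have "H i z + (\<Sum>k\<in>X. z (Mat i k) * z (Unk k)) + z (Cst i) = 0"
          using zero that by (simp add: pert_def)
        ultimately show ?thesis using that by (simp add: \<Psi>_def M p Hp)
      qed
      then show ?thesis using q M by (auto simp: pars_def \<Psi>_def p)
    qed
    then have "D (\<lambda>q. \<Psi> q p) = D z" by (intro poly_fun_cong[OF D(1)])
    then show ?thesis using D(3) by simp
  qed
  then show ?thesis using D(1,2) by blast
qed

text \<open>A kernel vector is nonzero at some \<open>j\<close>, and the discriminant of column
  \<open>j\<close> then vanishes; the product over all columns therefore covers every singular
  zero.\<close>

lemma discriminant:
  "\<exists>D\<in>poly_fun pars. (\<exists>z. D z \<noteq> 0) \<and>
    (\<forall>z. (\<forall>i\<in>X. pert (Unk i) z = 0) \<longrightarrow> singular_at unks pert z \<longrightarrow> D z = 0)"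
proof -
  have "\<forall>j\<in>X. \<exists>D. D \<in> poly_fun pars \<and> (\<exists>z. D z \<noteq> 0) \<and>
    (\<forall>z x. (\<forall>i\<in>X. pert (Unk i) z = 0) \<longrightarrow> x j \<noteq> 0 \<longrightarrow>
       (\<forall>i\<in>X. (\<Sum>k\<in>X. (dH i k z + z (Mat i k)) * x k) = 0) \<longrightarrow> D z = 0)"
    using column_discriminant by blast
  from bchoice[OF this] obtain D where D: "\<And>j. j \<in> X \<Longrightarrow> D j \<in> poly_fun pars" "\<And>j. j \<in> X \<Longrightarrow> \<exists>z. D j z \<noteq> 0"
    "\<And>j z x. j \<in> X \<Longrightarrow> (\<forall>i\<in>X. pert (Unk i) z = 0) \<Longrightarrow> x j \<noteq> 0 \<Longrightarrow>
       (\<forall>i\<in>X. (\<Sum>k\<in>X. (dH i k z + z (Mat i k)) * x k) = 0) \<Longrightarrow> D j z = 0"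
    by (elim exE) (simp, blast)
  have "(\<Prod>j\<in>X. D j z) = 0" if "\<forall>i\<in>X. pert (Unk i) z = 0" "singular_at unks pert z" for z
    using that(2) D(3)[OF _ that(1)] finX unfolding singular_pert_iff by (auto simp: prod_zero_iff)
  then show ?thesis
    using poly_fun_nonzero_prod[OF finX D(1,2)] poly_fun_prod[OF D(1), of X]
    by (intro bexI[of _ "\<lambda>z. \<Prod>j\<in>X. D j z"]) auto
qed

end

section \<open>Continuation of pairs of zeros along the homotopy\<close>

lemma sequentially_imp_open:
  fixes S :: "'a::metric_space set"
  assumes "\<And>x s. x \<in> S \<Longrightarrow> s \<longlonglongrightarrow> x \<Longrightarrow> \<forall>\<^sub>F n in sequentially. s n \<in> S"
  shows "open S"
proof -
  have "\<forall>\<^sub>F y in nhds x. y \<in> S" if "x \<in> S" for x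
    using sequentially_imp_eventually_nhds_within[of UNIV x "\<lambda>y. y \<in> S"] assms[OF that] by auto
  then show ?thesis by (subst open_subopen) (simp add: eventually_nhds subset_eq)
qed

context poly_homotopy
begin

definition comb :: "('v pvar \<Rightarrow> complex) \<Rightarrow> ('v \<Rightarrow> complex) \<Rightarrow> 'v pvar \<Rightarrow> complex" where
  "comb p w q = (case q of Unk u \<Rightarrow> w u | _ \<Rightarrow> p q)"

definition is_zero :: "('v pvar \<Rightarrow> complex) \<Rightarrow> ('v \<Rightarrow> complex) \<Rightarrow> bool" where
  "is_zero p w \<longleftrightarrow> (\<forall>i\<in>X. pert (Unk i) (comb p w) = 0)"

definition two_zeros :: "('v \<Rightarrow> complex) \<Rightarrow> real \<Rightarrow> ('v pvar \<Rightarrow> complex) \<Rightarrow> bool" where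
  "two_zeros a \<rho> p \<longleftrightarrow> (\<exists>w w'. in_polydisc X a \<rho> w \<and> in_polydisc X a \<rho> w' \<and>
     is_zero p w \<and> is_zero p w' \<and> (\<exists>u\<in>X. w u \<noteq> w' u))"

lemma comb_simps [simp]: "comb p w (Unk u) = w u" "comb p w (Mat i k) = p (Mat i k)"
  "comb p w (Cst i) = p (Cst i)" "comb p w Hom = p Hom"
  by (simp_all add: comb_def)

definition hset :: "('v pvar \<Rightarrow> complex) \<Rightarrow> complex \<Rightarrow> 'v pvar \<Rightarrow> complex" where
  "hset p \<theta> q = (if q = Hom then \<theta> else p q)"

lemma hset_simps [simp]: "hset p \<theta> (Unk u) = p (Unk u)" "hset p \<theta> (Mat i k) = p (Mat i k)"
  "hset p \<theta> (Cst i) = p (Cst i)" "hset p \<theta> Hom = \<theta>"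
  by (simp_all add: hset_def)

lemma tendsto_hset:
  assumes "(s \<longlongrightarrow> \<theta>) F" "((\<lambda>n. p n q) \<longlongrightarrow> p0 q) F"
  shows "((\<lambda>n. hset (p n) (s n) q) \<longlongrightarrow> hset p0 \<theta> q) F"
  using assms by (simp add: hset_def)

lemma unks_subset_vars: "unks \<subseteq> vars"
  by (simp add: vars_def)

lemma comb_pars: "q \<in> pars \<Longrightarrow> comb p w q = p q"
  by (auto simp: pars_def)

lemma comb_off_unks: "q \<in> vars - unks \<Longrightarrow> comb p w q = p q"
  by (auto simp: vars_def comb_pars)

lemma tendsto_comb:
  assumes "\<And>q. q \<in> pars \<Longrightarrow> ((\<lambda>n. p n q) \<longlongrightarrow> p0 q) F" "\<And>u. u \<in> X \<Longrightarrow> ((\<lambda>n. w n u) \<longlongrightarrow> w0 u) F" "q \<in> vars"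
  shows "((\<lambda>n. comb (p n) (w n) q) \<longlongrightarrow> comb p0 w0 q) F"
  using assms by (cases q) (auto simp: vars_def unks_def pars_def)

lemma is_zero_limit:
  assumes "\<And>q. q \<in> pars \<Longrightarrow> (\<lambda>n. p n q) \<longlonglongrightarrow> p0 q" "\<And>u. u \<in> X \<Longrightarrow> (\<lambda>n. w n u) \<longlonglongrightarrow> w0 u"
    and "\<And>n. is_zero (p n) (w n)"
  shows "is_zero p0 w0"
  unfolding is_zero_def
proof
  fix i assume i: "i \<in> X"
  have "(\<lambda>n. pert (Unk i) (comb (p n) (w n))) \<longlonglongrightarrow> pert (Unk i) (comb p0 w0)"
    using i by (intro tendsto_poly_fun[OF poly_pert] tendsto_comb assms) (auto simp: unks_def)
  moreover have "pert (Unk i) (comb (p n) (w n)) = 0" for n using assms(3) i by (auto simp: is_zero_def)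
  ultimately show "pert (Unk i) (comb p0 w0) = 0" by (simp add: LIMSEQ_const_iff)
qed

text \<open>In the limit a pair of zeros either stays a pair or merges, and merged zeros are
  singular. This is the closedness half of the continuation argument.\<close>

lemma two_zeros_limit:
  assumes p: "\<And>q. q \<in> pars \<Longrightarrow> (\<lambda>n. p n q) \<longlonglongrightarrow> p0 q" and two: "\<And>n. two_zeros a \<rho> (p n)"
  shows "two_zeros a \<rho> p0 \<or>
    (\<exists>w. in_polydisc X a \<rho> w \<and> is_zero p0 w \<and> singular_at unks pert (comb p0 w))"
proof -
  define Q where "Q n ww \<longleftrightarrow> (\<forall>u\<in>X. cmod (fst ww u - a u) \<le> \<rho>) \<and> (\<forall>u\<in>X. cmod (snd ww u - a u) \<le> \<rho>) \<and>
     is_zero (p n) (fst ww) \<and> is_zero (p n) (snd ww) \<and> (\<exists>u\<in>X. fst ww u \<noteq> snd ww u)" for n ww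
  have "\<exists>ww. Q n ww" for n
    using two[of n] unfolding two_zeros_def Q_def by auto
  then obtain ww where Q: "\<And>n. Q n (ww n)" by metis
  \<comment> \<open>The Boolean tells which of the two zeros is meant, so that a single subsequence
    makes both converge.\<close>
  define z where "z n q = (if snd q then snd (ww n) (fst q) else fst (ww n) (fst q))" for n and q :: "'v \<times> bool"
  have "norm (z n q) \<le> cmod (a (fst q)) + \<rho>" if "q \<in> X \<times> UNIV" for n q
  proof -
    have "cmod (z n q - a (fst q)) \<le> \<rho>" using Q[of n] that by (auto simp: z_def Q_def)
    then show ?thesis using norm_triangle_sub[of "z n q" "a (fst q)"] by linarith
  qed
  from bounded_family_convergent_subsequence[of "X \<times> (UNIV :: bool set)" z "\<lambda>q. cmod (a (fst q)) + \<rho>", OF _ this] finX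
  obtain r l where r: "strict_mono (r :: nat \<Rightarrow> nat)" and l: "\<And>q. q \<in> X \<times> UNIV \<Longrightarrow> (\<lambda>n. z (r n) q) \<longlonglongrightarrow> l q"
    by auto
  define w where "w u = l (u, False)" for u
  define w' where "w' u = l (u, True)" for u
  have w: "(\<lambda>n. fst (ww (r n)) u) \<longlonglongrightarrow> w u" and w': "(\<lambda>n. snd (ww (r n)) u) \<longlonglongrightarrow> w' u" if "u \<in> X" for u
    using l[of "(u, False)"] l[of "(u, True)"] that by (simp_all add: z_def w_def w'_def)
  have pr: "(\<lambda>n. p (r n) q) \<longlonglongrightarrow> p0 q" if "q \<in> pars" for q
    using LIMSEQ_subseq_LIMSEQ[OF p[OF that] r] by (simp add: o_def)
  have z0: "is_zero p0 w"
    by (rule is_zero_limit[OF pr w]) (use Q in \<open>auto simp: Q_def\<close>)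
  have z0': "is_zero p0 w'"
    by (rule is_zero_limit[OF pr w']) (use Q in \<open>auto simp: Q_def\<close>)
  have K: "cmod (w u - a u) \<le> \<rho>" if "u \<in> X" for u
    by (rule Lim_bounded[where M = 0, OF tendsto_norm[OF tendsto_diff[OF w[OF that] tendsto_const]]])
       (use Q that in \<open>auto simp: Q_def\<close>)
  have K': "cmod (w' u - a u) \<le> \<rho>" if "u \<in> X" for u
    by (rule Lim_bounded[where M = 0, OF tendsto_norm[OF tendsto_diff[OF w'[OF that] tendsto_const]]])
       (use Q that in \<open>auto simp: Q_def\<close>)
  show ?thesis
  proof (cases "\<exists>u\<in>X. w u \<noteq> w' u")
    case True
    then show ?thesis unfolding two_zeros_def using z0 z0' K K' by blast
  next
    case False
    have "singular_at unks pert (comb p0 w)"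
    proof (rule coalescing_zeros_singular[of vars])
      show "(\<lambda>n. comb (p (r n)) (fst (ww (r n))) q) \<longlonglongrightarrow> comb p0 w q" if "q \<in> vars" for q
        by (rule tendsto_comb[OF pr w that])
      show "(\<lambda>n. comb (p (r n)) (snd (ww (r n))) q) \<longlonglongrightarrow> comb p0 w q" if "q \<in> vars" for q
      proof (rule tendsto_comb[OF pr _ that])
        show "(\<lambda>n. snd (ww (r n)) u) \<longlonglongrightarrow> w u" if "u \<in> X" for u
          using w'[OF that] False that by simp
      qed
      show "comb (p (r n)) (fst (ww (r n))) q = comb (p (r n)) (snd (ww (r n))) q" if "q \<in> vars - unks" for n q
        using that by (simp add: comb_off_unks)
      show "\<exists>u\<in>unks. comb (p (r n)) (fst (ww (r n))) u \<noteq> comb (p (r n)) (snd (ww (r n))) u" for n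
        using Q[of "r n"] by (auto simp: Q_def unks_def)
      show "pert i (comb (p (r n)) (fst (ww (r n)))) = 0" "pert i (comb (p (r n)) (snd (ww (r n)))) = 0" if "i \<in> unks" for n i
        using Q[of "r n"] that by (auto simp: Q_def unks_def is_zero_def)
    qed (use fin_vars(3) unks_subset_vars poly_pert in auto)
    then show ?thesis using z0 K by blast
  qed
qed

lemma zero_persists:
  assumes p: "\<And>q. q \<in> pars \<Longrightarrow> (\<lambda>n. p n q) \<longlonglongrightarrow> p0 q"
    and w: "is_zero p0 w" "\<not> singular_at unks pert (comb p0 w)" and "r > 0"
  shows "\<forall>\<^sub>F n in sequentially. \<exists>w'. in_polydisc X w r w' \<and> is_zero (p n) w'"
proof -
  have "\<forall>\<^sub>F n in sequentially. \<exists>z. (\<forall>q. q \<notin> unks \<longrightarrow> z q = comb (p n) w q) \<and>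
    (\<forall>u\<in>unks. cmod (z u - comb p0 w u) \<le> r) \<and> (\<forall>i\<in>unks. pert i z = 0)"
  proof (rule nonsingular_zero_persists[of vars])
    show "(\<lambda>n. comb (p n) w q) \<longlonglongrightarrow> comb p0 w q" if "q \<in> vars" for q
      by (rule tendsto_comb[OF p _ that]) auto
    show "pert i (comb p0 w) = 0" if "i \<in> unks" for i
      using w(1) that by (auto simp: is_zero_def unks_def)
  qed (use w(2) \<open>r > 0\<close> fin_vars(3) unks_subset_vars poly_pert in auto)
  then show ?thesis
  proof eventually_elim
    case (elim n)
    then obtain z where z: "\<And>q. q \<notin> unks \<Longrightarrow> z q = comb (p n) w q"
      "\<And>u. u \<in> unks \<Longrightarrow> cmod (z u - comb p0 w u) \<le> r" "\<And>i. i \<in> unks \<Longrightarrow> pert i z = 0" by blast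
    have "pert (Unk i) (comb (p n) (\<lambda>u. z (Unk u))) = 0" if "i \<in> X" for i
    proof -
      have "pert (Unk i) (comb (p n) (\<lambda>u. z (Unk u))) = pert (Unk i) z"
        by (rule poly_fun_cong[OF poly_pert])
           (use that z(1) in \<open>auto simp: unks_def vars_def pars_def image_iff\<close>)
      then show ?thesis using z(3) that by (simp add: unks_def)
    qed
    then show ?case using z(2)[of "Unk _"] by (intro exI[of _ "\<lambda>u. z (Unk u)"]) (auto simp: is_zero_def unks_def)
  qed
qed

lemma two_zeros_persist:
  assumes p: "\<And>q. q \<in> pars \<Longrightarrow> (\<lambda>n. p n q) \<longlonglongrightarrow> p0 q"
    and w1: "\<And>u. u \<in> X \<Longrightarrow> cmod (w1 u - a u) < \<rho>" "is_zero p0 w1" "\<not> singular_at unks pert (comb p0 w1)"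
    and w2: "\<And>u. u \<in> X \<Longrightarrow> cmod (w2 u - a u) < \<rho>" "is_zero p0 w2" "\<not> singular_at unks pert (comb p0 w2)"
    and ne: "\<exists>u\<in>X. w1 u \<noteq> w2 u"
  shows "\<forall>\<^sub>F n in sequentially. two_zeros a \<rho> (p n)"
proof -
  obtain v where v: "v \<in> X" "w1 v \<noteq> w2 v" using ne by blast
  \<comment> \<open>A third of the distance in the coordinate \<open>v\<close> keeps the perturbed
    zeros distinct; the other entries keep them in the polydisc.\<close>
  define r where "r = Min ({cmod (w1 v - w2 v) / 3} \<union> (\<lambda>u. \<rho> - cmod (w1 u - a u)) ` X \<union> (\<lambda>u. \<rho> - cmod (w2 u - a u)) ` X)"
  have "r \<le> cmod (w1 v - w2 v) / 3"
    unfolding r_def using finX by (intro Min_le) auto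
  moreover have "r > 0" "\<And>u. u \<in> X \<Longrightarrow> r \<le> \<rho> - cmod (w1 u - a u)"
    "\<And>u. u \<in> X \<Longrightarrow> r \<le> \<rho> - cmod (w2 u - a u)"
    unfolding r_def using finX v w1(1) w2(1) by auto
  ultimately have r: "r > 0" "r \<le> cmod (w1 v - w2 v) / 3" "\<And>u. u \<in> X \<Longrightarrow> r \<le> \<rho> - cmod (w1 u - a u)"
    "\<And>u. u \<in> X \<Longrightarrow> r \<le> \<rho> - cmod (w2 u - a u)" by auto
  have e1: "\<forall>\<^sub>F n in sequentially. \<exists>w'. in_polydisc X w1 r w' \<and> is_zero (p n) w'"
    by (rule zero_persists[OF p w1(2,3) r(1)])
  have e2: "\<forall>\<^sub>F n in sequentially. \<exists>w'. in_polydisc X w2 r w' \<and> is_zero (p n) w'"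
    by (rule zero_persists[OF p w2(2,3) r(1)])
  from e1 e2 show ?thesis
  proof eventually_elim
    case (elim n)
    then obtain x y where x: "\<And>u. u \<in> X \<Longrightarrow> cmod (x u - w1 u) \<le> r" "is_zero (p n) x"
      and y: "\<And>u. u \<in> X \<Longrightarrow> cmod (y u - w2 u) \<le> r" "is_zero (p n) y" by blast
    have "cmod (x u - a u) \<le> \<rho>" if "u \<in> X" for u
      using x(1)[OF that] r(3)[OF that] norm_triangle_ineq[of "x u - w1 u" "w1 u - a u"] by simp
    moreover have "cmod (y u - a u) \<le> \<rho>" if "u \<in> X" for u
      using y(1)[OF that] r(4)[OF that] norm_triangle_ineq[of "y u - w2 u" "w2 u - a u"] by simp
    moreover have "x v \<noteq> y v"
    proof
      assume "x v = y v"
      then have "cmod (w1 v - w2 v) \<le> cmod (x v - w1 v) + cmod (y v - w2 v)"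
        using norm_triangle_ineq[of "w1 v - x v" "y v - w2 v"] by (simp add: norm_minus_commute)
      then show False using x(1)[OF v(1)] y(1)[OF v(1)] r(1,2) by linarith
    qed
    ultimately show ?case unfolding two_zeros_def using x(2) y(2) v(1) by blast
  qed
qed

text \<open>Small multiples of a point off the discriminant are off it as well, with finitely many
  exceptions. Along the \<open>Hom\<close> line through such a multiple the discriminant is a
  nonzero polynomial in \<theta>, and its finitely many roots contain all \<theta> with a singular
  zero.\<close>

lemma generic_parameters:
  "\<exists>p :: nat \<Rightarrow> 'v pvar \<Rightarrow> complex. (\<forall>q. (\<lambda>n. p n q) \<longlonglongrightarrow> 0) \<and>
    (\<forall>n. finite {\<theta>. \<exists>w. is_zero (hset (p n) \<theta>) w \<and> singular_at unks pert (comb (hset (p n) \<theta>) w)})"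
proof -
  from discriminant obtain D b where D: "D \<in> poly_fun pars" "D b \<noteq> 0"
    "\<And>z. (\<forall>i\<in>X. pert (Unk i) z = 0) \<Longrightarrow> singular_at unks pert z \<Longrightarrow> D z = 0" by blast
  have fin: "finite {s. D (\<lambda>q. 0 + s * b q) = 0}"
    by (rule poly_fun_nonzero_off_finite_on_line[OF D(1), of _ 1]) (use D(2) in simp)
  have "\<exists>s. cmod s < inverse (real (Suc n)) \<and> D (\<lambda>q. s * b q) \<noteq> 0" for n
  proof -
    have "infinite (ball (0::complex) (inverse (real (Suc n))))"
      by (rule uncountable_infinite) (simp add: uncountable_ball)
    then have "infinite (ball (0::complex) (inverse (real (Suc n))) - {s. D (\<lambda>q. 0 + s * b q) = 0})"
      using fin by simp
    then obtain s where "s \<in> ball (0::complex) (inverse (real (Suc n))) - {s. D (\<lambda>q. 0 + s * b q) = 0}"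
      by (metis finite.emptyI ex_in_conv)
    then show ?thesis by auto
  qed
  then obtain s where s: "\<And>n. cmod (s n) < inverse (real (Suc n))" "\<And>n. D (\<lambda>q. s n * b q) \<noteq> 0" by metis
  define p where "p n q = s n * b q" for n q
  have "s \<longlonglongrightarrow> 0"
    by (rule Lim_null_comparison[OF _ LIMSEQ_inverse_real_of_nat]) (use s(1) in \<open>auto intro!: always_eventually less_imp_le\<close>)
  then have "(\<lambda>n. p n q) \<longlonglongrightarrow> 0" for q
    using tendsto_mult_left_zero[of s sequentially "b q"] by (simp add: p_def)
  moreover have "finite {\<theta>. \<exists>w. is_zero (hset (p n) \<theta>) w \<and> singular_at unks pert (comb (hset (p n) \<theta>) w)}" for n
  proof -
    define c where "c q = (if q = Hom then 0 else p n q)" for q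
    define e where "e q = (if q = Hom then 1 else (0::complex))" for q :: "'v pvar"
    have ce: "(\<lambda>q. c q + \<theta> * e q) = hset (p n) \<theta>" for \<theta>
      by (auto simp: c_def e_def hset_def)
    \<comment> \<open>The value \<open>p n Hom\<close> of \<theta> only witnesses that the
      discriminant does not vanish identically along this line.\<close>
    have "hset (p n) (p n Hom) = (\<lambda>q. s n * b q)" by (auto simp: hset_def p_def)
    then have "D (hset (p n) (p n Hom)) \<noteq> 0" using s(2)[of n] by simp
    then have "finite {\<theta>. D (\<lambda>q. c q + \<theta> * e q) = 0}"
      by (intro poly_fun_nonzero_off_finite_on_line[OF D(1), of _ "p n Hom"]) (simp add: ce)
    moreover have "D (\<lambda>q. c q + \<theta> * e q) = 0"
      if "is_zero (hset (p n) \<theta>) w" "singular_at unks pert (comb (hset (p n) \<theta>) w)" for \<theta> w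
    proof -
      have "D (comb (hset (p n) \<theta>) w) = 0" using that by (intro D(3)) (auto simp: is_zero_def)
      moreover have "D (comb (hset (p n) \<theta>) w) = D (hset (p n) \<theta>)"
        by (rule poly_fun_cong[OF D(1)]) (rule comb_pars)
      ultimately show ?thesis by (simp add: ce)
    qed
    ultimately show ?thesis by (elim finite_subset[rotated]) auto
  qed
  ultimately show ?thesis by blast
qed

lemma is_zero_unperturbed: "is_zero (hset (\<lambda>_. 0) \<theta>) w \<longleftrightarrow> (\<forall>i\<in>X. (1 - \<theta>) * P0 i w + \<theta> * P1 i w = 0)"
  by (simp add: is_zero_def pert_def H_def)

lemma singular_unperturbed:
  "singular_at unks pert (comb (hset (\<lambda>_. 0) 0) w) \<longleftrightarrow> singular_at X P0 w"
  "singular_at unks pert (comb (hset (\<lambda>_. 0) 1) w) \<longleftrightarrow> singular_at X P1 w"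
  by (subst singular_pert_iff, simp add: singular_at_def dH_def)+

text \<open>Otherwise boundary zeros of ever smaller perturbations would accumulate, by compactness
  in \<theta> and \<open>w\<close> together, at a boundary zero of the unperturbed homotopy.\<close>

lemma zeros_off_boundary:
  assumes bd: "\<And>\<theta> w. cmod \<theta> \<le> 2 \<Longrightarrow> in_polydisc X a \<rho> w \<Longrightarrow> \<exists>u\<in>X. cmod (w u - a u) = \<rho> \<Longrightarrow>
      \<exists>i\<in>X. (1 - \<theta>) * P0 i w + \<theta> * P1 i w \<noteq> 0"
    and p: "\<And>q. (\<lambda>n. p n q) \<longlonglongrightarrow> 0"
  shows "\<forall>\<^sub>F n in sequentially. \<forall>\<theta> w. cmod \<theta> \<le> 2 \<longrightarrow> in_polydisc X a \<rho> w \<longrightarrow>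
    is_zero (hset (p n) \<theta>) w \<longrightarrow> (\<forall>u\<in>X. cmod (w u - a u) < \<rho>)"
proof (rule ccontr)
  define Q where "Q n \<theta>w \<longleftrightarrow> cmod (fst \<theta>w) \<le> 2 \<and> (\<forall>u\<in>X. cmod (snd \<theta>w u - a u) \<le> \<rho>) \<and>
    is_zero (hset (p n) (fst \<theta>w)) (snd \<theta>w) \<and> (\<exists>u\<in>X. cmod (snd \<theta>w u - a u) = \<rho>)" for n \<theta>w
  assume "\<not> ?thesis"
  then have "\<not> (\<forall>\<^sub>F n in sequentially. \<not> (\<exists>\<theta>w. Q n \<theta>w))"
    by (rule contrapos_nn) (erule eventually_mono, force simp: Q_def not_le[symmetric] intro: antisym)
  from not_eventually_sequentiallyD[OF this] obtain k where k: "strict_mono (k :: nat \<Rightarrow> nat)" "\<And>n. \<exists>\<theta>w. Q (k n) \<theta>w"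
    by auto
  from k(2) obtain \<theta>w where Q: "\<And>n. Q (k n) (\<theta>w n)" by metis
  define z where "z n q = (case q of None \<Rightarrow> fst (\<theta>w n) | Some u \<Rightarrow> snd (\<theta>w n) u)" for n q
  define R where "R q = (case q of None \<Rightarrow> 2 | Some u \<Rightarrow> cmod (a u) + \<rho>)" for q
  have "norm (z n q) \<le> R q" if "q \<in> insert None (Some ` X)" for n q
  proof (cases q)
    case None
    then show ?thesis using Q[of n] by (simp add: z_def R_def Q_def)
  next
    case (Some u)
    have "cmod (snd (\<theta>w n) u - a u) \<le> \<rho>" using Q[of n] that Some by (auto simp: Q_def)
    then show ?thesis using norm_triangle_sub[of "snd (\<theta>w n) u" "a u"] Some by (simp add: z_def R_def)
  qed
  from bounded_family_convergent_subsequence[of "insert None (Some ` X)" z R, OF _ this] finX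
  obtain r l where r: "strict_mono (r :: nat \<Rightarrow> nat)" and l: "\<And>q. q \<in> insert None (Some ` X) \<Longrightarrow> (\<lambda>n. z (r n) q) \<longlonglongrightarrow> l q"
    by auto
  define w where "w u = l (Some u)" for u
  have th: "(\<lambda>n. fst (\<theta>w (r n))) \<longlonglongrightarrow> l None" and w: "\<And>u. u \<in> X \<Longrightarrow> (\<lambda>n. snd (\<theta>w (r n)) u) \<longlonglongrightarrow> w u"
    using l[of None] l[of "Some _"] by (simp_all add: z_def w_def)
  have "cmod (l None) \<le> 2"
    by (rule Lim_bounded[where M = 0, OF tendsto_norm[OF th]]) (use Q in \<open>auto simp: Q_def\<close>)
  moreover have "cmod (w u - a u) \<le> \<rho>" if "u \<in> X" for u
    by (rule Lim_bounded[where M = 0, OF tendsto_norm[OF tendsto_diff[OF w[OF that] tendsto_const]]])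
       (use Q that in \<open>auto simp: Q_def\<close>)
  moreover have "\<exists>u\<in>X. cmod (w u - a u) = \<rho>"
  proof -
    \<comment> \<open>The product is 0 exactly when some coordinate attains the radius; this turns
      the existential boundary condition into an equation that passes to the limit.\<close>
    have "(\<lambda>n. \<Prod>u\<in>X. (cmod (snd (\<theta>w (r n)) u - a u) - \<rho>)) \<longlonglongrightarrow> (\<Prod>u\<in>X. (cmod (w u - a u) - \<rho>))"
      by (intro tendsto_prod tendsto_diff tendsto_norm tendsto_const w)
    moreover have "(\<Prod>u\<in>X. (cmod (snd (\<theta>w (r n)) u - a u) - \<rho>)) = 0" for n
      using Q[of "r n"] finX by (auto simp: Q_def)
    ultimately have "(\<Prod>u\<in>X. (cmod (w u - a u) - \<rho>)) = 0" by (simp add: LIMSEQ_const_iff)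
    then show ?thesis using finX by (auto simp: prod_zero_iff)
  qed
  moreover have "is_zero (hset (\<lambda>_. 0) (l None)) w"
  proof (rule is_zero_limit[OF _ w])
    show "is_zero (hset (p (k (r n))) (fst (\<theta>w (r n)))) (snd (\<theta>w (r n)))" for n
      using Q[of "r n"] by (simp add: Q_def)
    show "(\<lambda>n. (hset (p (k (r n))) (fst (\<theta>w (r n)))) q) \<longlonglongrightarrow> (hset (\<lambda>_. 0) (l None)) q" for q
      using LIMSEQ_subseq_LIMSEQ[OF p strict_mono_o[OF k(1) r], of q] by (intro tendsto_hset th) (simp add: o_def)
  qed
  ultimately show False using bd[of "l None" w] unfolding is_zero_unperturbed by blast
qed

text \<open>Off \<open>B\<close> all zeros are nonsingular and none lies on the boundary, so having
  two zeros is both an open and a closed condition on \<theta>; a disc minus a finite set is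
  connected.\<close>

lemma two_zeros_transfer_generic:
  assumes off: "\<And>\<theta> w. cmod \<theta> \<le> 2 \<Longrightarrow> in_polydisc X a \<rho> w \<Longrightarrow> is_zero (hset p \<theta>) w \<Longrightarrow>
      \<forall>u\<in>X. cmod (w u - a u) < \<rho>"
    and fin: "finite B"
    and ns: "\<And>\<theta> w. \<theta> \<notin> B \<Longrightarrow> is_zero (hset p \<theta>) w \<Longrightarrow> \<not> singular_at unks pert (comb (hset p \<theta>) w)"
    and \<theta>1: "cmod \<theta>1 < 2" "\<theta>1 \<notin> B" "two_zeros a \<rho> (hset p \<theta>1)" and \<theta>0: "cmod \<theta>0 < 2" "\<theta>0 \<notin> B"
  shows "two_zeros a \<rho> (hset p \<theta>0)"
proof -
  \<comment> \<open>Radius 2 leaves room around 0 and 1 for the nearby parameters that will replace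
    them.\<close>
  define S where "S = ball (0::complex) 2 - B"
  define T where "T = {\<theta> \<in> S. two_zeros a \<rho> (hset p \<theta>)}"
  have openS: "open S" unfolding S_def using fin by (intro open_Diff finite_imp_closed) auto
  have conS: "connected S" unfolding S_def using fin by (intro connected_open_delete_finite) auto
  have lim: "(\<lambda>n. (hset p (s n)) q) \<longlonglongrightarrow> (hset p \<theta>) q" if "s \<longlonglongrightarrow> \<theta>" for s \<theta> q
    using that by (intro tendsto_hset) auto
  have "open T"
  proof (rule sequentially_imp_open)
    fix \<theta> s assume \<theta>: "\<theta> \<in> T" and s: "s \<longlonglongrightarrow> \<theta>"
    then obtain w w' where w: "in_polydisc X a \<rho> w" "in_polydisc X a \<rho> w'"
      "is_zero (hset p \<theta>) w" "is_zero (hset p \<theta>) w'" "\<exists>u\<in>X. w u \<noteq> w' u"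
      unfolding T_def two_zeros_def by blast
    have th: "cmod \<theta> \<le> 2" "\<theta> \<notin> B" using \<theta> by (auto simp: T_def S_def)
    have "\<forall>\<^sub>F n in sequentially. two_zeros a \<rho> (hset p (s n))"
      by (rule two_zeros_persist[OF lim[OF s] _ w(3) ns[OF th(2) w(3)] _ w(4) ns[OF th(2) w(4)] w(5)])
         (use off[OF th(1) w(1,3)] off[OF th(1) w(2,4)] in auto)
    moreover have "\<forall>\<^sub>F n in sequentially. s n \<in> S"
      using topological_tendstoD[OF s openS] \<theta> by (simp add: T_def)
    ultimately show "\<forall>\<^sub>F n in sequentially. s n \<in> T" by eventually_elim (simp add: T_def)
  qed
  moreover have "open (S - T)"
  proof (rule sequentially_imp_open)
    fix \<theta> s assume \<theta>: "\<theta> \<in> S - T" and s: "s \<longlonglongrightarrow> \<theta>"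
    have "\<forall>\<^sub>F n in sequentially. \<not> two_zeros a \<rho> (hset p (s n))"
    proof (rule ccontr)
      assume "\<not> ?thesis"
      from not_eventually_sequentiallyD[OF this] obtain k where k: "strict_mono (k :: nat \<Rightarrow> nat)"
        "\<And>n. two_zeros a \<rho> (hset p (s (k n)))" by auto
      have "(\<lambda>n. s (k n)) \<longlonglongrightarrow> \<theta>" using LIMSEQ_subseq_LIMSEQ[OF s k(1)] by (simp add: o_def)
      from two_zeros_limit[OF lim[OF this] k(2)] show False
        using \<theta> ns by (auto simp: T_def S_def)
    qed
    moreover have "\<forall>\<^sub>F n in sequentially. s n \<in> S"
      using topological_tendstoD[OF s openS] \<theta> by simp
    ultimately show "\<forall>\<^sub>F n in sequentially. s n \<in> S - T" by eventually_elim (simp add: T_def)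
  qed
  ultimately have "T \<inter> S = {} \<or> (S - T) \<inter> S = {}"
    by (intro connectedD[OF conS]) auto
  moreover have "\<theta>1 \<in> T \<inter> S" using \<theta>1 by (auto simp: T_def S_def)
  ultimately have "S \<subseteq> T" by auto
  moreover have "\<theta>0 \<in> S" using \<theta>0 by (auto simp: S_def)
  ultimately show ?thesis by (auto simp: T_def)
qed

text \<open>The endpoints 0 and 1 may be exceptional for a perturbed family, so parameters \<tau>
  tending to them take their place. The pair persists from \<open>P1\<close> into the perturbed
  family, is carried across, and cannot merge when the perturbation tends to 0, because
  \<open>P0\<close> has only nonsingular zeros in the polydisc.\<close>

theorem two_zeros_transfer:
  assumes bd: "\<And>\<theta> w. cmod \<theta> \<le> 2 \<Longrightarrow> in_polydisc X a \<rho> w \<Longrightarrow> \<exists>u\<in>X. cmod (w u - a u) = \<rho> \<Longrightarrow>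
      \<exists>i\<in>X. (1 - \<theta>) * P0 i w + \<theta> * P1 i w \<noteq> 0"
    and w1: "in_polydisc X a \<rho> w1" "\<forall>i\<in>X. P1 i w1 = 0" "\<not> singular_at X P1 w1"
    and w2: "in_polydisc X a \<rho> w2" "\<forall>i\<in>X. P1 i w2 = 0" "\<not> singular_at X P1 w2"
    and ne: "\<exists>u\<in>X. w1 u \<noteq> w2 u"
    and nd: "\<And>w. in_polydisc X a \<rho> w \<Longrightarrow> \<forall>i\<in>X. P0 i w = 0 \<Longrightarrow> \<not> singular_at X P0 w"
  shows "two_zeros_in X a \<rho> P0"
proof -
  obtain p :: "nat \<Rightarrow> 'v pvar \<Rightarrow> complex" where p: "\<And>q. (\<lambda>n. p n q) \<longlonglongrightarrow> 0"
    and finB: "\<And>n. finite {\<theta>. \<exists>w. is_zero (hset (p n) \<theta>) w \<and> singular_at unks pert (comb (hset (p n) \<theta>) w)}"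
    using generic_parameters by blast
  define B where "B n = {\<theta>. \<exists>w. is_zero (hset (p n) \<theta>) w \<and> singular_at unks pert (comb (hset (p n) \<theta>) w)}" for n
  have "\<exists>\<theta>. cmod (\<theta> - c) < inverse (real (Suc n)) \<and> \<theta> \<notin> B n" for n c
  proof -
    have "infinite (ball c (inverse (real (Suc n))))"
      by (rule uncountable_infinite) (simp add: uncountable_ball)
    then have "infinite (ball c (inverse (real (Suc n))) - B n)" using finB by (simp add: B_def)
    then obtain \<theta> where "\<theta> \<in> ball c (inverse (real (Suc n))) - B n" by (metis finite.emptyI ex_in_conv)
    then show ?thesis by (auto simp: dist_norm norm_minus_commute)
  qed
  then have "\<exists>\<tau>. \<forall>n c. cmod (\<tau> n c - c) < inverse (real (Suc n)) \<and> \<tau> n c \<notin> B n"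
    by (intro choice allI)
  then obtain \<tau> where \<tau>: "\<And>n c. cmod (\<tau> n c - c) < inverse (real (Suc n))" "\<And>n c. \<tau> n c \<notin> B n" by blast
  have \<tau>lim: "(\<lambda>n. \<tau> n c) \<longlonglongrightarrow> c" for c
  proof -
    have "(\<lambda>n. \<tau> n c - c) \<longlonglongrightarrow> 0"
      by (rule Lim_null_comparison[OF _ LIMSEQ_inverse_real_of_nat])
         (use \<tau>(1) in \<open>auto intro!: always_eventually less_imp_le\<close>)
    then show ?thesis by (simp add: LIM_zero_iff)
  qed
  have plim: "(\<lambda>n. (hset (p n) (\<tau> n c)) q) \<longlonglongrightarrow> (hset (\<lambda>_. 0) c) q" for c q
    by (intro tendsto_hset p \<tau>lim)
  have strict: "\<forall>u\<in>X. cmod (w u - a u) < \<rho>" if "in_polydisc X a \<rho> w" "\<forall>i\<in>X. P1 i w = 0" for w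
    using bd[of 1 w] that by (force simp: less_le)
  have ev1: "\<forall>\<^sub>F n in sequentially. two_zeros a \<rho> (hset (p n) (\<tau> n 1))"
  proof (rule two_zeros_persist[OF plim _ _ _ _ _ _ ne])
    show "is_zero (hset (\<lambda>_. 0) 1) w1" "is_zero (hset (\<lambda>_. 0) 1) w2"
      using w1 w2 by (auto simp: is_zero_unperturbed)
    show "\<not> singular_at unks pert (comb (hset (\<lambda>_. 0) 1) w1)" "\<not> singular_at unks pert (comb (hset (\<lambda>_. 0) 1) w2)"
      using w1 w2 by (auto simp: singular_unperturbed)
  qed (use strict w1 w2 in auto)
  have ev2: "\<forall>\<^sub>F n in sequentially. cmod (\<tau> n c) < 2" if "cmod c < 2" for c
    using order_tendstoD(2)[OF tendsto_norm[OF \<tau>lim]] that by blast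
  have "\<forall>\<^sub>F n in sequentially. two_zeros a \<rho> (hset (p n) (\<tau> n 0))"
    using ev1 ev2[of 0, simplified] ev2[of 1, simplified] zeros_off_boundary[of a \<rho> p, OF bd p, simplified]
  proof eventually_elim
    case (elim n)
    show ?case
      by (rule two_zeros_transfer_generic[where B = "B n" and p = "p n" and ?\<theta>1.0 = "\<tau> n 1"])
         (use elim finB[of n] \<tau>(2) in \<open>auto simp: B_def\<close>)
  qed
  then obtain N where N: "\<And>n. n \<ge> N \<Longrightarrow> two_zeros a \<rho> (hset (p n) (\<tau> n 0))"
    by (auto simp: eventually_sequentially)
  have "two_zeros a \<rho> (hset (\<lambda>_. 0) 0) \<or> (\<exists>w. in_polydisc X a \<rho> w \<and>
      is_zero (hset (\<lambda>_. 0) 0) w \<and> singular_at unks pert (comb (hset (\<lambda>_. 0) 0) w))"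
    by (rule two_zeros_limit[of "\<lambda>n. hset (p (n + N)) (\<tau> (n + N) 0)"])
       (use LIMSEQ_ignore_initial_segment[OF plim] N in auto)
  then have "two_zeros a \<rho> (hset (\<lambda>_. 0) 0)"
    using nd by (auto simp: singular_unperturbed is_zero_unperturbed)
  then show ?thesis unfolding two_zeros_def is_zero_unperturbed by simp
qed

end

section \<open>Bifurcation of an isolated singular zero\<close>

text \<open>In a kernel direction \<open>v\<close> the value of \<open>F\<close> at
  \<open>a + e v\<close> is \<open>e s\<close> with \<open>s\<close> small, so a small linear
  correction turns that point into a second zero. A further small multiple of a fixed map then makes
  both zeros nonsingular.\<close>

lemma singular_zero_splits:
  fixes F :: "'v \<Rightarrow> ('v \<Rightarrow> complex) \<Rightarrow> complex"
  assumes fin: "finite X" and F: "\<And>i. i \<in> X \<Longrightarrow> F i \<in> poly_fun X"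
    and zero: "\<And>i. i \<in> X \<Longrightarrow> F i a = 0" and sing: "singular_at X F a" and "\<rho> > 0" "\<eta> > 0"
  shows "\<exists>P b. (\<forall>i\<in>X. P i \<in> poly_fun X) \<and>
    (\<forall>i\<in>X. \<forall>w. in_polydisc X a \<rho> w \<longrightarrow> cmod (P i w - F i w) < \<eta>) \<and>
    (\<forall>i\<in>X. P i a = 0) \<and> \<not> singular_at X P a \<and>
    in_polydisc X a \<rho> b \<and> (\<forall>i\<in>X. P i b = 0) \<and> \<not> singular_at X P b \<and> (\<exists>u\<in>X. a u \<noteq> b u)"
proof -
  obtain x j where x: "j \<in> X" "x j \<noteq> 0" "\<And>i. i \<in> X \<Longrightarrow> (\<Sum>k\<in>X. pd k (F i) a * x k) = 0"
    using sing unfolding singular_at_def by blast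
  define v where "v u = x u / x j" for u
  have vj: "v j = 1" using x(2) by (simp add: v_def)
  have ker: "(\<Sum>k\<in>X. pd k (F i) a * v k) = 0" if "i \<in> X" for i
    using x(3)[OF that] by (simp add: v_def sum_divide_distrib[symmetric])
  define M where "M = 1 + (\<Sum>u\<in>X. cmod (v u))"
  have M: "cmod (v u) \<le> M" if "u \<in> X" for u
    using member_le_sum[of u X "\<lambda>u. cmod (v u)"] that fin by (simp add: M_def)
  have "M \<ge> 1" by (simp add: M_def sum_nonneg)
  define y where "y t u = a u + complex_of_real t * v u" for t u
  define r where "r t i = F i (y t) / complex_of_real t" for t i
  have ev1: "\<forall>\<^sub>F t in at_right 0. \<forall>i\<in>X. cmod (r t i) < \<eta> / (2 * \<rho>)"
  proof (rule eventually_ball_finite[OF fin], rule ballI)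
    fix i assume i: "i \<in> X"
    have "((\<lambda>t. (F i (y t) - F i a) / complex_of_real t) \<longlongrightarrow> (\<Sum>u\<in>X. pd u (F i) a * v u)) (at_right 0)"
    proof (rule poly_fun_difference_quotient[OF fin F[OF i]])
      show "((\<lambda>t. y t u) \<longlongrightarrow> a u) (at_right 0)" for u
      proof -
        have "((\<lambda>t. y t u) \<longlongrightarrow> a u + complex_of_real 0 * v u) (at_right 0)"
          unfolding y_def by (intro tendsto_intros)
        then show ?thesis by simp
      qed
      show "((\<lambda>t. (y t u - a u) / complex_of_real t) \<longlongrightarrow> v u) (at_right 0)" for u
        by (rule Lim_transform_eventually[OF tendsto_const])
           (auto simp: y_def eventually_at_right_less eventually_at_filter)
    qed simp
    then have "((\<lambda>t. r t i) \<longlongrightarrow> 0) (at_right 0)" using ker[OF i] zero[OF i] by (simp add: r_def)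
    from tendsto_norm[OF this] have "((\<lambda>t. cmod (r t i)) \<longlongrightarrow> 0) (at_right 0)" by simp
    then show "\<forall>\<^sub>F t in at_right 0. cmod (r t i) < \<eta> / (2 * \<rho>)"
      by (rule order_tendstoD) (use \<open>\<rho> > 0\<close> \<open>\<eta> > 0\<close> in simp)
  qed
  have ev2: "\<forall>\<^sub>F t in at_right 0. t \<in> {0<..<\<rho> / M}"
    using \<open>\<rho> > 0\<close> \<open>M \<ge> 1\<close> by (intro eventually_at_right_real) simp
  obtain \<epsilon> where \<epsilon>: "\<forall>i\<in>X. cmod (r \<epsilon> i) < \<eta> / (2 * \<rho>)" "\<epsilon> > 0" "\<epsilon> < \<rho> / M"
    using eventually_happens'[OF _ eventually_conj[OF ev1 ev2]] by auto
  define e where "e = complex_of_real \<epsilon>"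
  have e: "e \<noteq> 0" "cmod e = \<epsilon>" using \<epsilon>(2) by (auto simp: e_def)
  define b where "b = y \<epsilon>"
  have b: "b u = a u + e * v u" for u by (simp add: b_def y_def e_def)
  define s where "s = r \<epsilon>"
  have s: "F i b = e * s i" for i using e(1) by (simp add: s_def r_def b_def e_def)
  \<comment> \<open>The linear term moves a second zero to \<open>b\<close>; the factor of \<open>m\<close> vanishes at both zeros and has
    invertible derivative there, so all but finitely many \<open>m\<close> make both zeros nonsingular.\<close>
  define P where "P m i w = F i w - (w j - a j) * s i
     + m * ((w i - a i) + ((w j - a j) * (w j - a j) / e - 2 * (w j - a j)) * v i)" for m i w
  have poly: "P m i \<in> poly_fun X" if "i \<in> X" for m i
  proof -
    have "(\<lambda>w. F i w - (w j - a j) * s i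
     + m * ((w i - a i) + ((w j - a j) * (w j - a j) * inverse e - 2 * (w j - a j)) * v i)) \<in> poly_fun X"
      by (intro poly_fun_intros F that x(1))
    then show ?thesis by (simp add: P_def[abs_def] divide_inverse)
  qed
  have pdP: "pd k (P m i) w = pd k (F i) w - (if k = j then s i else 0)
     + m * ((if k = i then 1 else 0) + (2 * (w j - a j) / e - 2) * (if k = j then v i else 0))"
    if i: "i \<in> X" for m k i w
  proof -
    have dF: "((\<lambda>t. F i (w(k := t))) has_field_derivative pd k (F i) w) (at (w k))"
      unfolding pd_def using poly_fun_field_differentiable[OF F[OF i]]
      by (simp add: field_differentiable_derivI)
    have dh: "((\<lambda>t. (w(k := t)) u - a u) has_field_derivative (if k = u then 1 else 0)) (at (w k))" for u
      by (cases "k = u") (auto intro!: derivative_eq_intros)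
    have gen: "((\<lambda>t. f t - hj t * s i + m * (hi t + (hj t * hj t / e - 2 * hj t) * v i)) has_field_derivative
        df - dj * s i + m * (di + (2 * hj x * dj / e - 2 * dj) * v i)) (at x)"
      if "(f has_field_derivative df) (at x)" "(hj has_field_derivative dj) (at x)" "(hi has_field_derivative di) (at x)"
      for f hj hi df dj di x
      using e(1) by (auto intro!: derivative_eq_intros that simp: field_simps)
    have "((\<lambda>t. P m i (w(k := t))) has_field_derivative pd k (F i) w - (if k = j then 1 else 0) * s i
     + m * ((if k = i then 1 else 0) + (2 * ((w(k := w k)) j - a j) * (if k = j then 1 else 0) / e
        - 2 * (if k = j then 1 else 0)) * v i)) (at (w k))"
      unfolding P_def by (rule gen[OF dF dh dh])
    moreover have "pd k (F i) w - (if k = j then 1 else 0) * s i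
     + m * ((if k = i then 1 else 0) + (2 * ((w(k := w k)) j - a j) * (if k = j then 1 else 0) / e
        - 2 * (if k = j then 1 else 0)) * v i) = pd k (F i) w - (if k = j then s i else 0)
     + m * ((if k = i then 1 else 0) + (2 * (w j - a j) / e - 2) * (if k = j then v i else 0))"
      by (simp add: fun_upd_triv)
    ultimately have "((\<lambda>t. P m i (w(k := t))) has_field_derivative pd k (F i) w - (if k = j then s i else 0)
     + m * ((if k = i then 1 else 0) + (2 * (w j - a j) / e - 2) * (if k = j then v i else 0))) (at (w k))"
      by (rule DERIV_cong)
    then show ?thesis unfolding pd_def by (rule DERIV_imp_deriv)
  qed
  define S where "S w i k = pd k (F i) w - (if k = j then s i else 0)" for w i k
  \<comment> \<open>The derivative of the factor of \<open>m\<close>, as a rank one change of the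
    identity: \<open>c = -2\<close> at \<open>a\<close> and \<open>c = 0\<close> at
    \<open>b\<close>. Since \<open>v j = 1\<close>, the matrix for \<open>c = -2\<close> is an
    involution; the other one is the identity.\<close>
  define R where "R c i k = (if k = i then 1 else 0) + c * (if k = j then v i else 0)" for c :: complex and i k
  have Rsum: "(\<Sum>k\<in>X. R c i k * z k) = z i + c * v i * z j" if "i \<in> X" for c i z
  proof -
    have "(\<Sum>k\<in>X. R c i k * z k) = (\<Sum>k\<in>X. if k = i then z k else 0) + (\<Sum>k\<in>X. if k = j then c * v i * z k else 0)"
      unfolding R_def sum.distrib[symmetric] by (intro sum.cong) (auto simp: distrib_right)
    then show ?thesis using fin that x(1) by simp
  qed
  have fB: "finite {m. \<exists>z. (\<exists>u\<in>X. z u \<noteq> 0) \<and> (\<forall>i\<in>X. (\<Sum>k\<in>X. (S w i k + m * R c i k) * z k) = 0)}"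
    if c: "c = 0 \<or> c = -2" for w c
  proof (rule finite_singular_parameters[OF fin])
    fix z assume "\<forall>i\<in>X. (\<Sum>k\<in>X. R c i k * z k) = 0"
    then have *: "\<forall>i\<in>X. z i + c * v i * z j = 0" by (simp add: Rsum)
    have "z j = 0" using bspec[OF * x(1)] c vj by auto
    then show "\<forall>k\<in>X. z k = 0" using * by simp
  qed
  define B where "B w c = {m. \<exists>z. (\<exists>u\<in>X. z u \<noteq> 0) \<and> (\<forall>i\<in>X. (\<Sum>k\<in>X. (S w i k + m * R c i k) * z k) = 0)}" for w c
  \<comment> \<open>A bound for the factor of \<open>m\<close> on the polydisc. One half of \<eta>
    is spent on the \<open>m\<close> term, the other half on the linear correction.\<close>
  define L where "L = \<rho> + (\<rho> * \<rho> / \<epsilon> + 2 * \<rho>) * M"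
  have L: "L > 0" unfolding L_def using \<open>\<rho> > 0\<close> \<epsilon>(2) \<open>M \<ge> 1\<close> by (intro add_pos_nonneg mult_nonneg_nonneg) auto
  have "infinite (ball (0::complex) (\<eta> / (2 * L)))"
    using L \<open>\<eta> > 0\<close> by (intro uncountable_infinite) (simp add: uncountable_ball)
  then have "infinite (ball (0::complex) (\<eta> / (2 * L)) - (B a (-2) \<union> B b 0))"
    using fB[of "-2" a] fB[of 0 b] by (simp add: B_def)
  then obtain m where m: "m \<in> ball (0::complex) (\<eta> / (2 * L)) - (B a (-2) \<union> B b 0)"
    by (metis finite.emptyI ex_in_conv)
  have m1: "cmod m * L < \<eta> / 2" using m L by (simp add: field_simps)
  have close: "cmod (P m i w - F i w) < \<eta>" if i: "i \<in> X" and w: "in_polydisc X a \<rho> w" for i w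
  proof -
    define h where "h u = w u - a u" for u
    have h: "cmod (h u) \<le> \<rho>" if "u \<in> X" for u using w that by (simp add: h_def)
    have "P m i w - F i w = m * (h i + (h j * h j / e - 2 * h j) * v i) - h j * s i"
      by (simp add: P_def h_def)
    then have "cmod (P m i w - F i w) \<le> cmod (m * (h i + (h j * h j / e - 2 * h j) * v i)) + cmod (h j * s i)"
      using norm_triangle_ineq4 by metis
    also have "cmod (h j * s i) \<le> \<rho> * (\<eta> / (2 * \<rho>))"
      unfolding norm_mult using h[OF x(1)] \<epsilon>(1) i \<open>\<rho> > 0\<close> by (intro mult_mono) (auto simp: s_def intro: less_imp_le)
    also have "\<rho> * (\<eta> / (2 * \<rho>)) = \<eta> / 2" using \<open>\<rho> > 0\<close> by simp
    also have "cmod (m * (h i + (h j * h j / e - 2 * h j) * v i)) \<le> cmod m * L"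
      unfolding norm_mult
    proof (intro mult_left_mono norm_ge_zero)
      have "cmod (h i + (h j * h j / e - 2 * h j) * v i) \<le> cmod (h i) + cmod (h j * h j / e - 2 * h j) * cmod (v i)"
        by (metis norm_mult norm_triangle_ineq)
      also have "cmod (h j * h j / e - 2 * h j) \<le> cmod (h j) * cmod (h j) / \<epsilon> + 2 * cmod (h j)"
        using norm_triangle_ineq4[of "h j * h j / e" "2 * h j"] by (simp add: norm_mult norm_divide e)
      also have "\<dots> \<le> \<rho> * \<rho> / \<epsilon> + 2 * \<rho>"
        using \<open>\<rho> > 0\<close> h[OF x(1)] \<epsilon>(2) by (intro add_mono divide_right_mono mult_mono) auto
      finally have 1: "cmod (h i + (h j * h j / e - 2 * h j) * v i) \<le> cmod (h i) + (\<rho> * \<rho> / \<epsilon> + 2 * \<rho>) * cmod (v i)"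
        by (simp add: mult_right_mono)
      have "(\<rho> * \<rho> / \<epsilon> + 2 * \<rho>) * cmod (v i) \<le> (\<rho> * \<rho> / \<epsilon> + 2 * \<rho>) * M"
        using M[OF i] \<open>\<rho> > 0\<close> \<epsilon>(2) by (intro mult_left_mono) auto
      then show "cmod (h i + (h j * h j / e - 2 * h j) * v i) \<le> L"
        using 1 h[OF i] unfolding L_def by linarith
    qed
    finally show ?thesis using m1 by simp
  qed
  have Pa: "P m i a = 0" if "i \<in> X" for i using zero[OF that] by (simp add: P_def)
  have Pb: "P m i b = 0" for i
    using e(1) by (simp add: P_def s b vj field_simps)
  have na: "\<not> singular_at X (P m) a"
  proof
    assume "singular_at X (P m) a"
    then have "m \<in> B a (-2)"
      unfolding singular_at_def B_def by (simp add: pdP S_def R_def)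
    then show False using m by blast
  qed
  have nb: "\<not> singular_at X (P m) b"
  proof
    assume "singular_at X (P m) b"
    moreover have "2 * (b j - a j) / e - 2 = 0" using e(1) by (simp add: b vj)
    ultimately have "m \<in> B b 0"
      unfolding singular_at_def B_def by (simp add: pdP S_def R_def)
    then show False using m by blast
  qed
  have Kb: "cmod (b u - a u) \<le> \<rho>" if "u \<in> X" for u
  proof -
    have "cmod (b u - a u) = \<epsilon> * cmod (v u)" by (simp add: b norm_mult e)
    also have "\<dots> \<le> \<epsilon> * M" using M[OF that] \<epsilon>(2) by simp
    also have "\<dots> \<le> \<rho>" using \<epsilon>(3) \<open>M \<ge> 1\<close> by (simp add: field_simps)
    finally show ?thesis .
  qed
  have "a j \<noteq> b j" using e(1) by (simp add: b vj)
  then show ?thesis using poly close Pa Pb na nb Kb x(1)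
    by (intro exI[of _ "P m"] exI[of _ b]) auto
qed

lemma boundary_lower_bound:
  fixes F :: "'v \<Rightarrow> ('v \<Rightarrow> complex) \<Rightarrow> complex"
  assumes fin: "finite X" and F: "\<And>i. i \<in> X \<Longrightarrow> F i \<in> poly_fun X"
    and nz: "\<And>w. in_polydisc X a \<rho> w \<Longrightarrow> \<exists>u\<in>X. cmod (w u - a u) = \<rho> \<Longrightarrow> \<exists>i\<in>X. F i w \<noteq> 0"
  shows "\<exists>m>0. \<forall>w. in_polydisc X a \<rho> w \<longrightarrow> (\<exists>u\<in>X. cmod (w u - a u) = \<rho>) \<longrightarrow> (\<exists>i\<in>X. cmod (F i w) \<ge> m)"
proof (rule ccontr)
  define Q where "Q n w \<longleftrightarrow> in_polydisc X a \<rho> w \<and> (\<exists>u\<in>X. cmod (w u - a u) = \<rho>) \<and>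
    (\<forall>i\<in>X. cmod (F i w) < inverse (real (Suc n)))" for n w
  assume neg: "\<not> ?thesis"
  have "\<exists>w. Q n w" for n
  proof -
    have "inverse (real (Suc n)) > 0" by simp
    then show ?thesis using neg unfolding Q_def by (meson not_le)
  qed
  then obtain w where Q: "\<And>n. Q n (w n)" by metis
  have "norm (w n u) \<le> cmod (a u) + \<rho>" if "u \<in> X" for n u
  proof -
    have "cmod (w n u - a u) \<le> \<rho>" using Q[of n] that by (auto simp: Q_def)
    then show ?thesis using norm_triangle_sub[of "w n u" "a u"] by linarith
  qed
  from bounded_family_convergent_subsequence[of X w "\<lambda>u. cmod (a u) + \<rho>", OF fin this]
  obtain r l where r: "strict_mono (r :: nat \<Rightarrow> nat)" and l: "\<And>u. u \<in> X \<Longrightarrow> (\<lambda>n. w (r n) u) \<longlonglongrightarrow> l u" by blast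
  have "cmod (l u - a u) \<le> \<rho>" if "u \<in> X" for u
    by (rule Lim_bounded[where M = 0, OF tendsto_norm[OF tendsto_diff[OF l[OF that] tendsto_const]]])
       (use Q that in \<open>auto simp: Q_def\<close>)
  moreover have "\<exists>u\<in>X. cmod (l u - a u) = \<rho>"
  proof -
    have "(\<lambda>n. \<Prod>u\<in>X. (cmod (w (r n) u - a u) - \<rho>)) \<longlonglongrightarrow> (\<Prod>u\<in>X. (cmod (l u - a u) - \<rho>))"
      by (intro tendsto_prod tendsto_diff tendsto_norm tendsto_const l)
    moreover have "(\<Prod>u\<in>X. (cmod (w (r n) u - a u) - \<rho>)) = 0" for n
      using Q[of "r n"] fin by (auto simp: Q_def)
    ultimately have "(\<Prod>u\<in>X. (cmod (l u - a u) - \<rho>)) = 0" by (simp add: LIMSEQ_const_iff)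
    then show ?thesis using fin by (auto simp: prod_zero_iff)
  qed
  moreover have "F i l = 0" if i: "i \<in> X" for i
  proof -
    have "(\<lambda>n. F i (w (r n))) \<longlonglongrightarrow> F i l" by (rule tendsto_poly_fun[OF F[OF i] l])
    moreover have "(\<lambda>n. F i (w (r n))) \<longlonglongrightarrow> 0"
    proof (rule Lim_null_comparison)
      show "(\<lambda>n. inverse (real (Suc (r n)))) \<longlonglongrightarrow> 0"
        using LIMSEQ_subseq_LIMSEQ[OF LIMSEQ_inverse_real_of_nat r] by (simp add: o_def)
      show "\<forall>\<^sub>F n in sequentially. norm (F i (w (r n))) \<le> inverse (real (Suc (r n)))"
        using Q i unfolding Q_def by (intro always_eventually allI less_imp_le) blast
    qed
    ultimately show ?thesis by (rule LIMSEQ_unique)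
  qed
  ultimately show False using nz[of l] by blast
qed

text \<open>The split system \<open>P\<close> has two nonsingular zeros, and the homotopy from
  \<open>P\<close> to a nearby \<open>G\<close> without singular zeros carries the pair over.
  Isolation of \<open>a\<close> bounds \<open>F\<close> away from 0 on the boundary, so no zero
  escapes on the way.\<close>

theorem isolated_singular_zero_bifurcates:
  fixes F :: "'v \<Rightarrow> ('v \<Rightarrow> complex) \<Rightarrow> complex"
  assumes fin: "finite X" and F: "\<And>i. i \<in> X \<Longrightarrow> F i \<in> poly_fun X"
    and zero: "\<And>i. i \<in> X \<Longrightarrow> F i a = 0" and sing: "singular_at X F a" and "\<rho> > 0"
    and iso: "\<And>w. in_polydisc X a \<rho> w \<Longrightarrow> \<forall>i\<in>X. F i w = 0 \<Longrightarrow> \<forall>u\<in>X. w u = a u"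
  shows "\<exists>m>0. \<forall>G. (\<forall>i\<in>X. G i \<in> poly_fun X) \<longrightarrow>
    (\<forall>i\<in>X. \<forall>w. in_polydisc X a \<rho> w \<longrightarrow> cmod (G i w - F i w) < m) \<longrightarrow>
    (\<forall>w. in_polydisc X a \<rho> w \<longrightarrow> (\<forall>i\<in>X. G i w = 0) \<longrightarrow> \<not> singular_at X G w) \<longrightarrow>
    two_zeros_in X a \<rho> G"
proof -
  have "\<exists>m>0. \<forall>w. in_polydisc X a \<rho> w \<longrightarrow> (\<exists>u\<in>X. cmod (w u - a u) = \<rho>) \<longrightarrow> (\<exists>i\<in>X. cmod (F i w) \<ge> m)"
  proof (rule boundary_lower_bound[OF fin F])
    fix w assume w: "in_polydisc X a \<rho> w" "\<exists>u\<in>X. cmod (w u - a u) = \<rho>"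
    show "\<exists>i\<in>X. F i w \<noteq> 0"
    proof (rule ccontr)
      assume "\<not> ?thesis"
      then have "\<forall>u\<in>X. w u = a u" using iso[OF w(1)] by blast
      then show False using w(2) \<open>\<rho> > 0\<close> by auto
    qed
  qed
  then obtain m where m: "m > 0" "\<And>w. in_polydisc X a \<rho> w \<Longrightarrow> \<exists>u\<in>X. cmod (w u - a u) = \<rho> \<Longrightarrow> \<exists>i\<in>X. cmod (F i w) \<ge> m"
    by blast
  \<comment> \<open>For \<open>cmod \<theta> \<le> 2\<close> the weights \<open>1 - \<theta>\<close>
    and \<open>\<theta>\<close> have modulus at most 3 and 2, so every member of the homotopy
    differs from \<open>F\<close> by at most five sixths of \<open>m\<close> and stays nonzero on
    the boundary.\<close>
  have "m / 6 > 0" using m(1) by simp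
  from singular_zero_splits[OF fin F zero sing \<open>\<rho> > 0\<close> this] obtain P b where
    P: "\<forall>i\<in>X. P i \<in> poly_fun X"
    and close: "\<forall>i\<in>X. \<forall>w. in_polydisc X a \<rho> w \<longrightarrow> cmod (P i w - F i w) < m / 6"
    and a: "\<forall>i\<in>X. P i a = 0" "\<not> singular_at X P a"
    and b: "in_polydisc X a \<rho> b" "\<forall>i\<in>X. P i b = 0" "\<not> singular_at X P b" "\<exists>u\<in>X. a u \<noteq> b u"
    by auto
  show ?thesis
  proof (intro exI[of _ "m / 6"] conjI allI impI)
    show "m / 6 > 0" by fact
    fix G assume G: "\<forall>i\<in>X. G i \<in> poly_fun X"
      and Gclose: "\<forall>i\<in>X. \<forall>w. in_polydisc X a \<rho> w \<longrightarrow> cmod (G i w - F i w) < m / 6"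
      and Gns: "\<forall>w. in_polydisc X a \<rho> w \<longrightarrow> (\<forall>i\<in>X. G i w = 0) \<longrightarrow> \<not> singular_at X G w"
    \<comment> \<open>The system under study sits at \<theta> = 0 and the split one at \<theta> = 1,
      so the pair travels from 1 to 0.\<close>
    interpret poly_homotopy X G P
      by unfold_locales (use fin G P in auto)
    show "two_zeros_in X a \<rho> G"
    proof (rule two_zeros_transfer[where ?w1.0 = a and ?w2.0 = b])
      fix \<theta> :: complex and w assume \<theta>: "cmod \<theta> \<le> 2"
        and w: "in_polydisc X a \<rho> w" "\<exists>u\<in>X. cmod (w u - a u) = \<rho>"
      obtain i where i: "i \<in> X" "cmod (F i w) \<ge> m" using m(2)[OF w] by blast
      have "cmod (1 - \<theta>) \<le> 3" using norm_triangle_ineq4[of 1 \<theta>] \<theta> by simp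
      then have "cmod ((1 - \<theta>) * (G i w - F i w)) \<le> 3 * (m / 6)"
        unfolding norm_mult using Gclose w(1) i(1) by (intro mult_mono) (auto intro: less_imp_le)
      moreover have "cmod (\<theta> * (P i w - F i w)) \<le> 2 * (m / 6)"
        unfolding norm_mult using close w(1) i(1) \<theta> by (intro mult_mono) (auto intro: less_imp_le)
      ultimately have "cmod ((1 - \<theta>) * (G i w - F i w) + \<theta> * (P i w - F i w)) < m"
        using norm_triangle_ineq[of "(1 - \<theta>) * (G i w - F i w)" "\<theta> * (P i w - F i w)"] m(1) by linarith
      moreover have "(1 - \<theta>) * (G i w - F i w) + \<theta> * (P i w - F i w) = (1 - \<theta>) * G i w + \<theta> * P i w - F i w"
        by (simp add: algebra_simps)
      ultimately have "(1 - \<theta>) * G i w + \<theta> * P i w \<noteq> 0" using i(2) by auto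
      then show "\<exists>i\<in>X. (1 - \<theta>) * G i w + \<theta> * P i w \<noteq> 0" using i(1) by blast
    qed (use a b Gns \<open>\<rho> > 0\<close> in auto)
  qed
qed

section \<open>The Lagrangian of a tensegrity framework\<close>

lemma mem_zclosure: "S \<subseteq> zclosure W S"
  by (auto simp: zclosure_def)

locale tensegrity =
  fixes n d :: nat and B C :: "(nat \<times> nat) set" and Y :: "coord set" and Om :: "(coord \<Rightarrow> complex) set"
  assumes edges: "B \<union> C \<subseteq> {(i, j). 1 \<le> i \<and> i < j \<and> j \<le> n}"
    and ctrl: "Y \<subseteq> tvars n d B C"
    and Om: "Om \<subseteq> aspace Y"
begin

abbreviation "E \<equiv> B \<union> C"
abbreviation "W \<equiv> all_vars n d B C"
abbreviation "XD \<equiv> xd_vars n d B C Y"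
abbreviation "X \<equiv> XD \<union> Lam ` E"
abbreviation "L \<equiv> Lag d B C"
abbreviation "g \<equiv> gfun d B"
abbreviation "LCs \<equiv> LC n d B C Y Om"

lemma finE: "finite E"
proof (rule finite_subset[OF edges])
  have "{(i, j). 1 \<le> i \<and> i < j \<and> j \<le> n} \<subseteq> {1..n} \<times> {1..n}" by auto
  then show "finite {(i, j). 1 \<le> i \<and> i < j \<and> j \<le> n}" by (rule finite_subset) auto
qed

lemma fin_tvars: "finite (tvars n d B C)"
proof -
  have "{Pc i k | i k. i \<in> {1..n} \<and> k \<in> {1..d}} = case_prod Pc ` ({1..n} \<times> {1..d})" by auto
  then show ?thesis using finE by (simp add: tvars_def)
qed

lemma finW: "finite W" and finXD: "finite XD" and finX: "finite X"
  using fin_tvars finE by (auto simp: all_vars_def xd_vars_def)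

lemma W_eq: "W = X \<union> Y" and X_Y: "X \<inter> Y = {}" and XD_Lam: "XD \<inter> Lam ` E = {}"
  using ctrl by (auto simp: all_vars_def xd_vars_def tvars_def)

lemma xd_neq_Lam: "u \<in> XD \<Longrightarrow> u \<noteq> Lam e"
  by (auto simp: xd_vars_def tvars_def)

lemma XW: "X \<subseteq> W" and YW: "Y \<subseteq> W"
  using W_eq by auto

text \<open>The smaller set of variables records that constraints do not involve multipliers; it
  preserves their values and derivatives when only multipliers move.\<close>

lemma poly_g: "e \<in> E \<Longrightarrow> g e \<in> poly_fun (W - Lam ` E)"
proof -
  assume e: "e \<in> E"
  then have ij: "fst e \<in> {1..n}" "snd e \<in> {1..n}" using edges by (cases e; fastforce)+
  have k: "Pc (fst e) k \<in> W - Lam ` E" "Pc (snd e) k \<in> W - Lam ` E" if "k \<in> {1..d}" for k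
    using that ij by (auto simp: all_vars_def tvars_def)
  have s: "(\<lambda>z. \<Sum>k\<in>{1..d}. (z (Pc (fst e) k) - z (Pc (snd e) k))\<^sup>2) \<in> poly_fun (W - Lam ` E)"
    using k by (intro poly_fun_intros) auto
  show ?thesis
  proof (cases "e \<in> B")
    case True
    then have "(\<lambda>z. (z (Ell e))\<^sup>2) \<in> poly_fun (W - Lam ` E)"
      by (intro poly_fun_intros) (auto simp: all_vars_def tvars_def)
    from poly_fun_diff[OF this s] show ?thesis using True by (simp add: gfun_def[abs_def])
  next
    case False
    then have "(\<lambda>z. (z (Dlt e))\<^sup>2) \<in> poly_fun (W - Lam ` E)"
      using e by (intro poly_fun_intros) (auto simp: all_vars_def tvars_def)
    from poly_fun_diff[OF this s] show ?thesis using False by (simp add: gfun_def[abs_def])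
  qed
qed

lemma poly_Q: "Qt C \<in> poly_fun (W - Lam ` E)"
proof -
  have "(\<lambda>z. \<Sum>e\<in>C. 1/2 * z (Elast e) * (z (Dlt e) - z (Rest e))\<^sup>2) \<in> poly_fun (W - Lam ` E)"
    by (intro poly_fun_intros) (auto simp: all_vars_def tvars_def)
  then show ?thesis by (simp add: Qt_def[abs_def])
qed

lemma poly_gW: "e \<in> E \<Longrightarrow> g e \<in> poly_fun W"
  by (rule poly_fun_mono[OF poly_g]) auto

lemma poly_QW: "Qt C \<in> poly_fun W"
  by (rule poly_fun_mono[OF poly_Q]) auto

lemma poly_Lam: "e \<in> E \<Longrightarrow> (\<lambda>z. z (Lam e)) \<in> poly_fun W"
  by (intro pvar) (auto simp: all_vars_def)

lemma poly_L: "L \<in> poly_fun W"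
proof -
  have "(\<lambda>z. Qt C z + (\<Sum>e\<in>E. z (Lam e) * g e z)) \<in> poly_fun W"
    by (intro poly_fun_intros poly_QW poly_gW poly_Lam poly_fun_sum) auto
  then show ?thesis by (simp add: Lag_def[abs_def])
qed

lemma pd_L: "pd u L z = pd u (Qt C) z + (\<Sum>e\<in>E. z (Lam e) * pd u (g e) z + (if u = Lam e then 1 else 0) * g e z)"
proof -
  have 1: "(\<lambda>z. z (Lam e) * g e z) \<in> poly_fun W" if "e \<in> E" for e
    by (intro pmult poly_Lam poly_gW that)
  have 2: "(\<lambda>z. \<Sum>e\<in>E. z (Lam e) * g e z) \<in> poly_fun W" by (rule poly_fun_sum[OF 1])
  have "pd u L z = pd u (Qt C) z + pd u (\<lambda>z. \<Sum>e\<in>E. z (Lam e) * g e z) z"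
    using pd_add[OF poly_QW 2, of u z] by (simp add: Lag_def[abs_def])
  also have "pd u (\<lambda>z. \<Sum>e\<in>E. z (Lam e) * g e z) z = (\<Sum>e\<in>E. pd u (\<lambda>z. z (Lam e) * g e z) z)"
    by (rule pd_sum[OF 1])
  also have "\<dots> = (\<Sum>e\<in>E. z (Lam e) * pd u (g e) z + (if u = Lam e then 1 else 0) * g e z)"
    by (intro sum.cong refl) (simp add: pd_mult[OF poly_Lam poly_gW] pd_var)
  finally show ?thesis .
qed

lemma pd_L_Lam: "e \<in> E \<Longrightarrow> pd (Lam e) L = g e"
proof
  fix z assume e: "e \<in> E"
  have "pd (Lam e) L z = (\<Sum>e'\<in>E. if e' = e then g e z else 0)"
    unfolding pd_L using e pd_notin[OF poly_Q, of "Lam e" z] pd_notin[OF poly_g, of _ "Lam e" z]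
    by (simp, intro sum.cong) auto
  then show "pd (Lam e) L z = g e z" using e finE by simp
qed

lemma pd_L_xd: "u \<in> XD \<Longrightarrow> pd u L = (\<lambda>z. pd u (Qt C) z + (\<Sum>e\<in>E. z (Lam e) * pd u (g e) z))"
  by (auto simp: fun_eq_iff pd_L xd_neq_Lam intro!: sum.cong)

lemma pd2_L_xd:
  assumes "u \<in> XD"
  shows "pd w (pd u L) z = pd w (pd u (Qt C)) z +
    (\<Sum>e\<in>E. z (Lam e) * pd w (pd u (g e)) z + (if w = Lam e then 1 else 0) * pd u (g e) z)"
proof -
  have q: "pd u (Qt C) \<in> poly_fun W" by (rule poly_fun_pd[OF poly_QW])
  have gp: "pd u (g e) \<in> poly_fun W" if "e \<in> E" for e by (rule poly_fun_pd[OF poly_gW[OF that]])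
  have 1: "(\<lambda>z. z (Lam e) * pd u (g e) z) \<in> poly_fun W" if "e \<in> E" for e
    by (intro pmult poly_Lam gp that)
  have 2: "(\<lambda>z. \<Sum>e\<in>E. z (Lam e) * pd u (g e) z) \<in> poly_fun W" by (rule poly_fun_sum[OF 1])
  have "pd w (pd u L) z = pd w (pd u (Qt C)) z + pd w (\<lambda>z. \<Sum>e\<in>E. z (Lam e) * pd u (g e) z) z"
    unfolding pd_L_xd[OF assms] by (rule pd_add[OF q 2])
  also have "pd w (\<lambda>z. \<Sum>e\<in>E. z (Lam e) * pd u (g e) z) z = (\<Sum>e\<in>E. pd w (\<lambda>z. z (Lam e) * pd u (g e) z) z)"
    by (rule pd_sum[OF 1])
  also have "\<dots> = (\<Sum>e\<in>E. z (Lam e) * pd w (pd u (g e)) z + (if w = Lam e then 1 else 0) * pd u (g e) z)"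
    by (intro sum.cong refl) (simp add: pd_mult[OF poly_Lam gp] pd_var)
  finally show ?thesis .
qed

text \<open>The multipliers are constants for these derivatives, so the Hessian of the definition is
  a block of the Hessian of \<open>L\<close>, from which it inherits symmetry and reality.\<close>

lemma hess_entry_eq:
  assumes "u \<in> XD" "w \<in> XD"
  shows "hess_entry d B C z u w = pd u (pd w L) z"
  unfolding pd2_L_xd[OF assms(2)] hess_entry_def using assms
  by (auto simp: xd_neq_Lam intro!: sum.cong)

lemma hess_entry_sym: "u \<in> XD \<Longrightarrow> w \<in> XD \<Longrightarrow> hess_entry d B C z u w = hess_entry d B C z w u"
  using pd_commute[OF poly_L] by (simp add: hess_entry_eq)

lemma pd_Lam_pd_L: "u \<in> XD \<Longrightarrow> e \<in> E \<Longrightarrow> pd (Lam e) (pd u L) z = pd u (g e) z"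
  using pd_commute[OF poly_L, of "Lam e" u z] by (simp add: pd_L_Lam)

lemma cnj_g: "g e (\<lambda>u. cnj (z u)) = cnj (g e z)"
  by (simp add: gfun_def)

lemma cnj_Q: "Qt C (\<lambda>u. cnj (z u)) = cnj (Qt C z)"
  by (simp add: Qt_def)

lemma cnj_L: "L (\<lambda>u. cnj (z u)) = cnj (L z)"
  by (simp add: Lag_def cnj_g cnj_Q)

lemma cnj_real_pt: "is_real_pt z \<longleftrightarrow> (\<lambda>u. cnj (z u)) = z"
  by (auto simp: is_real_pt_def fun_eq_iff complex_eq_iff)

lemma pd_g_real:
  assumes "is_real_pt z" "e \<in> E"
  shows "pd u (g e) z = complex_of_real (Re (pd u (g e) z))"
proof -
  have "cnj (pd u (g e) z) = pd u (g e) z"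
    using pd_cnj[OF poly_gW[OF assms(2)] cnj_g, of u z] assms(1) by (simp add: cnj_real_pt)
  then show ?thesis by (simp add: complex_eq_iff)
qed

lemma pd2_L_real:
  assumes "is_real_pt z"
  shows "pd u (pd w L) z = complex_of_real (Re (pd u (pd w L) z))"
proof -
  have "cnj (pd u (pd w L) z) = pd u (pd w L) z"
    using pd_cnj[OF poly_fun_pd[OF poly_L] pd_cnj[OF poly_L cnj_L], of w u z] assms(1) by (simp add: cnj_real_pt)
  then show ?thesis by (simp add: complex_eq_iff)
qed

lemma LC_iff: "z \<in> LCs \<longleftrightarrow> z \<in> aspace W \<and> proj Y z \<in> Om \<and> (\<forall>u\<in>X. pd u L z = 0)"
  by (simp add: LC_def)

section \<open>Local injectivity over the controls and its first consequence\<close>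

definition noncritical :: "(coord \<Rightarrow> complex) \<Rightarrow> bool" where
  "noncritical z \<longleftrightarrow> z \<in> LCs \<and> (\<forall>v\<in>tangent_space W LCs z. proj Y v = (\<lambda>_. 0) \<longrightarrow> v = (\<lambda>_. 0))"

lemma noncritical_off_discriminant:
  assumes "z \<in> LCs" "proj Y z \<notin> cat_disc n d B C Y Om"
  shows "noncritical z"
  using assms mem_zclosure[of "crit_values n d B C Y Om" Y]
  unfolding cat_disc_def noncritical_def crit_values_def by blast

text \<open>Every polynomial vanishing on \<open>LC\<close>, not only its defining equations, takes
  equal values along both sequences. The limit direction is therefore tangent in the sense of the
  full vanishing ideal, the one that enters the discriminant.\<close>

lemma proj_locally_injective:
  assumes "noncritical z"
  shows "\<exists>\<rho>>0. \<forall>a\<in>LCs. \<forall>b\<in>LCs. in_polydisc W z \<rho> a \<longrightarrow> in_polydisc W z \<rho> b \<longrightarrow>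
    proj Y a = proj Y b \<longrightarrow> a = b"
proof (rule ccontr)
  define Q where "Q k ab \<longleftrightarrow> fst ab \<in> LCs \<and> snd ab \<in> LCs \<and> (\<forall>u\<in>W. cmod (fst ab u - z u) \<le> inverse (real (Suc k))) \<and>
    (\<forall>u\<in>W. cmod (snd ab u - z u) \<le> inverse (real (Suc k))) \<and> proj Y (fst ab) = proj Y (snd ab) \<and> fst ab \<noteq> snd ab" for k ab
  assume neg: "\<not> ?thesis"
  have "\<exists>ab. Q k ab" for k
  proof -
    have "inverse (real (Suc k)) > 0" by simp
    then obtain a b where "a \<in> LCs" "b \<in> LCs" "\<forall>u\<in>W. cmod (a u - z u) \<le> inverse (real (Suc k))"
      "\<forall>u\<in>W. cmod (b u - z u) \<le> inverse (real (Suc k))" "proj Y a = proj Y b" "a \<noteq> b"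
      using neg by blast
    then have "Q k (a, b)" by (simp add: Q_def)
    then show ?thesis ..
  qed
  then obtain ab where Q: "\<And>k. Q k (ab k)" by metis
  have lim: "(\<lambda>k. fst (ab k) u) \<longlonglongrightarrow> z u" "(\<lambda>k. snd (ab k) u) \<longlonglongrightarrow> z u" if "u \<in> W" for u
  proof -
    have "(\<lambda>k. fst (ab k) u - z u) \<longlonglongrightarrow> 0" "(\<lambda>k. snd (ab k) u - z u) \<longlonglongrightarrow> 0"
      by (rule Lim_null_comparison[OF _ LIMSEQ_inverse_real_of_nat];
          use Q that in \<open>auto simp: Q_def intro!: always_eventually\<close>)+
    then show "(\<lambda>k. fst (ab k) u) \<longlonglongrightarrow> z u" "(\<lambda>k. snd (ab k) u) \<longlonglongrightarrow> z u" by (simp_all add: LIM_zero_iff)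
  qed
  have "\<exists>u\<in>W. fst (ab k) u \<noteq> snd (ab k) u" for k
  proof (rule ccontr)
    assume "\<not> ?thesis"
    then have "fst (ab k) = snd (ab k)"
      using Q[of k] by (auto simp: Q_def LC_iff aspace_def fun_eq_iff)
    then show False using Q[of k] by (simp add: Q_def)
  qed
  from coalescing_sequences_tangent[of W "\<lambda>k. fst (ab k)" z "\<lambda>k. snd (ab k)", OF finW lim this] obtain v0 where
    v0: "\<exists>u\<in>W. v0 u \<noteq> 0" "\<And>f. f \<in> poly_fun W \<Longrightarrow> (\<forall>k. f (fst (ab k)) = f (snd (ab k))) \<Longrightarrow> (\<Sum>u\<in>W. pd u f z * v0 u) = 0"
    by blast
  define v where "v u = (if u \<in> W then v0 u else 0)" for u
  have "(\<Sum>u\<in>W. pd u f z * v u) = 0" if "f \<in> vanishing_ideal W LCs" for f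
  proof -
    have "(\<Sum>u\<in>W. pd u f z * v0 u) = 0"
      using that Q by (intro v0(2)) (auto simp: vanishing_ideal_def Q_def)
    then show ?thesis by (simp add: v_def)
  qed
  then have "v \<in> tangent_space W LCs z" by (auto simp: tangent_space_def aspace_def v_def)
  moreover have "v u = 0" if u: "u \<in> Y" for u
  proof -
    have uW: "u \<in> W" using u YW by blast
    have "fst (ab k) u = snd (ab k) u" for k
    proof -
      have "proj Y (fst (ab k)) u = proj Y (snd (ab k)) u" using Q[of k] by (simp add: Q_def)
      then show ?thesis using u by (simp add: proj_def)
    qed
    then have "(\<Sum>w\<in>W. pd w (\<lambda>z. z u) z * v0 w) = 0" by (intro v0(2) pvar uW) simp
    then show ?thesis using uW finW
      by (simp add: v_def pd_var if_distrib[of "\<lambda>x. x * _"] cong: if_cong)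
  qed
  then have "proj Y v = (\<lambda>_. 0)" by (auto simp: proj_def)
  ultimately have "v = (\<lambda>_. 0)" using assms by (simp add: noncritical_def)
  then show False using v0(1) by (auto simp: v_def fun_eq_iff split: if_splits)
qed

text \<open>The gradient of \<open>L\<close> is affine in the multipliers, so a relation
  \<open>m\<close> among the constraint gradients produces a whole line of points of
  \<open>LC\<close> over the same control.\<close>

lemma constraint_gradients_independent:
  assumes z: "noncritical z" and m: "\<And>u. u \<in> XD \<Longrightarrow> (\<Sum>e\<in>E. m e * pd u (g e) z) = 0"
  shows "\<forall>e\<in>E. m e = 0"
proof (rule ccontr)
  assume "\<not> ?thesis"
  then obtain e0 where e0: "e0 \<in> E" "m e0 \<noteq> 0" by blast
  obtain \<rho> where \<rho>: "\<rho> > 0" and inj: "\<And>a b. a \<in> LCs \<Longrightarrow> b \<in> LCs \<Longrightarrow> in_polydisc W z \<rho> a \<Longrightarrow>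
    in_polydisc W z \<rho> b \<Longrightarrow> proj Y a = proj Y b \<Longrightarrow> a = b"
    using proj_locally_injective[OF z] by blast
  define M where "M = 1 + (\<Sum>e\<in>E. cmod (m e))"
  have M: "cmod (m e) \<le> M" if "e \<in> E" for e
    using member_le_sum[of e E "\<lambda>e. cmod (m e)"] that finE by (simp add: M_def)
  have M1: "M \<ge> 1" by (simp add: M_def sum_nonneg)
  \<comment> \<open>Scaled so that every multiplier moves by at most \<rho>; the summand 1 in
    \<open>M\<close> keeps the divisor positive.\<close>
  define s where "s = complex_of_real (\<rho> / M)"
  have s: "s \<noteq> 0" "cmod s = \<rho> / M" using \<rho> M1 by (auto simp: s_def norm_divide)
  define z' where "z' u = (case u of Lam e \<Rightarrow> if e \<in> E then z u + s * m e else z u | _ \<Rightarrow> z u)" for u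
  have z': "z' u = z u" if "u \<notin> Lam ` E" for u using that by (auto simp: z'_def split: coord.splits)
  have z'L: "z' (Lam e) = z (Lam e) + s * m e" if "e \<in> E" for e using that by (simp add: z'_def)
  have zLC: "z \<in> LCs" using z by (simp add: noncritical_def)
  have YLam: "Y \<inter> Lam ` E = {}" using X_Y by blast
  have "z' u = z u" if "u \<in> Y" for u using YLam that by (intro z') blast
  then have prj: "proj Y z' = proj Y z" by (auto simp: proj_def fun_eq_iff)
  have gz: "pd u (g e) z' = pd u (g e) z" "g e z' = g e z" if "e \<in> E" for u e
    by (rule poly_fun_cong[OF poly_fun_pd[OF poly_g[OF that]]] poly_fun_cong[OF poly_g[OF that]], use z' in auto)+
  have Qz: "pd u (Qt C) z' = pd u (Qt C) z" for u
    by (rule poly_fun_cong[OF poly_fun_pd[OF poly_Q]]) (use z' in auto)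
  have "z' \<in> LCs"
    unfolding LC_iff
  proof (intro conjI ballI)
    have "z' u = 0" if "u \<notin> W" for u
    proof -
      have "u \<notin> Lam ` E" using that XW by blast
      then show ?thesis using z' zLC that by (simp add: LC_iff aspace_def)
    qed
    then show "z' \<in> aspace W" by (simp add: aspace_def)
    show "proj Y z' \<in> Om" using zLC prj by (simp add: LC_iff)
    fix u assume u: "u \<in> X"
    show "pd u L z' = 0"
    proof (cases "u \<in> XD")
      case True
      have "pd u L z' = pd u (Qt C) z + (\<Sum>e\<in>E. (z (Lam e) + s * m e) * pd u (g e) z)"
        unfolding pd_L_xd[OF True] Qz by (simp add: gz z'L)
      also have "\<dots> = pd u L z + s * (\<Sum>e\<in>E. m e * pd u (g e) z)"
        unfolding pd_L_xd[OF True] sum_distrib_left add.assoc sum.distrib[symmetric] by (simp add: algebra_simps)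
      finally show ?thesis using m[OF True] zLC u by (simp add: LC_iff)
    next
      case False
      then obtain e where e: "e \<in> E" "u = Lam e" using u by blast
      have "pd u L z = 0" using zLC u unfolding LC_iff by blast
      then show ?thesis using e by (simp add: pd_L_Lam gz)
    qed
  qed
  moreover have "cmod (z' u - z u) \<le> \<rho>" for u
  proof (cases "u \<in> Lam ` E")
    case True
    then obtain e where e: "e \<in> E" "u = Lam e" by blast
    then have "cmod (z' u - z u) = \<rho> / M * cmod (m e)" by (simp add: z'L norm_mult s)
    also have "\<dots> \<le> \<rho> / M * M" using M[OF e(1)] \<rho> M1 by (intro mult_left_mono) auto
    finally show ?thesis using M1 by simp
  qed (use \<rho> z' in simp)
  ultimately have "z' = z" using inj[of z' z] zLC prj \<rho> by auto
  then have "z' (Lam e0) = z (Lam e0)" by simp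
  then show False using z'L[OF e0(1)] s(1) e0(2) by simp
qed

end

section \<open>Positivity on the null space of the constraints\<close>

text \<open>A strict minimum has to exhibit a basis, and a largest independent family is one; its
  size is at most \<open>card A\<close> because all vectors are supported in
  \<open>A\<close>.\<close>

lemma real_basis_exists:
  assumes fin: "finite A" and supp: "\<And>v u. v \<in> N \<Longrightarrow> u \<notin> A \<Longrightarrow> v u = 0"
  shows "\<exists>m Vs. is_real_basis N m Vs"
proof -
  define indep where "indep m Vs \<longleftrightarrow> (\<forall>a<m. Vs a \<in> N) \<and>
     (\<forall>c. (\<forall>u. (\<Sum>a<m. c a * Vs a u) = 0) \<longrightarrow> (\<forall>a<m. c a = 0))" for m :: nat and Vs :: "nat \<Rightarrow> coord \<Rightarrow> real"
  have bound: "m \<le> card A" if "indep m Vs" for m Vs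
  proof (rule ccontr)
    assume "\<not> ?thesis"
    then have "card A < card {..<m}" by simp
    from underdetermined_system_has_nonzero_solution[OF fin _ this, of Vs]
    obtain c where c: "\<exists>a\<in>{..<m}. c a \<noteq> 0" "\<forall>u\<in>A. (\<Sum>a<m. Vs a u * c a) = 0" by auto
    have "(\<Sum>a<m. c a * Vs a u) = 0" for u
    proof (cases "u \<in> A")
      case True
      then show ?thesis using c(2) by (simp add: mult.commute)
    next
      case False
      then show ?thesis using that supp by (intro sum.neutral) (auto simp: indep_def)
    qed
    then have "\<forall>a<m. c a = 0" using that by (simp add: indep_def)
    then show False using c(1) by auto
  qed
  define m where "m = (GREATEST m. \<exists>Vs. indep m Vs)"
  have "\<exists>Vs. indep 0 Vs" by (simp add: indep_def)
  then have "\<exists>Vs. indep m Vs"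
    unfolding m_def using bound by (intro GreatestI_nat[where P = "\<lambda>m. \<exists>Vs. indep m Vs" and b = "card A"]) blast+
  then obtain Vs where Vs: "indep m Vs" by blast
  have max: "\<not> indep (Suc m) Vs'" for Vs'
  proof
    assume "indep (Suc m) Vs'"
    then have "Suc m \<le> m"
      unfolding m_def using bound by (intro Greatest_le_nat[where P = "\<lambda>m. \<exists>Vs. indep m Vs" and b = "card A"]) blast+
    then show False by simp
  qed
  have "\<exists>c. \<forall>u. v u = (\<Sum>a<m. c a * Vs a u)" if v: "v \<in> N" for v
  proof (rule ccontr)
    assume no: "\<not> ?thesis"
    have sm: "(\<Sum>a<Suc m. c a * (Vs(m := v)) a u) = (\<Sum>a<m. c a * Vs a u) + c m * v u" for c u
      by simp
    have "indep (Suc m) (Vs(m := v))"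
      unfolding indep_def
    proof (intro conjI allI impI)
      show "(Vs(m := v)) a \<in> N" if "a < Suc m" for a
        using that Vs v by (auto simp: indep_def less_Suc_eq)
      fix c :: "nat \<Rightarrow> real" and a
      assume c: "\<forall>u. (\<Sum>a<Suc m. c a * (Vs(m := v)) a u) = 0" and a: "a < Suc m"
      have c': "(\<Sum>a<m. c a * Vs a u) + c m * v u = 0" for u using c sm by simp
      have cm: "c m = 0"
      proof (rule ccontr)
        assume "c m \<noteq> 0"
        have "\<forall>u. v u = (\<Sum>a<m. (- c a / c m) * Vs a u)"
        proof
          fix u
          have "(\<Sum>a<m. (- c a / c m) * Vs a u) = - (\<Sum>a<m. c a * Vs a u) / c m"
            by (simp add: sum_negf sum_divide_distrib)
          also have "\<dots> = v u" using c'[of u] \<open>c m \<noteq> 0\<close> by (simp add: field_simps)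
          finally show "v u = (\<Sum>a<m. (- c a / c m) * Vs a u)" by simp
        qed
        then have "\<exists>c. \<forall>u. v u = (\<Sum>a<m. c a * Vs a u)" by (rule exI[of _ "\<lambda>a. - c a / c m"])
        then show False using no by contradiction
      qed
      then have "\<forall>u. (\<Sum>a<m. c a * Vs a u) = 0" using c' by simp
      then have "\<forall>a<m. c a = 0" using Vs by (simp add: indep_def)
      then show "c a = 0" using a cm by (auto simp: less_Suc_eq)
    qed
    then show False using max by blast
  qed
  then have "is_real_basis N m Vs" using Vs by (simp add: is_real_basis_def indep_def)
  then show ?thesis by blast
qed

section \<open>The projected Hessian as a quadratic form on null vectors\<close>

context tensegrity
begin

abbreviation "null \<equiv> dg_null n d B C Y"

definition Dg :: "(coord \<Rightarrow> complex) \<Rightarrow> nat \<times> nat \<Rightarrow> coord \<Rightarrow> real" where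
  "Dg z e u = Re (pd u (g e) z)"

definition Hs :: "(coord \<Rightarrow> complex) \<Rightarrow> coord \<Rightarrow> coord \<Rightarrow> real" where
  "Hs z u w = Re (hess_entry d B C z u w)"

definition qf :: "(coord \<Rightarrow> complex) \<Rightarrow> (coord \<Rightarrow> real) \<Rightarrow> real" where
  "qf z v = (\<Sum>u\<in>XD. \<Sum>w\<in>XD. v u * Hs z u w * v w)"

definition pos_on_null :: "(coord \<Rightarrow> complex) \<Rightarrow> bool" where
  "pos_on_null z \<longleftrightarrow> (\<forall>v\<in>null z. (\<exists>u. v u \<noteq> 0) \<longrightarrow> 0 < qf z v)"

lemma null_iff: "v \<in> null z \<longleftrightarrow> (\<forall>u. u \<notin> XD \<longrightarrow> v u = 0) \<and> (\<forall>e\<in>E. (\<Sum>u\<in>XD. Dg z e u * v u) = 0)"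
  by (simp add: dg_null_def Dg_def)

lemma null_sum:
  assumes "\<And>a. a \<in> I \<Longrightarrow> Vs a \<in> null z"
  shows "(\<lambda>u. \<Sum>a\<in>I. c a * Vs a u) \<in> null z"
proof -
  have "(\<Sum>u\<in>XD. Dg z e u * (\<Sum>a\<in>I. c a * Vs a u)) = 0" if "e \<in> E" for e
  proof -
    have "(\<Sum>u\<in>XD. Dg z e u * (\<Sum>a\<in>I. c a * Vs a u)) = (\<Sum>a\<in>I. c a * (\<Sum>u\<in>XD. Dg z e u * Vs a u))"
      unfolding sum_distrib_left by (subst sum.swap) (simp add: mult_ac)
    then show ?thesis using assms that by (simp add: null_iff)
  qed
  then show ?thesis using assms by (simp add: null_iff)
qed

lemma qf_sum:
  fixes m :: nat
  shows "qf z (\<lambda>u. \<Sum>a<m. c a * Vs a u) =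
    (\<Sum>a<m. \<Sum>b<m. c a * c b * (\<Sum>u\<in>XD. \<Sum>w\<in>XD. Vs a u * Hs z u w * Vs b w))"
proof -
  have inner: "(\<Sum>a<m. c a * Vs a u) * h * (\<Sum>b<m. c b * Vs b w) =
      (\<Sum>a<m. \<Sum>b<m. c a * c b * (Vs a u * h * Vs b w))" for u w h
    unfolding sum_distrib_right sum_distrib_left by (subst sum.swap) (simp add: mult_ac)
  have "qf z (\<lambda>u. \<Sum>a<m. c a * Vs a u) =
      (\<Sum>u\<in>XD. \<Sum>w\<in>XD. \<Sum>a<m. \<Sum>b<m. c a * c b * (Vs a u * Hs z u w * Vs b w))"
    unfolding qf_def inner ..
  also have "\<dots> = (\<Sum>u\<in>XD. \<Sum>a<m. \<Sum>w\<in>XD. \<Sum>b<m. c a * c b * (Vs a u * Hs z u w * Vs b w))"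
    by (intro sum.cong refl) (rule sum.swap)
  also have "\<dots> = (\<Sum>a<m. \<Sum>u\<in>XD. \<Sum>w\<in>XD. \<Sum>b<m. c a * c b * (Vs a u * Hs z u w * Vs b w))"
    by (rule sum.swap)
  also have "\<dots> = (\<Sum>a<m. \<Sum>u\<in>XD. \<Sum>b<m. \<Sum>w\<in>XD. c a * c b * (Vs a u * Hs z u w * Vs b w))"
    by (intro sum.cong refl) (rule sum.swap)
  also have "\<dots> = (\<Sum>a<m. \<Sum>b<m. \<Sum>u\<in>XD. \<Sum>w\<in>XD. c a * c b * (Vs a u * Hs z u w * Vs b w))"
    by (intro sum.cong refl) (rule sum.swap)
  finally show ?thesis by (simp add: sum_distrib_left)
qed

text \<open>Expansion in a basis matches nonzero coefficient vectors with nonzero null vectors. The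
  matrix \<open>V\<close> thereby disappears, and limits along the path need not follow a moving
  basis.\<close>

lemma strict_local_min_iff:
  "strict_local_min n d B C Y Om z \<longleftrightarrow> z \<in> LCs \<and> is_real_pt z \<and> pos_on_null z"
proof -
  have basis: "\<exists>m Vs. is_real_basis (null z) m Vs"
    by (rule real_basis_exists[OF finXD]) (simp add: null_iff)
  have eq: "(\<forall>c::nat \<Rightarrow> real. (\<exists>a<m. c a \<noteq> 0) \<longrightarrow>
           0 < (\<Sum>a<m. \<Sum>b<m. c a * c b * (\<Sum>u\<in>XD. \<Sum>w\<in>XD. Vs a u * Hs z u w * Vs b w))) \<longleftrightarrow> pos_on_null z"
    if b: "is_real_basis (null z) m Vs" for m Vs
    unfolding qf_sum[symmetric] pos_on_null_def
  proof (intro iffI allI impI ballI)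
    fix v assume H: "\<forall>c::nat \<Rightarrow> real. (\<exists>a<m. c a \<noteq> 0) \<longrightarrow> 0 < qf z (\<lambda>u. \<Sum>a<m. c a * Vs a u)"
      and v: "v \<in> null z" "\<exists>u. v u \<noteq> 0"
    obtain c where c: "\<forall>u. v u = (\<Sum>a<m. c a * Vs a u)" using b v(1) unfolding is_real_basis_def by blast
    have "\<exists>a<m. c a \<noteq> 0"
    proof (rule ccontr)
      assume "\<not> ?thesis"
      then have "\<forall>u. v u = 0" using c by simp
      then show False using v(2) by blast
    qed
    moreover have "v = (\<lambda>u. \<Sum>a<m. c a * Vs a u)" using c by auto
    ultimately show "0 < qf z v" using H by blast
  next
    fix c :: "nat \<Rightarrow> real"
    assume H: "\<forall>v\<in>null z. (\<exists>u. v u \<noteq> 0) \<longrightarrow> 0 < qf z v" and c: "\<exists>a<m. c a \<noteq> 0"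
    have "(\<lambda>u. \<Sum>a<m. c a * Vs a u) \<in> null z"
      using b by (intro null_sum) (auto simp: is_real_basis_def)
    moreover have "\<exists>u. (\<Sum>a<m. c a * Vs a u) \<noteq> 0"
      using b c by (auto simp: is_real_basis_def)
    ultimately show "0 < qf z (\<lambda>u. \<Sum>a<m. c a * Vs a u)" by (rule H[rule_format])
  qed
  have "(\<exists>m Vs. is_real_basis (null z) m Vs \<and> (\<forall>c::nat \<Rightarrow> real. (\<exists>a<m. c a \<noteq> 0) \<longrightarrow>
           0 < (\<Sum>a<m. \<Sum>b<m. c a * c b * (\<Sum>u\<in>XD. \<Sum>w\<in>XD. Vs a u * Hs z u w * Vs b w)))) \<longleftrightarrow> pos_on_null z"
    (is "?L \<longleftrightarrow> _")
  proof
    assume ?L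
    then show "pos_on_null z" using eq by (elim exE conjE) simp
  next
    assume p: "pos_on_null z"
    obtain m Vs where b: "is_real_basis (null z) m Vs" using basis by blast
    show ?L by (intro exI[of _ m] exI[of _ Vs] conjI b) (simp only: eq[OF b] p)
  qed
  then show ?thesis unfolding strict_local_min_def Hs_def by simp
qed

lemma tendsto_Dg:
  assumes "\<And>u. u \<in> W \<Longrightarrow> (\<lambda>k. zs k u) \<longlonglongrightarrow> z0 u" "e \<in> E"
  shows "(\<lambda>k. Dg (zs k) e u) \<longlonglongrightarrow> Dg z0 e u"
  unfolding Dg_def by (intro tendsto_Re tendsto_poly_fun[OF poly_fun_pd[OF poly_gW[OF assms(2)]]] assms(1))

lemma tendsto_Hs:
  assumes "\<And>u. u \<in> W \<Longrightarrow> (\<lambda>k. zs k u) \<longlonglongrightarrow> z0 u" "u \<in> XD" "w \<in> XD"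
  shows "(\<lambda>k. Hs (zs k) u w) \<longlonglongrightarrow> Hs z0 u w"
  unfolding Hs_def hess_entry_eq[OF assms(2,3)]
  by (intro tendsto_Re tendsto_poly_fun[OF poly_fun_pd[OF poly_fun_pd[OF poly_L]]] assms(1))

lemma tendsto_qf:
  assumes "\<And>u. u \<in> W \<Longrightarrow> (\<lambda>k. zs k u) \<longlonglongrightarrow> z0 u" "\<And>u. u \<in> XD \<Longrightarrow> (\<lambda>k. v k u) \<longlonglongrightarrow> v0 u"
  shows "(\<lambda>k. qf (zs k) (v k)) \<longlonglongrightarrow> qf z0 v0"
  unfolding qf_def by (intro tendsto_sum tendsto_mult tendsto_Hs assms)

lemma qf_scale: "qf z (\<lambda>u. v u / s) = qf z v / (s * s)"
  by (simp add: qf_def sum_divide_distrib mult_ac)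

text \<open>Normalised null vectors on which the form fails to be positive accumulate at a nonzero
  null vector of the limit point, where the form is still not positive.\<close>

lemma pos_on_null_open:
  assumes lim: "\<And>u. u \<in> W \<Longrightarrow> (\<lambda>k. zs k u) \<longlonglongrightarrow> z0 u" and pos: "pos_on_null z0"
  shows "\<forall>\<^sub>F k in sequentially. pos_on_null (zs k)"
proof (rule ccontr)
  assume "\<not> ?thesis"
  from not_eventually_sequentiallyD[OF this] obtain r where r: "strict_mono (r :: nat \<Rightarrow> nat)"
    "\<And>k. \<not> pos_on_null (zs (r k))" by auto
  have "\<exists>v. v \<in> null (zs (r k)) \<and> (\<exists>u. v u \<noteq> 0) \<and> qf (zs (r k)) v \<le> 0" for k
    using r(2)[of k] by (auto simp: pos_on_null_def not_less)
  then obtain v where v: "\<And>k. v k \<in> null (zs (r k))" "\<And>k. \<exists>u. v k u \<noteq> 0" "\<And>k. qf (zs (r k)) (v k) \<le> 0" by metis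
  have "\<exists>u\<in>XD. v k u \<noteq> 0" for k using v(1,2)[of k] by (auto simp: null_iff)
  from normalized_subsequence[of XD v, OF finXD this] obtain h s l where h: "strict_mono (h :: nat \<Rightarrow> nat)"
    and s: "\<And>k. s k > 0" and l0: "\<And>u. u \<in> XD \<Longrightarrow> (\<lambda>k. v (h k) u /\<^sub>R s k) \<longlonglongrightarrow> l u" and ln: "\<exists>u\<in>XD. l u \<noteq> 0"
    by blast
  define x where "x k u = v (h k) u / s k" for k u
  have l: "(\<lambda>k. x k u) \<longlonglongrightarrow> l u" if "u \<in> XD" for u
    using l0[OF that] by (simp add: x_def divide_inverse mult.commute)
  define l' where "l' u = (if u \<in> XD then l u else 0)" for u
  have l': "(\<lambda>k. x k u) \<longlonglongrightarrow> l' u" if "u \<in> XD" for u using l that by (simp add: l'_def)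
  have zl: "(\<lambda>k. zs (r (h k)) u) \<longlonglongrightarrow> z0 u" if "u \<in> W" for u
    using LIMSEQ_subseq_LIMSEQ[OF lim[OF that] strict_mono_o[OF r(1) h]] by (simp add: o_def)
  have "l' \<in> null z0"
    unfolding null_iff
  proof (intro conjI ballI allI impI)
    fix e assume e: "e \<in> E"
    have "(\<lambda>k. \<Sum>u\<in>XD. Dg (zs (r (h k))) e u * x k u) \<longlonglongrightarrow> (\<Sum>u\<in>XD. Dg z0 e u * l' u)"
      by (intro tendsto_sum tendsto_mult tendsto_Dg zl e l')
    moreover have "(\<Sum>u\<in>XD. Dg (zs (r (h k))) e u * x k u) = 0" for k
      using v(1)[of "h k"] e by (simp add: null_iff x_def sum_divide_distrib[symmetric])
    ultimately show "(\<Sum>u\<in>XD. Dg z0 e u * l' u) = 0" by (simp add: LIMSEQ_const_iff)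
  qed (simp add: l'_def)
  moreover have "\<exists>u. l' u \<noteq> 0" using ln by (auto simp: l'_def)
  moreover have "qf z0 l' \<le> 0"
  proof (rule LIMSEQ_le_const2)
    show "(\<lambda>k. qf (zs (r (h k))) (x k)) \<longlonglongrightarrow> qf z0 l'" by (intro tendsto_qf zl l')
    have "qf (zs (r (h k))) (x k) \<le> 0" for k
    proof -
      have "qf (zs (r (h k))) (x k) = qf (zs (r (h k))) (v (h k)) / (s k * s k)"
        unfolding x_def by (rule qf_scale)
      then show ?thesis using v(3)[of "h k"] s[of k] by (simp add: divide_nonpos_pos)
    qed
    then show "\<exists>N. \<forall>k\<ge>N. qf (zs (r (h k))) (x k) \<le> 0" by blast
  qed
  ultimately show False using pos by (auto simp: pos_on_null_def not_less)
qed

lemma Dg_right_inverse: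
  assumes "noncritical z" "is_real_pt z"
  shows "\<exists>b. \<forall>e\<in>E. \<forall>e'\<in>E. (\<Sum>u\<in>XD. Dg z e' u * b e u) = (if e' = e then 1 else 0)"
proof (rule independent_rows_right_inverse[OF finE finXD])
  fix m assume m: "\<forall>u\<in>XD. (\<Sum>e\<in>E. m e * Dg z e u) = 0"
  have "\<forall>e\<in>E. complex_of_real (m e) = 0"
  proof (rule constraint_gradients_independent[OF assms(1)])
    fix u assume u: "u \<in> XD"
    have "(\<Sum>e\<in>E. complex_of_real (m e) * pd u (g e) z) = complex_of_real (\<Sum>e\<in>E. m e * Dg z e u)"
      unfolding of_real_sum by (intro sum.cong refl) (subst pd_g_real[OF assms(2)], auto simp: Dg_def)
    then show "(\<Sum>e\<in>E. complex_of_real (m e) * pd u (g e) z) = 0" using m u by simp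
  qed
  then show "\<forall>e\<in>E. m e = 0" by simp
qed

text \<open>No null vector of the limit is isolated from those along the sequence, because the
  gradients at \<open>z0\<close> are independent: a right inverse \<open>b\<close> of the limit
  differential corrects \<open>v\<close> to an exact null vector, by an amount controlled by the
  defect \<open>r\<close>, which tends to 0.\<close>

lemma null_vector_approximation:
  assumes lim: "\<And>u. u \<in> W \<Longrightarrow> (\<lambda>k. zs k u) \<longlonglongrightarrow> z0 u" and z0: "noncritical z0" "is_real_pt z0" and v: "v \<in> null z0"
  shows "\<exists>N vs. (\<forall>k\<ge>N. vs k \<in> null (zs k)) \<and> (\<forall>u\<in>XD. (\<lambda>k. vs k u) \<longlonglongrightarrow> v u)"
proof -
  obtain b where b: "\<And>e e'. e \<in> E \<Longrightarrow> e' \<in> E \<Longrightarrow> (\<Sum>u\<in>XD. Dg z0 e' u * b e u) = (if e' = e then 1 else 0)"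
    using Dg_right_inverse[OF z0] by blast
  define M where "M k e' e = (\<Sum>u\<in>XD. Dg (zs k) e' u * b e u)" for k e' e
  define \<delta> where "\<delta> e' e = (if e' = e then 1 else (0::real))" for e' e :: "nat \<times> nat"
  define \<epsilon> where "\<epsilon> k = (\<Sum>e'\<in>E. \<Sum>e\<in>E. \<bar>\<delta> e' e - M k e' e\<bar>)" for k
  define r where "r k e' = (\<Sum>u\<in>XD. Dg (zs k) e' u * v u)" for k e'
  have M: "(\<lambda>k. M k e' e) \<longlonglongrightarrow> \<delta> e' e" if "e' \<in> E" "e \<in> E" for e' e
  proof -
    have "(\<lambda>k. M k e' e) \<longlonglongrightarrow> (\<Sum>u\<in>XD. Dg z0 e' u * b e u)"
      unfolding M_def by (intro tendsto_sum tendsto_mult tendsto_Dg lim that tendsto_const)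
    then show ?thesis using b that by (simp add: \<delta>_def)
  qed
  have "\<epsilon> \<longlonglongrightarrow> (\<Sum>e'\<in>E. \<Sum>e\<in>E. \<bar>\<delta> e' e - \<delta> e' e\<bar>)"
    unfolding \<epsilon>_def by (intro tendsto_sum tendsto_rabs tendsto_diff tendsto_const M)
  then have "\<epsilon> \<longlonglongrightarrow> 0" by simp
  then have "\<forall>\<^sub>F k in sequentially. \<epsilon> k < 1 / 2" by (rule order_tendstoD) simp
  \<comment> \<open>Within 1/2 of the identity \<open>M k\<close> is injective with inverse bounded
    by 2 in the sum norm, the estimate of a Neumann series.\<close>
  then obtain N where N: "\<And>k. k \<ge> N \<Longrightarrow> \<epsilon> k < 1 / 2" by (auto simp: eventually_sequentially)
  have rlim: "(\<lambda>k. \<Sum>e\<in>E. \<bar>r k e\<bar>) \<longlonglongrightarrow> 0"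
  proof -
    have "(\<lambda>k. \<Sum>e\<in>E. \<bar>r k e\<bar>) \<longlonglongrightarrow> (\<Sum>e\<in>E. \<bar>\<Sum>u\<in>XD. Dg z0 e u * v u\<bar>)"
      unfolding r_def by (intro tendsto_sum tendsto_rabs tendsto_mult tendsto_Dg lim tendsto_const)
    then show ?thesis using v by (simp add: null_iff)
  qed
  have bound: "(\<Sum>e\<in>E. \<bar>\<mu> e\<bar>) \<le> 2 * (\<Sum>e\<in>E. \<bar>\<Sum>e'\<in>E. M k e e' * \<mu> e'\<bar>)" if "k \<ge> N" for k \<mu>
  proof -
    define T where "T = (\<Sum>e\<in>E. \<bar>\<mu> e\<bar>)"
    have Tle: "\<bar>\<mu> e\<bar> \<le> T" if "e \<in> E" for e
      unfolding T_def using that finE by (intro member_le_sum) auto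
    have "\<bar>\<mu> e\<bar> \<le> \<bar>\<Sum>e'\<in>E. M k e e' * \<mu> e'\<bar> + (\<Sum>e'\<in>E. \<bar>\<delta> e e' - M k e e'\<bar> * T)" if e: "e \<in> E" for e
    proof -
      have "(\<Sum>e'\<in>E. \<delta> e e' * \<mu> e') = (\<Sum>e'\<in>E. if e' = e then \<mu> e' else 0)"
        by (intro sum.cong) (auto simp: \<delta>_def)
      then have "\<mu> e = (\<Sum>e'\<in>E. \<delta> e e' * \<mu> e')" using e finE by simp
      also have "\<dots> = (\<Sum>e'\<in>E. M k e e' * \<mu> e') + (\<Sum>e'\<in>E. (\<delta> e e' - M k e e') * \<mu> e')"
        by (simp add: sum.distrib[symmetric] algebra_simps)
      finally have "\<bar>\<mu> e\<bar> \<le> \<bar>\<Sum>e'\<in>E. M k e e' * \<mu> e'\<bar> + \<bar>\<Sum>e'\<in>E. (\<delta> e e' - M k e e') * \<mu> e'\<bar>"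
        by (metis abs_triangle_ineq)
      also have "\<bar>\<Sum>e'\<in>E. (\<delta> e e' - M k e e') * \<mu> e'\<bar> \<le> (\<Sum>e'\<in>E. \<bar>(\<delta> e e' - M k e e') * \<mu> e'\<bar>)"
        by (rule sum_abs)
      also have "\<dots> \<le> (\<Sum>e'\<in>E. \<bar>\<delta> e e' - M k e e'\<bar> * T)"
        unfolding abs_mult using Tle by (intro sum_mono mult_left_mono) auto
      finally show ?thesis by simp
    qed
    then have "T \<le> (\<Sum>e\<in>E. \<bar>\<Sum>e'\<in>E. M k e e' * \<mu> e'\<bar> + (\<Sum>e'\<in>E. \<bar>\<delta> e e' - M k e e'\<bar> * T))"
      unfolding T_def[symmetric] by (subst T_def) (rule sum_mono)
    also have "\<dots> = (\<Sum>e\<in>E. \<bar>\<Sum>e'\<in>E. M k e e' * \<mu> e'\<bar>) + \<epsilon> k * T"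
      by (simp add: sum.distrib \<epsilon>_def sum_distrib_right)
    also have "\<epsilon> k * T \<le> 1 / 2 * T"
      using N[OF that] by (intro mult_right_mono) (auto simp: T_def intro: sum_nonneg)
    finally have "T \<le> 2 * (\<Sum>e\<in>E. \<bar>\<Sum>e'\<in>E. M k e e' * \<mu> e'\<bar>)" by simp
    then show ?thesis by (simp add: T_def)
  qed
  have "\<exists>\<mu>. k \<ge> N \<longrightarrow> (\<forall>e\<in>E. (\<Sum>e'\<in>E. M k e e' * \<mu> e') = r k e)" for k
  proof (cases "k \<ge> N")
    case True
    have "\<exists>\<mu>. \<forall>e\<in>E. (\<Sum>e'\<in>E. M k e e' * \<mu> e') = r k e"
    proof (rule injective_square_system_solvable[OF finE])
      fix \<mu> assume "\<forall>e\<in>E. (\<Sum>e'\<in>E. M k e e' * \<mu> e') = 0"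
      then have "(\<Sum>e\<in>E. \<bar>\<mu> e\<bar>) \<le> 0" using bound[OF True, of \<mu>] by simp
      moreover have "\<bar>\<mu> e\<bar> \<le> (\<Sum>e\<in>E. \<bar>\<mu> e\<bar>)" if "e \<in> E" for e
        using that finE by (intro member_le_sum) auto
      ultimately show "\<forall>e\<in>E. \<mu> e = 0" by force
    qed
    then show ?thesis by blast
  qed simp
  then obtain \<mu> where \<mu>: "\<And>k e. k \<ge> N \<Longrightarrow> e \<in> E \<Longrightarrow> (\<Sum>e'\<in>E. M k e e' * \<mu> k e') = r k e" by metis
  have \<mu>lim: "(\<lambda>k. \<mu> k e) \<longlonglongrightarrow> 0" if e: "e \<in> E" for e
  proof (rule Lim_null_comparison)
    show "(\<lambda>k. 2 * (\<Sum>e\<in>E. \<bar>r k e\<bar>)) \<longlonglongrightarrow> 0"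
      using tendsto_mult[OF tendsto_const[of 2] rlim] by simp
    have "\<bar>\<mu> k e\<bar> \<le> 2 * (\<Sum>e\<in>E. \<bar>r k e\<bar>)" if "k \<ge> N" for k
    proof -
      have "\<bar>\<mu> k e\<bar> \<le> (\<Sum>e\<in>E. \<bar>\<mu> k e\<bar>)" using e finE by (intro member_le_sum) auto
      also have "\<dots> \<le> 2 * (\<Sum>e\<in>E. \<bar>\<Sum>e'\<in>E. M k e e' * \<mu> k e'\<bar>)" by (rule bound[OF that])
      also have "\<dots> = 2 * (\<Sum>e\<in>E. \<bar>r k e\<bar>)" using \<mu>[OF that] by simp
      finally show ?thesis .
    qed
    then show "\<forall>\<^sub>F k in sequentially. norm (\<mu> k e) \<le> 2 * (\<Sum>e\<in>E. \<bar>r k e\<bar>)"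
      by (auto simp: eventually_sequentially)
  qed
  define vs where "vs k u = (if u \<in> XD then v u - (\<Sum>e\<in>E. \<mu> k e * b e u) else 0)" for k u
  have "vs k \<in> null (zs k)" if k: "k \<ge> N" for k
    unfolding null_iff
  proof (intro conjI ballI allI impI)
    fix e assume e: "e \<in> E"
    have "(\<Sum>u\<in>XD. Dg (zs k) e u * vs k u) = r k e - (\<Sum>u\<in>XD. Dg (zs k) e u * (\<Sum>e'\<in>E. \<mu> k e' * b e' u))"
      by (simp add: vs_def r_def right_diff_distrib sum_subtractf)
    also have "(\<Sum>u\<in>XD. Dg (zs k) e u * (\<Sum>e'\<in>E. \<mu> k e' * b e' u)) = (\<Sum>e'\<in>E. M k e e' * \<mu> k e')"
      unfolding M_def sum_distrib_left sum_distrib_right by (subst sum.swap) (simp add: mult_ac)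
    finally show "(\<Sum>u\<in>XD. Dg (zs k) e u * vs k u) = 0" using \<mu>[OF k e] by simp
  qed (simp add: vs_def)
  moreover have "(\<lambda>k. vs k u) \<longlonglongrightarrow> v u" if u: "u \<in> XD" for u
  proof -
    have "(\<lambda>k. v u - (\<Sum>e\<in>E. \<mu> k e * b e u)) \<longlonglongrightarrow> v u - (\<Sum>e\<in>E. 0 * b e u)"
      by (intro tendsto_intros \<mu>lim)
    then show ?thesis using u by (simp add: vs_def)
  qed
  ultimately show ?thesis by blast
qed

lemma qf_nonneg_limit:
  assumes lim: "\<And>u. u \<in> W \<Longrightarrow> (\<lambda>k. zs k u) \<longlonglongrightarrow> z0 u" and z0: "noncritical z0" "is_real_pt z0"
    and pos: "\<And>k. pos_on_null (zs k)" and v: "v \<in> null z0"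
  shows "qf z0 v \<ge> 0"
proof -
  have "\<exists>N vs. (\<forall>k\<ge>N. vs k \<in> null (zs k)) \<and> (\<forall>u\<in>XD. (\<lambda>k. vs k u) \<longlonglongrightarrow> v u)"
    by (rule null_vector_approximation[OF lim z0 v])
  then obtain N vs where vs: "\<And>k. k \<ge> N \<Longrightarrow> vs k \<in> null (zs k)" "\<And>u. u \<in> XD \<Longrightarrow> (\<lambda>k. vs k u) \<longlonglongrightarrow> v u" by blast
  show ?thesis
  proof (rule LIMSEQ_le_const)
    show "(\<lambda>k. qf (zs k) (vs k)) \<longlonglongrightarrow> qf z0 v" by (intro tendsto_qf lim vs(2))
    have "qf (zs k) (vs k) \<ge> 0" if "k \<ge> N" for k
    proof (cases "\<exists>u. vs k u \<noteq> 0")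
      case True
      then show ?thesis using pos[of k] vs(1)[OF that] by (auto simp: pos_on_null_def intro: less_imp_le)
    next
      case False
      then show ?thesis by (simp add: qf_def)
    qed
    then show "\<exists>N. \<forall>k\<ge>N. 0 \<le> qf (zs k) (vs k)" by blast
  qed
qed

end

section \<open>The bordered Hessian of the Lagrangian\<close>

context tensegrity
begin

lemma sum_X: "(\<Sum>k\<in>X. f k) = (\<Sum>k\<in>XD. f k) + (\<Sum>e\<in>E. f (Lam e))"
proof -
  have "(\<Sum>k\<in>X. f k) = (\<Sum>k\<in>XD. f k) + (\<Sum>k\<in>Lam ` E. f k)"
    using finXD finE XD_Lam by (intro sum.union_disjoint) auto
  also have "(\<Sum>k\<in>Lam ` E. f k) = (\<Sum>e\<in>E. f (Lam e))"
    by (subst sum.reindex) (auto simp: inj_on_def)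
  finally show ?thesis .
qed

text \<open>The Jacobian of the gradient system in block form: the Hessian bordered by the
  constraint differential and its transpose, with a zero block because \<open>L\<close> is linear in
  the multipliers.\<close>

lemma singular_gradient_iff:
  "singular_at X (\<lambda>u. pd u L) z \<longleftrightarrow> (\<exists>x. (\<exists>u\<in>X. x u \<noteq> 0) \<and>
    (\<forall>u\<in>XD. (\<Sum>w\<in>XD. hess_entry d B C z u w * x w) + (\<Sum>e\<in>E. pd u (g e) z * x (Lam e)) = 0) \<and>
    (\<forall>e\<in>E. (\<Sum>w\<in>XD. pd w (g e) z * x w) = 0))"
proof -
  have 1: "(\<Sum>k\<in>X. pd k (pd u L) z * x k) =
      (\<Sum>w\<in>XD. hess_entry d B C z u w * x w) + (\<Sum>e\<in>E. pd u (g e) z * x (Lam e))" if "u \<in> XD" for u x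
  proof -
    have "(\<Sum>w\<in>XD. pd w (pd u L) z * x w) = (\<Sum>w\<in>XD. hess_entry d B C z u w * x w)"
      using that by (intro sum.cong) (auto simp: hess_entry_eq pd_commute[OF poly_L])
    then show ?thesis using that by (simp add: sum_X pd_Lam_pd_L)
  qed
  have 2: "(\<Sum>k\<in>X. pd k (pd (Lam e) L) z * x k) = (\<Sum>w\<in>XD. pd w (g e) z * x w)" if "e \<in> E" for e x
  proof -
    have "(\<Sum>e'\<in>E. pd (Lam e') (g e) z * x (Lam e')) = 0"
      using pd_notin[OF poly_g[OF that]] by (intro sum.neutral) auto
    then show ?thesis using that by (simp add: pd_L_Lam sum_X)
  qed
  have "(\<forall>i\<in>X. (\<Sum>k\<in>X. pd k (pd i L) z * x k) = 0) \<longleftrightarrow>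
    (\<forall>u\<in>XD. (\<Sum>w\<in>XD. hess_entry d B C z u w * x w) + (\<Sum>e\<in>E. pd u (g e) z * x (Lam e)) = 0) \<and>
    (\<forall>e\<in>E. (\<Sum>w\<in>XD. pd w (g e) z * x w) = 0)" for x
  proof -
    have "(\<forall>i\<in>X. R i) \<longleftrightarrow> (\<forall>u\<in>XD. R u) \<and> (\<forall>e\<in>E. R (Lam e))" for R by blast
    then show ?thesis using 1 2 by simp
  qed
  then show ?thesis unfolding singular_at_def by simp
qed

lemma hess_real:
  assumes "is_real_pt z" "u \<in> XD" "w \<in> XD"
  shows "hess_entry d B C z u w = complex_of_real (Hs z u w)"
  using pd2_L_real[OF assms(1), of u w] by (simp add: Hs_def hess_entry_eq[OF assms(2,3)])

lemma Hs_sym: "u \<in> XD \<Longrightarrow> w \<in> XD \<Longrightarrow> Hs z u w = Hs z w u"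
  by (simp add: Hs_def hess_entry_sym)

text \<open>Pairing the first block row with the part of a kernel vector outside the multipliers
  gives value 0 of the quadratic form on a null vector, so that part vanishes; independence of the
  gradients then removes the multiplier part. At a real point the bordered matrix is real, which
  allows real and imaginary parts to be treated separately.\<close>

lemma nonsingular_of_pos:
  assumes nc: "noncritical z" and re: "is_real_pt z" and pos: "pos_on_null z"
  shows "\<not> singular_at X (\<lambda>u. pd u L) z"
proof
  assume "singular_at X (\<lambda>u. pd u L) z"
  then obtain x where x: "\<exists>u\<in>X. x u \<noteq> 0"
    "\<And>u. u \<in> XD \<Longrightarrow> (\<Sum>w\<in>XD. hess_entry d B C z u w * x w) + (\<Sum>e\<in>E. pd u (g e) z * x (Lam e)) = 0"
    "\<And>e. e \<in> E \<Longrightarrow> (\<Sum>w\<in>XD. pd w (g e) z * x w) = 0"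
    unfolding singular_gradient_iff by blast
  have x2: "(\<Sum>w\<in>XD. complex_of_real (Hs z u w) * x w) + (\<Sum>e\<in>E. complex_of_real (Dg z e u) * x (Lam e)) = 0" if "u \<in> XD" for u
  proof -
    have "(\<Sum>w\<in>XD. complex_of_real (Hs z u w) * x w) = (\<Sum>w\<in>XD. hess_entry d B C z u w * x w)"
      using that by (intro sum.cong) (auto simp: hess_real[OF re])
    moreover have "(\<Sum>e\<in>E. complex_of_real (Dg z e u) * x (Lam e)) = (\<Sum>e\<in>E. pd u (g e) z * x (Lam e))"
      by (intro sum.cong refl) (simp add: Dg_def pd_g_real[OF re, symmetric])
    ultimately show ?thesis using x(2)[OF that] by simp
  qed
  have x3: "(\<Sum>w\<in>XD. complex_of_real (Dg z e w) * x w) = 0" if "e \<in> E" for e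
  proof -
    have "(\<Sum>w\<in>XD. complex_of_real (Dg z e w) * x w) = (\<Sum>w\<in>XD. pd w (g e) z * x w)"
      using that by (intro sum.cong refl) (simp add: Dg_def pd_g_real[OF re, symmetric])
    then show ?thesis using x(3)[OF that] by simp
  qed
  have zero: "\<forall>u\<in>XD. y u = 0"
    if y2: "\<And>u. u \<in> XD \<Longrightarrow> (\<Sum>w\<in>XD. Hs z u w * y w) + (\<Sum>e\<in>E. Dg z e u * y (Lam e)) = 0"
      and y3: "\<And>e. e \<in> E \<Longrightarrow> (\<Sum>w\<in>XD. Dg z e w * y w) = 0" for y
  proof -
    define v where "v u = (if u \<in> XD then y u else 0)" for u
    have vn: "v \<in> null z" using y3 by (auto simp: null_iff v_def)
    have "qf z v = (\<Sum>u\<in>XD. y u * (\<Sum>w\<in>XD. Hs z u w * y w))"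
      unfolding qf_def sum_distrib_left by (intro sum.cong refl) (simp add: v_def mult_ac)
    also have "\<dots> = (\<Sum>u\<in>XD. y u * (- (\<Sum>e\<in>E. Dg z e u * y (Lam e))))"
      using y2 by (intro sum.cong refl) (simp add: add_eq_0_iff2)
    also have "\<dots> = - (\<Sum>e\<in>E. y (Lam e) * (\<Sum>u\<in>XD. Dg z e u * y u))"
      unfolding sum_distrib_left sum_negf[symmetric] mult_minus_right
      by (subst sum.swap) (simp add: mult_ac)
    also have "\<dots> = 0" using y3 by simp
    finally have "qf z v = 0" .
    then have "\<forall>u. v u = 0" using pos vn unfolding pos_on_null_def by fastforce
    then show ?thesis by (metis v_def)
  qed
  have re0: "\<forall>u\<in>XD. Re (x u) = 0"
  proof (rule zero[of "\<lambda>u. Re (x u)"])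
    fix u assume "u \<in> XD"
    from arg_cong[OF x2[OF this], of Re]
    show "(\<Sum>w\<in>XD. Hs z u w * Re (x w)) + (\<Sum>e\<in>E. Dg z e u * Re (x (Lam e))) = 0" by simp
  next
    fix e assume "e \<in> E"
    from arg_cong[OF x3[OF this], of Re] show "(\<Sum>w\<in>XD. Dg z e w * Re (x w)) = 0" by simp
  qed
  have im0: "\<forall>u\<in>XD. Im (x u) = 0"
  proof (rule zero[of "\<lambda>u. Im (x u)"])
    fix u assume "u \<in> XD"
    from arg_cong[OF x2[OF this], of Im]
    show "(\<Sum>w\<in>XD. Hs z u w * Im (x w)) + (\<Sum>e\<in>E. Dg z e u * Im (x (Lam e))) = 0" by simp
  next
    fix e assume "e \<in> E"
    from arg_cong[OF x3[OF this], of Im] show "(\<Sum>w\<in>XD. Dg z e w * Im (x w)) = 0" by simp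
  qed
  have x0: "x u = 0" if "u \<in> XD" for u using re0 im0 that by (simp add: complex_eq_iff)
  have "\<forall>e\<in>E. x (Lam e) = 0"
  proof (rule constraint_gradients_independent[OF nc])
    fix u assume "u \<in> XD"
    from x(2)[OF this] show "(\<Sum>e\<in>E. x (Lam e) * pd u (g e) z) = 0"
      using x0 by (simp add: mult.commute)
  qed
  then show False using x(1) x0 by auto
qed

text \<open>A vector on which a semidefinite form vanishes lies in its radical. Hence the Hessian
  applied to \<open>v\<close> annihilates the null space and is a combination of constraint
  gradients, whose coefficients complete \<open>v\<close> to a kernel vector of the bordered
  matrix.\<close>

lemma singular_of_degenerate:
  assumes nc: "noncritical z" and re: "is_real_pt z"
    and psd: "\<And>v. v \<in> null z \<Longrightarrow> qf z v \<ge> 0" and deg: "\<not> pos_on_null z"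
  shows "singular_at X (\<lambda>u. pd u L) z"
proof -
  obtain v where v: "v \<in> null z" "\<exists>u. v u \<noteq> 0" "qf z v \<le> 0"
    using deg by (auto simp: pos_on_null_def not_less)
  have q0: "qf z v = 0" using psd[OF v(1)] v(3) by simp
  define h where "h u = (\<Sum>w\<in>XD. Hs z u w * v w)" for u
  have ortho: "(\<Sum>u\<in>XD. h u * y u) = 0" if y: "y \<in> null z" for y
  proof -
    define b where "b = (\<Sum>u\<in>XD. h u * y u)"
    have exp: "qf z (\<lambda>u. v u + s * y u) = qf z v + 2 * s * b + s * s * qf z y" for s
    proof -
      have "(\<Sum>u\<in>XD. \<Sum>w\<in>XD. v u * Hs z u w * y w) = b"
      proof -
        have "(\<Sum>u\<in>XD. \<Sum>w\<in>XD. v u * Hs z u w * y w) = (\<Sum>w\<in>XD. \<Sum>u\<in>XD. v u * Hs z u w * y w)"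
          by (rule sum.swap)
        also have "\<dots> = b"
          unfolding b_def h_def sum_distrib_right
          by (intro sum.cong refl) (simp add: Hs_sym mult_ac)
        finally show ?thesis .
      qed
      moreover have "(\<Sum>u\<in>XD. \<Sum>w\<in>XD. y u * Hs z u w * v w) = b"
        unfolding b_def h_def sum_distrib_right by (intro sum.cong refl) (simp add: mult_ac)
      moreover have "qf z (\<lambda>u. v u + s * y u) = qf z v + s * (\<Sum>u\<in>XD. \<Sum>w\<in>XD. v u * Hs z u w * y w)
          + s * (\<Sum>u\<in>XD. \<Sum>w\<in>XD. y u * Hs z u w * v w) + s * s * qf z y"
        unfolding qf_def sum_distrib_left sum.distrib[symmetric]
        by (intro sum.cong refl) (simp add: algebra_simps)
      ultimately show ?thesis by simp
    qed
    have ge: "2 * s * b + s * s * qf z y \<ge> 0" for s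
    proof -
      have "(\<lambda>u. v u + s * y u) \<in> null z"
        using null_sum[of UNIV "\<lambda>a. if a then v else y" z "\<lambda>a. if a then 1 else s"] v(1) y
        by (simp add: UNIV_bool add.commute)
      from psd[OF this] show ?thesis unfolding exp q0 by simp
    qed
    have q: "qf z y \<ge> 0" by (rule psd[OF y])
    have "b = 0"
    proof (rule ccontr)
      assume "b \<noteq> 0"
      \<comment> \<open>With \<open>s = - b / D\<close> the expression
        \<open>2 * s * b + s * s * qf z y\<close> is
        \<open>- (b * b) * (qf z y + 2) / (D * D)\<close>, hence negative; the added 1 covers the
        case \<open>qf z y = 0\<close>.\<close>
      define D where "D = qf z y + 1"
      have D: "D > 0" using q by (simp add: D_def)
      define s where "s = - b / D"
      have sD: "s * D = - b" using D by (simp add: s_def)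
      have "(2 * s * b + s * s * qf z y) * (D * D) = 2 * (s * D) * b * D + (s * D) * (s * D) * qf z y"
        by (simp add: algebra_simps)
      also have "\<dots> = - (b * b) * (qf z y + 2)" unfolding sD by (simp add: D_def algebra_simps)
      also have "\<dots> < 0"
      proof -
        have "b * b > 0" using \<open>b \<noteq> 0\<close> not_real_square_gt_zero by blast
        then show ?thesis using q by (simp add: mult_pos_pos)
      qed
      finally have "2 * s * b + s * s * qf z y < 0" using D by (simp add: mult_less_0_iff)
      then show False using ge[of s] by simp
    qed
    then show ?thesis by (simp add: b_def)
  qed
  obtain b where b: "\<And>e e'. e \<in> E \<Longrightarrow> e' \<in> E \<Longrightarrow> (\<Sum>u\<in>XD. Dg z e' u * b e u) = (if e' = e then 1 else 0)"
    using Dg_right_inverse[OF nc re] by blast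
  \<comment> \<open>The only possible choice: testing the stationarity equation against the vector
    \<open>b e\<close> of the right inverse isolates the multiplier of \<open>e\<close>.\<close>
  define \<mu> where "\<mu> e = - (\<Sum>u\<in>XD. h u * b e u)" for e
  have stat: "h u + (\<Sum>e\<in>E. Dg z e u * \<mu> e) = 0" if u: "u \<in> XD" for u
  proof -
    \<comment> \<open>The unit vector at \<open>u\<close>, moved into the null space along the right
      inverse; its orthogonality to \<open>h\<close> is the stationarity equation at
      \<open>u\<close>.\<close>
    define y where "y w = (if w \<in> XD then (if w = u then 1 else 0) - (\<Sum>e\<in>E. Dg z e u * b e w) else 0)" for w
    have delta: "(\<Sum>w\<in>XD. f w * (if w = u then 1 else 0)) = f u" for f :: "coord \<Rightarrow> real"
      using u finXD by (simp add: if_distrib cong: if_cong)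
    have ysum: "(\<Sum>w\<in>XD. f w * y w) = f u - (\<Sum>e\<in>E. Dg z e u * (\<Sum>w\<in>XD. f w * b e w))" for f
    proof -
      have "(\<Sum>w\<in>XD. f w * y w) = (\<Sum>w\<in>XD. f w * (if w = u then 1 else 0)) - (\<Sum>w\<in>XD. f w * (\<Sum>e\<in>E. Dg z e u * b e w))"
        unfolding sum_subtractf[symmetric] by (intro sum.cong refl) (simp add: y_def right_diff_distrib)
      also have "(\<Sum>w\<in>XD. f w * (\<Sum>e\<in>E. Dg z e u * b e w)) = (\<Sum>e\<in>E. Dg z e u * (\<Sum>w\<in>XD. f w * b e w))"
        unfolding sum_distrib_left by (subst sum.swap) (simp add: mult_ac)
      finally show ?thesis by (simp only: delta)
    qed
    have "y \<in> null z"
      unfolding null_iff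
    proof (intro conjI ballI allI impI)
      fix e' assume e': "e' \<in> E"
      have "(\<Sum>e\<in>E. Dg z e u * (\<Sum>w\<in>XD. Dg z e' w * b e w)) = (\<Sum>e\<in>E. if e = e' then Dg z e u else 0)"
        using e' b by (intro sum.cong refl) auto
      then show "(\<Sum>w\<in>XD. Dg z e' w * y w) = 0" unfolding ysum using e' finE by simp
    qed (simp add: y_def)
    from ortho[OF this] show ?thesis unfolding ysum by (simp add: \<mu>_def sum_negf)
  qed
  define x where "x u = (case u of Lam e \<Rightarrow> complex_of_real (\<mu> e) | _ \<Rightarrow> complex_of_real (v u))" for u
  have xL: "x (Lam e) = complex_of_real (\<mu> e)" for e by (simp add: x_def)
  have xX: "x u = complex_of_real (v u)" if "u \<in> XD" for u
    using xd_neq_Lam[OF that] by (auto simp: x_def split: coord.splits)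
  have "\<exists>u\<in>X. x u \<noteq> 0"
  proof -
    obtain u where "v u \<noteq> 0" using v(2) by blast
    moreover then have "u \<in> XD" using v(1) by (auto simp: null_iff)
    ultimately show ?thesis using xX by (intro bexI[of _ u]) auto
  qed
  moreover have "(\<Sum>w\<in>XD. hess_entry d B C z u w * x w) + (\<Sum>e\<in>E. pd u (g e) z * x (Lam e)) = 0" if u: "u \<in> XD" for u
  proof -
    have "(\<Sum>w\<in>XD. hess_entry d B C z u w * x w) = complex_of_real (h u)"
      unfolding h_def of_real_sum using u by (intro sum.cong refl) (simp add: hess_real[OF re] xX)
    moreover have "(\<Sum>e\<in>E. pd u (g e) z * x (Lam e)) = complex_of_real (\<Sum>e\<in>E. Dg z e u * \<mu> e)"
      unfolding of_real_sum by (intro sum.cong refl) (subst pd_g_real[OF re], auto simp: Dg_def xL)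
    ultimately show ?thesis using arg_cong[OF stat[OF u], of complex_of_real] by simp
  qed
  moreover have "(\<Sum>w\<in>XD. pd w (g e) z * x w) = 0" if e: "e \<in> E" for e
  proof -
    have "(\<Sum>w\<in>XD. pd w (g e) z * x w) = complex_of_real (\<Sum>w\<in>XD. Dg z e w * v w)"
      unfolding of_real_sum by (intro sum.cong refl) (subst pd_g_real[OF re e], auto simp: Dg_def xX)
    moreover have "(\<Sum>w\<in>XD. Dg z e w * v w) = 0" using v(1) e unfolding null_iff by blast
    ultimately show ?thesis by (simp only: of_real_0)
  qed
  ultimately show ?thesis unfolding singular_gradient_iff by blast
qed

section \<open>Gradient systems with frozen controls and passage to the limit\<close>

definition join :: "(coord \<Rightarrow> complex) \<Rightarrow> (coord \<Rightarrow> complex) \<Rightarrow> coord \<Rightarrow> complex" where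
  "join w y u = (if u \<in> X then w u else y u)"

text \<open>For fixed controls the gradient is a square polynomial system in the unknowns
  \<open>X\<close>, the form to which the bifurcation theorem applies.\<close>

definition grad_at :: "(coord \<Rightarrow> complex) \<Rightarrow> coord \<Rightarrow> (coord \<Rightarrow> complex) \<Rightarrow> complex" where
  "grad_at y i w = pd i L (join w y)"

lemma poly_grad_at: "grad_at y i \<in> poly_fun X"
proof -
  have "(\<lambda>w. pd i L (\<lambda>u. join w y u)) \<in> poly_fun X"
  proof (rule poly_fun_subst[OF poly_fun_pd[OF poly_L]])
    show "(\<lambda>w. join w y u) \<in> poly_fun X" for u
      by (cases "u \<in> X") (simp_all only: join_def if_True if_False pvar pconst)
  qed
  then show ?thesis by (simp add: grad_at_def[abs_def])
qed

lemma singular_grad_at: "singular_at X (grad_at y) w \<longleftrightarrow> singular_at X (\<lambda>u. pd u L) (join w y)"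
proof -
  have "pd k (grad_at y i) w = pd k (pd i L) (join w y)" if "k \<in> X" for k i
  proof -
    have "join (w(k := t)) y = (join w y)(k := t)" for t using that by (auto simp: join_def fun_eq_iff)
    moreover have "w k = join w y k" using that by (simp add: join_def)
    ultimately show ?thesis by (simp add: pd_def grad_at_def)
  qed
  then show ?thesis unfolding singular_at_def by simp
qed

lemma join_proj: "z \<in> aspace W \<Longrightarrow> join z (proj Y z) = z"
  using W_eq by (auto simp: join_def proj_def aspace_def fun_eq_iff)

lemma join_in_LC:
  assumes "y \<in> Om" "\<forall>i\<in>X. grad_at y i w = 0"
  shows "join w y \<in> LCs" "proj Y (join w y) = y"
proof -
  have y: "y u = 0" if "u \<notin> Y" for u using assms(1) Om that by (auto simp: aspace_def)
  show prj: "proj Y (join w y) = y"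
    using X_Y y by (auto simp: proj_def join_def fun_eq_iff)
  have "join w y u = 0" if "u \<notin> W" for u
    using that W_eq y by (auto simp: join_def)
  then show "join w y \<in> LCs"
    using prj assms by (auto simp: LC_iff aspace_def grad_at_def)
qed

text \<open>Local injectivity enters twice. Over the limit control it makes \<open>z0\<close> the
  only zero in the polydisc, so a singular \<open>z0\<close> would bifurcate. Over a nearby control
  it leaves \<open>zs k\<close> as the only zero, which is nonsingular, so the bifurcation theorem
  applies and its two zeros contradict uniqueness.\<close>

lemma nonsingular_limit:
  assumes nc: "noncritical z0" and LC: "\<And>k. zs k \<in> LCs"
    and lim: "\<And>u. u \<in> W \<Longrightarrow> (\<lambda>k. zs k u) \<longlonglongrightarrow> z0 u"
    and ns: "\<And>k. \<not> singular_at X (\<lambda>u. pd u L) (zs k)"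
  shows "\<not> singular_at X (\<lambda>u. pd u L) z0"
proof
  assume sing: "singular_at X (\<lambda>u. pd u L) z0"
  have z0: "z0 \<in> LCs" using nc by (simp add: noncritical_def)
  obtain \<rho> where \<rho>: "\<rho> > 0" and inj: "\<And>a b. a \<in> LCs \<Longrightarrow> b \<in> LCs \<Longrightarrow> in_polydisc W z0 \<rho> a \<Longrightarrow>
    in_polydisc W z0 \<rho> b \<Longrightarrow> proj Y a = proj Y b \<Longrightarrow> a = b"
    using proj_locally_injective[OF nc] by blast
  define y0 where "y0 = proj Y z0"
  define ys where "ys k = proj Y (zs k)" for k
  have y0: "y0 \<in> Om" and ys: "ys k \<in> Om" for k using z0 LC by (auto simp: y0_def ys_def LC_iff)
  have j0: "join z0 y0 = z0" and js: "join (zs k) (ys k) = zs k" for k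
    using z0 LC by (auto simp: y0_def ys_def LC_iff intro!: join_proj)
  have yl: "(\<lambda>k. ys k u) \<longlonglongrightarrow> y0 u" for u
    using lim YW by (auto simp: ys_def y0_def proj_def)
  have "\<exists>m>0. \<forall>G. (\<forall>i\<in>X. G i \<in> poly_fun X) \<longrightarrow>
    (\<forall>i\<in>X. \<forall>w. in_polydisc X z0 \<rho> w \<longrightarrow> cmod (G i w - grad_at y0 i w) < m) \<longrightarrow>
    (\<forall>w. in_polydisc X z0 \<rho> w \<longrightarrow> (\<forall>i\<in>X. G i w = 0) \<longrightarrow> \<not> singular_at X G w) \<longrightarrow>
    two_zeros_in X z0 \<rho> G"
  proof (rule isolated_singular_zero_bifurcates[OF finX poly_grad_at _ _ \<rho>])
    show "grad_at y0 i z0 = 0" if "i \<in> X" for i using z0 that j0 by (auto simp: grad_at_def LC_iff)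
    show "singular_at X (grad_at y0) z0" using sing by (simp add: singular_grad_at j0)
    fix w assume w: "in_polydisc X z0 \<rho> w" "\<forall>i\<in>X. grad_at y0 i w = 0"
    have "\<forall>u\<in>W. cmod (join w y0 u - z0 u) \<le> \<rho>"
      using w(1) W_eq \<rho> by (auto simp: join_def y0_def proj_def)
    then have "join w y0 = z0"
      by (rule inj[OF join_in_LC(1)[OF y0 w(2)] z0]) (use join_in_LC(2)[OF y0 w(2)] \<rho> in \<open>simp_all add: y0_def\<close>)
    then show "\<forall>u\<in>X. w u = z0 u" by (metis join_def)
  qed
  then obtain m where m: "m > 0" and bif: "\<forall>G. (\<forall>i\<in>X. G i \<in> poly_fun X) \<longrightarrow>
    (\<forall>i\<in>X. \<forall>w. in_polydisc X z0 \<rho> w \<longrightarrow> cmod (G i w - grad_at y0 i w) < m) \<longrightarrow>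
    (\<forall>w. in_polydisc X z0 \<rho> w \<longrightarrow> (\<forall>i\<in>X. G i w = 0) \<longrightarrow> \<not> singular_at X G w) \<longrightarrow>
    two_zeros_in X z0 \<rho> G"
    by (elim exE conjE)
  \<comment> \<open>Closeness uniform on the polydisc: points violating it would have a limit, at
    which both gradients tend to the same value.\<close>
  have close: "\<forall>\<^sub>F k in sequentially. \<forall>w. in_polydisc X z0 \<rho> w \<longrightarrow>
      cmod (grad_at (ys k) i w - grad_at y0 i w) < m" for i
  proof (rule ccontr)
    assume "\<not> ?thesis"
    from not_eventually_sequentiallyD[OF this] obtain r where r: "strict_mono (r :: nat \<Rightarrow> nat)"
      and ex: "\<And>k. \<exists>w. in_polydisc X z0 \<rho> w \<and> m \<le> cmod (grad_at (ys (r k)) i w - grad_at y0 i w)"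
      by (auto simp: not_less)
    from choice[OF allI[OF ex]] obtain w where w0: "\<forall>k. in_polydisc X z0 \<rho> (w k) \<and>
      m \<le> cmod (grad_at (ys (r k)) i (w k) - grad_at y0 i (w k))" by (rule exE)
    have w: "cmod (w k u - z0 u) \<le> \<rho>" if "u \<in> X" for k u using w0 that by blast
    have wm: "m \<le> cmod (grad_at (ys (r k)) i (w k) - grad_at y0 i (w k))" for k using w0 by blast
    have "norm (w k u) \<le> cmod (z0 u) + \<rho>" if "u \<in> X" for k u
      using w[OF that, of k] norm_triangle_sub[of "w k u" "z0 u"] by linarith
    from bounded_family_convergent_subsequence[of X w "\<lambda>u. cmod (z0 u) + \<rho>", OF finX this]
    obtain h l where h: "strict_mono (h :: nat \<Rightarrow> nat)" and l: "\<And>u. u \<in> X \<Longrightarrow> (\<lambda>k. w (h k) u) \<longlonglongrightarrow> l u" by blast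
    have 1: "(\<lambda>k. grad_at (ys (r (h k))) i (w (h k))) \<longlonglongrightarrow> grad_at y0 i l"
      unfolding grad_at_def
    proof (rule tendsto_poly_fun[OF poly_fun_pd[OF poly_L]])
      fix u
      show "(\<lambda>k. join (w (h k)) (ys (r (h k))) u) \<longlonglongrightarrow> join l y0 u"
        using l LIMSEQ_subseq_LIMSEQ[OF yl strict_mono_o[OF r h], of u] by (simp add: join_def o_def)
    qed
    have 2: "(\<lambda>k. grad_at y0 i (w (h k))) \<longlonglongrightarrow> grad_at y0 i l"
      by (rule tendsto_poly_fun[OF poly_grad_at l])
    from tendsto_norm[OF tendsto_diff[OF 1 2]]
    have "(\<lambda>k. cmod (grad_at (ys (r (h k))) i (w (h k)) - grad_at y0 i (w (h k)))) \<longlonglongrightarrow> 0" by simp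
    then have "m \<le> 0" by (rule LIMSEQ_le_const) (use wm in blast)
    then show False using m by simp
  qed
  have ev1: "\<forall>\<^sub>F k in sequentially. \<forall>i\<in>X. \<forall>w. in_polydisc X z0 \<rho> w \<longrightarrow>
      cmod (grad_at (ys k) i w - grad_at y0 i w) < m"
    by (rule eventually_ball_finite[OF finX]) (use close in blast)
  have ev2: "\<forall>\<^sub>F k in sequentially. \<forall>u\<in>W. cmod (zs k u - z0 u) < \<rho>"
    by (rule eventually_close[OF finW lim \<rho>])
  obtain k where k: "\<forall>i\<in>X. \<forall>w. in_polydisc X z0 \<rho> w \<longrightarrow>
      cmod (grad_at (ys k) i w - grad_at y0 i w) < m" "\<forall>u\<in>W. cmod (zs k u - z0 u) < \<rho>"
    using eventually_happens'[OF sequentially_bot eventually_conj[OF ev1 ev2]] by blast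
  have uniq: "join w (ys k) = zs k" if w: "in_polydisc X z0 \<rho> w" "\<forall>i\<in>X. grad_at (ys k) i w = 0" for w
  proof (rule inj)
    show "join w (ys k) \<in> LCs" "proj Y (join w (ys k)) = proj Y (zs k)"
      using join_in_LC[OF ys w(2)] by (simp_all add: ys_def)
    show "\<forall>u\<in>W. cmod (join w (ys k) u - z0 u) \<le> \<rho>"
    proof
      fix u assume u: "u \<in> W"
      show "cmod (join w (ys k) u - z0 u) \<le> \<rho>"
      proof (cases "u \<in> X")
        case True
        then show ?thesis using w(1) by (simp add: join_def)
      next
        case False
        then have "join w (ys k) u = zs k u" using u W_eq by (auto simp: join_def ys_def proj_def)
        then show ?thesis using k(2) u by (simp add: less_imp_le)
      qed
    qed
    show "in_polydisc W z0 \<rho> (zs k)" using k(2) by (auto intro: less_imp_le)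
  qed (rule LC)
  have "two_zeros_in X z0 \<rho> (grad_at (ys k))"
    by (rule bif[THEN spec, THEN mp, THEN mp, THEN mp]) (use k(1) ns uniq in \<open>auto simp: poly_grad_at singular_grad_at\<close>)
  then obtain w w' u where "in_polydisc X z0 \<rho> w" "in_polydisc X z0 \<rho> w'"
    "\<forall>i\<in>X. grad_at (ys k) i w = 0" "\<forall>i\<in>X. grad_at (ys k) i w' = 0" "u \<in> X" "w u \<noteq> w' u" by blast
  then show False using uniq[of w] uniq[of w'] by (metis join_def)
qed

lemma pos_on_null_limit:
  assumes nc: "\<And>k. noncritical (zs k)" "noncritical z0" and re: "\<And>k. is_real_pt (zs k)" "is_real_pt z0"
    and lim: "\<And>u. u \<in> W \<Longrightarrow> (\<lambda>k. zs k u) \<longlonglongrightarrow> z0 u" and pos: "\<And>k. pos_on_null (zs k)"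
  shows "pos_on_null z0"
proof (rule ccontr)
  assume deg: "\<not> pos_on_null z0"
  have psd: "qf z0 v \<ge> 0" if "v \<in> null z0" for v
    by (rule qf_nonneg_limit[OF lim nc(2) re(2) pos that])
  have "singular_at X (\<lambda>u. pd u L) z0"
    by (rule singular_of_degenerate[OF nc(2) re(2) psd deg])
  moreover have "\<not> singular_at X (\<lambda>u. pd u L) z0"
  proof (rule nonsingular_limit[OF nc(2) _ lim])
    show "zs k \<in> LCs" for k using nc(1)[of k] by (simp add: noncritical_def)
    show "\<not> singular_at X (\<lambda>u. pd u L) (zs k)" for k
      by (rule nonsingular_of_pos[OF nc(1) re(1) pos])
  qed
  ultimately show False by blast
qed

lemma real_pt_open:
  assumes nc: "noncritical z0" and re0: "is_real_pt z0" and LC: "\<And>k. zs k \<in> LCs" "\<And>k. is_real_pt (proj Y (zs k))"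
    and lim: "\<And>u. u \<in> W \<Longrightarrow> (\<lambda>k. zs k u) \<longlonglongrightarrow> z0 u"
  shows "\<forall>\<^sub>F k in sequentially. is_real_pt (zs k)"
proof -
  obtain \<rho> where \<rho>: "\<rho> > 0" and inj: "\<And>a b. a \<in> LCs \<Longrightarrow> b \<in> LCs \<Longrightarrow> in_polydisc W z0 \<rho> a \<Longrightarrow>
    in_polydisc W z0 \<rho> b \<Longrightarrow> proj Y a = proj Y b \<Longrightarrow> a = b"
    using proj_locally_injective[OF nc] by blast
  have "\<forall>\<^sub>F k in sequentially. \<forall>u\<in>W. cmod (zs k u - z0 u) < \<rho>"
    by (rule eventually_close[OF finW lim \<rho>])
  then show ?thesis
  proof eventually_elim
    case (elim k)
    define c where "c u = cnj (zs k u)" for u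
    \<comment> \<open>The control is real, so the conjugate point has the same projection and in
      particular lies over \<open>Om\<close>.\<close>
    have pc: "proj Y c = proj Y (zs k)"
      using LC(2)[of k] unfolding cnj_real_pt by (auto simp: proj_def c_def fun_eq_iff split: if_splits)
    have "pd u L c = 0" if "u \<in> X" for u
    proof -
      have "pd u L (zs k) = 0" using LC(1)[of k] that unfolding LC_iff by blast
      then show ?thesis unfolding c_def pd_cnj[OF poly_L cnj_L] by simp
    qed
    then have "c \<in> LCs" using LC(1)[of k] pc by (auto simp: LC_iff aspace_def c_def)
    moreover have "cmod (c u - z0 u) = cmod (zs k u - z0 u)" for u
    proof -
      have "z0 u = cnj (z0 u)" using re0 unfolding cnj_real_pt by (metis (full_types))
      then have "c u - z0 u = cnj (zs k u - z0 u)" by (simp add: c_def)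
      then show ?thesis by (metis complex_mod_cnj)
    qed
    ultimately have "c = zs k"
      using elim by (intro inj[OF _ LC(1) _ _ pc]) (auto intro: less_imp_le)
    then show ?case by (simp add: cnj_real_pt c_def[abs_def])
  qed
qed

end

section \<open>Strict local minima along the lift\<close>

text \<open>Connectedness of the interval, with openness and closedness phrased by sequences to fit
  the limit lemmas.\<close>

lemma unit_interval_clopen_induct:
  fixes S :: "real set"
  assumes "0 \<in> S"
    and op: "\<And>t s. t \<in> {0..1} \<Longrightarrow> t \<in> S \<Longrightarrow> (\<And>k. s k \<in> {0..1}) \<Longrightarrow> s \<longlonglongrightarrow> t \<Longrightarrow> \<forall>\<^sub>F k in sequentially. s k \<in> S"
    and cl: "\<And>t s. t \<in> {0..1} \<Longrightarrow> (\<And>k. s k \<in> {0..1} \<inter> S) \<Longrightarrow> s \<longlonglongrightarrow> t \<Longrightarrow> t \<in> S"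
  shows "{0..1} \<subseteq> S"
proof -
  define I where "I = {0..1::real}"
  have lim: "t \<in> I" if "\<And>k. s k \<in> I" "s \<longlonglongrightarrow> t" for s t
    using closed_sequentially[of I s t] that by (auto simp: I_def)
  have "closed (I \<inter> S)"
    unfolding closed_sequential_limits using cl lim unfolding I_def by (metis IntD1 IntI)
  moreover have "closed (I - S)"
    unfolding closed_sequential_limits
  proof (intro allI impI)
    fix s t assume st: "(\<forall>k. s k \<in> I - S) \<and> s \<longlonglongrightarrow> t"
    then have tI: "t \<in> I" using lim by blast
    have "t \<notin> S"
    proof
      assume "t \<in> S"
      then have "\<forall>\<^sub>F k in sequentially. s k \<in> S" using op[of t s] st tI by (auto simp: I_def)
      then have "\<forall>\<^sub>F k::nat in sequentially. False" using st by (auto elim: eventually_mono)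
      then show False by simp
    qed
    then show "t \<in> I - S" using tI by blast
  qed
  moreover have "connected I" by (simp add: I_def)
  ultimately have "(I \<inter> S) \<inter> I = {} \<or> (I - S) \<inter> I = {}"
    by (intro connected_closedD) auto
  moreover have "0 \<in> I" by (simp add: I_def)
  ultimately have "I \<subseteq> S" using assms(1) by blast
  then show ?thesis by (simp add: I_def)
qed

lemma smooth_on_imp_continuous_on:
  assumes "smooth_on S f"
  shows "continuous_on S f"
proof -
  obtain D where D: "D 0 = f" "\<forall>k. \<forall>t\<in>S. (D k has_vector_derivative D (Suc k) t) (at t within S)"
    using assms unfolding smooth_on_def by blast
  have "(f has_vector_derivative D (Suc 0) t) (at t within S)" if "t \<in> S" for t
    using D(2)[rule_format, of t 0] that D(1) by simp
  then show ?thesis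
    unfolding continuous_on_eq_continuous_within using has_vector_derivative_continuous by blast
qed

theorem mainTheorem3:
  fixes n d :: nat
    and B C :: "(nat \<times> nat) set"
    and Y :: "coord set"
    and Om :: "(coord \<Rightarrow> complex) set"
    and y z :: "real \<Rightarrow> coord \<Rightarrow> complex"
  assumes edges: "B \<union> C \<subseteq> {(i, j). 1 \<le> i \<and> i < j \<and> j \<le> n}"
    and disj: "B \<inter> C = {}"
    and ctrl: "Y \<subseteq> tvars n d B C"
    and Om_var: "zclosed Y Om"
    and Om_real_dim: "vdim Y (zclosure Y {w \<in> Om. is_real_pt w}) = vdim Y Om"
    and compl_int: "\<forall>yy \<in> aspace Y.
        (\<forall>w \<in> {w \<in> aspace (xd_vars n d B C Y). \<forall>e\<in>B \<union> C. gfun d B e (\<lambda>u. w u + yy u) = 0}.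
           local_dim (xd_vars n d B C Y)
             {w \<in> aspace (xd_vars n d B C Y). \<forall>e\<in>B \<union> C. gfun d B e (\<lambda>u. w u + yy u) = 0} w
           = card (xd_vars n d B C Y) - card (B \<union> C))"
    and y_path: "\<forall>t\<in>{0..1}. y t \<in> Om \<and> is_real_pt (y t)"
    and y_smooth: "\<forall>u. smooth_on {0..1} (\<lambda>t. y t u)"
    and z0_reg: "z 0 \<in> LC_reg n d B C Y Om"
    and z0_proj: "proj Y (z 0) = y 0"
    and z0_dim: "cdim (tangent_space (all_vars n d B C) (LC n d B C Y Om) (z 0))
                 = cdim (tangent_space Y Om (y 0))"
    and no_disc: "\<forall>t\<in>{0..1}. y t \<notin> cat_disc n d B C Y Om"
    and z_lift: "\<forall>t\<in>{0..1}. z t \<in> LC n d B C Y Om \<and> proj Y (z t) = y t"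
    and z_smooth: "\<forall>u. smooth_on {0..1} (\<lambda>t. z t u)"
    and z0_min: "strict_local_min n d B C Y Om (z 0)"
  shows "\<forall>t\<in>{0..1}. strict_local_min n d B C Y Om (z t)"
proof -
  have "Om \<subseteq> aspace Y" using Om_var by (auto simp: zclosed_def zero_set_def)
  then interpret tensegrity n d B C Y Om
    using edges ctrl by unfold_locales
  have LCz: "z t \<in> LCs" "proj Y (z t) = y t" if "t \<in> {0..1}" for t using z_lift that by auto
  have nc: "noncritical (z t)" if "t \<in> {0..1}" for t
    using LCz[OF that] no_disc that by (intro noncritical_off_discriminant) auto
  have cont: "(\<lambda>k. z (s k) u) \<longlonglongrightarrow> z t u" if "t \<in> {0..1}" "\<And>k. s k \<in> {0..1}" "s \<longlonglongrightarrow> t" for s t u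
  proof -
    have "continuous_on {0..1} (\<lambda>t. z t u)" using z_smooth smooth_on_imp_continuous_on by blast
    then show ?thesis using that by (intro continuous_on_tendsto_compose[of "{0..1}" "\<lambda>t. z t u"]) auto
  qed
  have min0: "is_real_pt (z 0)" "pos_on_null (z 0)" using z0_min by (auto simp: strict_local_min_iff)
  \<comment> \<open>Reality is propagated before positivity, since the limit argument for positivity
    is carried out at real points.\<close>
  have "{0..1} \<subseteq> {t. is_real_pt (z t)}"
  proof (rule unit_interval_clopen_induct)
    show "0 \<in> {t. is_real_pt (z t)}" using min0 by simp
    show "\<forall>\<^sub>F k in sequentially. s k \<in> {t. is_real_pt (z t)}"
      if t: "t \<in> {0..1}" "t \<in> {t. is_real_pt (z t)}" and s: "\<And>k. s k \<in> {0..1}" "s \<longlonglongrightarrow> t" for t s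
    proof -
      have "\<forall>\<^sub>F k in sequentially. is_real_pt (z (s k))"
        by (rule real_pt_open[OF nc[OF t(1)] _ _ _ cont[OF t(1) s]]) (use t s LCz y_path in auto)
      then show ?thesis by simp
    qed
    show "t \<in> {t. is_real_pt (z t)}"
      if t: "t \<in> {0..1}" and s: "\<And>k. s k \<in> {0..1} \<inter> {t. is_real_pt (z t)}" "s \<longlonglongrightarrow> t" for t s
    proof -
      have "Im (z t u) = 0" for u
      proof -
        have "(\<lambda>k. Im (z (s k) u)) \<longlonglongrightarrow> Im (z t u)"
          using s by (intro tendsto_Im cont t) auto
        moreover have "Im (z (s k) u) = 0" for k using s(1)[of k] by (simp add: is_real_pt_def)
        ultimately show ?thesis by (simp add: LIMSEQ_const_iff)
      qed
      then show ?thesis by (simp add: is_real_pt_def)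
    qed
  qed
  then have re: "is_real_pt (z t)" if "t \<in> {0..1}" for t using that by blast
  have "{0..1} \<subseteq> {t. pos_on_null (z t)}"
  proof (rule unit_interval_clopen_induct)
    show "0 \<in> {t. pos_on_null (z t)}" using min0 by simp
    show "\<forall>\<^sub>F k in sequentially. s k \<in> {t. pos_on_null (z t)}"
      if t: "t \<in> {0..1}" "t \<in> {t. pos_on_null (z t)}" and s: "\<And>k. s k \<in> {0..1}" "s \<longlonglongrightarrow> t" for t s
      using pos_on_null_open[of "\<lambda>k. z (s k)" "z t", OF cont[OF t(1) s]] t(2) by simp
    show "t \<in> {t. pos_on_null (z t)}"
      if t: "t \<in> {0..1}" and s: "\<And>k. s k \<in> {0..1} \<inter> {t. pos_on_null (z t)}" "s \<longlonglongrightarrow> t" for t s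
    proof -
      have s1: "s k \<in> {0..1}" "pos_on_null (z (s k))" for k using s(1)[of k] by auto
      have "pos_on_null (z t)"
        by (rule pos_on_null_limit[OF nc[OF s1(1)] nc[OF t] re[OF s1(1)] re[OF t] cont[OF t s1(1) s(2)] s1(2)])
      then show ?thesis by simp
    qed
  qed
  then show ?thesis using LCz re by (auto simp: strict_local_min_iff)
qed

end
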